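(* There is an absolute constant $K>0$ such that the following holds. Let $N\ge1$ be an integer, $F=\left(e^{2\pi i(j-1)(k-1)/N}\right)_{j,k=1}^N\in\mathbb{C}^{N\times N}$, let $S\subset[N]$ be an arbitrary nonempty subset, $T\subset[N]$ a nonempty cyclically contiguous subset, and $\alpha=\max(|S|,|T|)/N$. Then $$\log\kappa(F_{S,T})\le\frac{2N}{\pi}\int_0^{\frac{\alpha\pi}{2}}\log\cot\phi\,d\phi+K\left|\log(\alpha(1-\alpha))\right|.$$ If both $S,T\subset[N]$ are (nonempty) cyclically contiguous subsets, then $$\log\kappa(F_{S,T})\le\frac{2N}{\pi}\int_0^{\frac{\alpha\pi}{2}}\log\cot\phi\,d\phi-\frac12\log N+K\left|\log(\alpha(1-\alpha))\right|,$$ and equality is achieved up to the error term when $|S|=|T|$: if $S,T$ are both cyclically contiguous and $|S|=|T|$, then $$\left|\log\kappa(F_{S,T})-\left(\frac{2N}{\pi}\int_0^{\frac{\alpha\pi}{2}}\log\cot\phi\,d\phi-\frac12\log N\right)\right|\le K\left|\log(\alpha(1-\alpha))\right|.$$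
   Context: $[N]=\{1,\ldots,N\}$. A subset $S\subset[N]$ is cyclically contiguous if it equals a set of consecutive integers modulo $N$. For $A\in\mathbb{C}^{N\times N}$ and $S,T\subset[N]$, $A_{S,T}$ is the $|S|\times|T|$ submatrix of $A$ with rows indexed by $S$ and columns indexed by $T$, and $\kappa(A_{S,T})=\sigma_1(A_{S,T})/\sigma_{\min(|S|,|T|)}(A_{S,T})$ is its condition number, with $\sigma_1\ge\sigma_2\ge\cdots$ the singular values. When $\alpha=1$ the error term $|\log(\alpha(1-\alpha))|$ is interpreted as $+\infty$, so the assertions are vacuous. (The terms with $K$ spell out the notation $\pm O(\log\alpha(1-\alpha))$.) *)

theory Defs
  imports
    "HOL-Analysis.Analysis"
    "Jordan_Normal_Form.Schur_Decomposition"
    "Jordan_Normal_Form.DL_Submatrix"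
begin

text \<open>Indices run over \<open>{..<N}\<close>, matching the 0-based indexing of \<open>complex mat\<close>; the index
  \<open>j\<close> here is \<open>j - 1\<close> in the 1-based convention \<open>[N] = {1..N}\<close>.\<close>

definition fourier_matrix :: "nat \<Rightarrow> complex mat" where
  "fourier_matrix N = Matrix.mat N N (\<lambda>(j, k). exp (2 * of_real pi * \<i> * of_nat j * of_nat k / of_nat N))"

definition cyclically_contiguous :: "nat \<Rightarrow> nat set \<Rightarrow> bool" where
  "cyclically_contiguous N S \<longleftrightarrow> (\<exists>a l. S = (\<lambda>i. i mod N) ` {a..<a + l})"

text \<open>Square roots of the eigenvalues of \<open>A\<^sup>* A\<close>, with algebraic multiplicity, in decreasing order.
  The list has length \<open>dim_col A\<close>: if \<open>dim_row A < dim_col A\<close>, the entries after the first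
  \<open>dim_row A\<close> are zeros. The real part is taken only to change types, as \<open>A\<^sup>* A\<close> is positive
  semidefinite.\<close>

definition singular_values :: "complex mat \<Rightarrow> real list" where
  "singular_values A =
     rev (sorted_list_of_multiset
       (image_mset (\<lambda>z. sqrt (Re z)) (proots (char_poly (mat_adjoint A * A)))))"

text \<open>The quotient is taken in \<open>ereal\<close>, so that a nonzero matrix of deficient rank has condition
  number \<open>\<infinity>\<close>.\<close>

definition condition_number :: "complex mat \<Rightarrow> ereal" where
  "condition_number A =
     ereal (singular_values A ! 0) /
     ereal (singular_values A ! (min (dim_row A) (dim_col A) - 1))"

text \<open>The natural logarithm on \<open>[0, \<infinity>]\<close>, with \<open>log 0 = - \<infinity>\<close>; negative arguments are irrelevant.\<close>

definition ln_ereal :: "ereal \<Rightarrow> ereal" where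
  "ln_ereal x = (if x = \<infinity> then \<infinity> else if x \<le> 0 then - \<infinity> else ereal (ln (real_of_ereal x)))"

text \<open>The junk values \<open>ln (cot 0) = 0\<close> and \<open>ln (cot (pi / 2)) = 0\<close> at the endpoints do not affect the
  integral.\<close>

definition log_cot_term :: "nat \<Rightarrow> real \<Rightarrow> real" where
  "log_cot_term N \<alpha> = 2 * real N / pi * integral {0..\<alpha> * pi / 2} (\<lambda>\<phi>. ln (cot \<phi>))"

text \<open>The value at \<open>\<alpha> = 1\<close> is \<open>\<infinity>\<close>.\<close>

definition log_error :: "real \<Rightarrow> ereal" where
  "log_error \<alpha> = \<bar>ln_ereal (ereal (\<alpha> * (1 - \<alpha>)))\<bar>"

end

theory Submission
  imports Defs "HOL-Real_Asymp.Real_Asymp" "Jordan_Normal_Form.Spectral_Radius"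
    "Jordan_Normal_Form.Jordan_Normal_Form_Existence"
begin

text \<open>
Put \<open>n = max (card S) (card T)\<close> and \<open>q = exp (2\<pi>i/N)\<close>. Up to unimodular factors of the rows, the
matrix evaluates polynomials at the nodes \<open>q\<^sup>s\<close> with \<open>s\<close> in \<open>S\<close>. Its largest singular value lies between
\<open>sqrt n\<close> and \<open>sqrt N\<close>, so the theorem is about the smallest one, that is, about the stability of
interpolation at \<open>n\<close> of the \<open>N\<close>-th roots of unity. The reciprocal of the square of the smallest
singular value is at most the sum of the squared coefficient norms of the Lagrange
basis polynomials (\<open>interpolation_lower_bound\<close>, and \<open>interpolation_dual_lower_bound\<close> if \<open>S\<close> is the smaller set). By Parseval these norms are averages of
\<open>|\<ell>_s(q\<^sup>j)|\<^sup>2\<close> over all \<open>j\<close>, and every such value is an explicit product of distances between roots of unity.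

For arbitrary nodes, each value is largest when the nodes form an arc around \<open>q\<^sup>s\<close>, which gives
\<open>|\<ell>_s(q\<^sup>j)| \<le> 2E\<close> (\<open>norm_lagrange_basis_le\<close>) with one quantity \<open>E\<close>, the \<open>extremal_ratio\<close>. If the nodes
themselves form an arc and \<open>\<alpha>\<close> stays away from \<open>0\<close> and \<open>1\<close>, then only about \<open>sqrt N\<close> nodes and
\<open>sqrt N\<close> points \<open>j\<close> contribute values of size \<open>E\<close>.
No asymptotic analysis is needed to see this: the polynomial that vanishes on an arc has coefficients
whose moduli are Gaussian binomial coefficients at \<open>q\<close> (\<open>coeff_arc_poly\<close>), so Parseval evaluates the sums
over \<open>j\<close> exactly, and the estimate \<open>\<Sum>B\<^sup>2 \<le> (max B) * (\<Sum>B)\<close> produces \<open>E\<close> again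
(\<open>interpolation_constant_arc_le\<close>). This saves the factor \<open>sqrt N\<close> in the condition number.

The same identities prove that the arc estimate is sharp. The values of the Lagrange basis off an arc
form, after unimodular scalings, a positive matrix that dominates one of rank one; testing it yields
\<open>arc_extremal_polynomial\<close>, where log-concavity of the binomials reverses the estimate of \<open>\<Sum>B\<^sup>2\<close>.

Finally \<open>E\<close> is a product of cosines over a product of sines, and \<open>ln E\<close> is a Riemann sum for the
integral of \<open>ln cot\<close>. Stirling's formula for the singular part of the sines contributes the term \<open>- ln N\<close>
(\<open>product_quotient_estimate\<close>). Constant factors never matter, because
\<open>|ln (\<alpha>(1 - \<alpha>))| \<ge> ln 4 > 1\<close>.
\<close>

section \<open>Riemann sums for the logarithm of the cotangent\<close>

lemma abs_mult_right_mono: "\<bar>a\<bar> \<le> b \<Longrightarrow> 0 < c \<Longrightarrow> \<bar>a * c\<bar> \<le> b * (c::real)"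
  by (simp add: abs_mult)

lemma antimono_integral_bounds:
  fixes g :: "real \<Rightarrow> real"
  assumes "antimono_on {a..b} g" "continuous_on {a..b} g" "a \<le> b"
  shows "(b - a) * g b \<le> integral {a..b} g" "integral {a..b} g \<le> (b - a) * g a"
proof -
  have int: "g integrable_on {a..b}" using assms(2) by (rule integrable_continuous_real)
  have "integral {a..b} (\<lambda>_. g b) \<le> integral {a..b} g"
    using int assms by (intro integral_le) (auto simp: monotone_on_def)
  then show "(b - a) * g b \<le> integral {a..b} g" using assms(3) by simp
  have "integral {a..b} g \<le> integral {a..b} (\<lambda>_. g a)"
    using int assms by (intro integral_le) (auto simp: monotone_on_def)
  then show "integral {a..b} g \<le> (b - a) * g a" using assms(3) by simp
qed

text \<open>Each sample of a monotone function lies between its averages over the two adjacent cells, so the sum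
  is squeezed between two integrals that differ by at most \<open>h\<close> times the total decrease \<open>- g x\<close>. The offset \<open>d\<close> covers midpoints
  (\<open>d = 1/2\<close>) and right end points (\<open>d = 1\<close>): which of the two occurs depends on a parity.\<close>

lemma antimono_Riemann_sum:
  fixes g :: "real \<Rightarrow> real"
  assumes g: "antimono_on {0..x} g" "continuous_on {0..x} g" "g 0 = 0"
    and h: "0 < h" "0 < d" "d \<le> 1" and x: "0 \<le> x" "x \<le> (real m + d) * h" "m = 0 \<or> (real m - 1 + d) * h \<le> x"
  shows "\<bar>h * (\<Sum>k<m. g ((real k + d) * h)) - integral {0..x} g\<bar> \<le> - h * g x"
proof -
  have sub: "(b - a) * g b \<le> integral {a..b} g \<and> integral {a..b} g \<le> (b - a) * g a"
    if "0 \<le> a" "a \<le> b" "b \<le> x" for a b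
    using that g(1,2) by (intro conjI antimono_integral_bounds)
      (auto intro: monotone_on_subset continuous_on_subset)
  have comb: "integral {0..a} g + integral {a..b} g = integral {0..b} g"
    if "0 \<le> a" "a \<le> b" "b \<le> x" for a b
    using that g(2) by (intro Henstock_Kurzweil_Integration.integral_combine integrable_continuous_real)
      (auto intro: continuous_on_subset)
  have le0: "g t \<le> 0" if "0 \<le> t" "t \<le> x" for t
    using g(1,3) that monotone_onD[OF g(1), of 0 t] by simp
  define p where "p = (\<lambda>k::nat. (real k + d) * h)"
  have p0: "0 \<le> p k" for k using h by (auto simp: p_def)
  have pS: "p (Suc k) = p k + h" for k by (simp add: p_def algebra_simps)
  have pd: "p 0 \<le> h" using h by (simp add: p_def)
  have up: "h * (\<Sum>k<Suc k. g (p k)) \<le> integral {0..p k} g" if "p k \<le> x" for k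
    using that
  proof (induction k)
    case 0
    have "integral {0..p 0} g \<ge> (p 0 - 0) * g (p 0)" using sub[of 0 "p 0"] 0 p0 by auto
    moreover have "(p 0 - 0) * g (p 0) \<ge> h * g (p 0)" using pd le0[OF p0 0]
      by (simp add: mult_right_mono_neg)
    ultimately show ?case by simp
  next
    case (Suc k)
    have "integral {p k..p (Suc k)} g \<ge> h * g (p (Suc k))"
      using sub[of "p k" "p (Suc k)"] Suc.prems p0 h by (auto simp: pS)
    moreover have "integral {0..p k} g + integral {p k..p (Suc k)} g = integral {0..p (Suc k)} g"
      using Suc.prems p0 h by (intro comb) (auto simp: pS)
    moreover have "h * (\<Sum>k<Suc k. g (p k)) \<le> integral {0..p k} g" using Suc h by (simp add: pS)
    ultimately show ?case by (simp add: algebra_simps)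
  qed
  have lo: "integral {0..p k} g \<le> h * (\<Sum>k<k. g (p k))" if "p k \<le> x" for k
    using that
  proof (induction k)
    case 0
    have "integral {0..p 0} g \<le> (p 0 - 0) * g 0" using sub[of 0 "p 0"] 0 p0 by auto
    then show ?case using g(3) by simp
  next
    case (Suc k)
    have "integral {p k..p (Suc k)} g \<le> h * g (p k)"
      using sub[of "p k" "p (Suc k)"] Suc.prems p0 h by (auto simp: pS)
    moreover have "integral {0..p k} g + integral {p k..p (Suc k)} g = integral {0..p (Suc k)} g"
      using Suc.prems p0 h by (intro comb) (auto simp: pS)
    moreover have "integral {0..p k} g \<le> h * (\<Sum>k<k. g (p k))" using Suc h by (simp add: pS)
    ultimately show ?case by (simp add: algebra_simps)
  qed
  show ?thesis
  proof (cases m)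
    case 0
    have "integral {0..x} g \<ge> x * g x" "integral {0..x} g \<le> x * g 0" using sub[of 0 x] x by auto
    moreover have "x * g x \<ge> h * g x"
    proof -
      have "x \<le> d * h" using x 0 by simp
      also have "\<dots> \<le> h" using h by simp
      finally show ?thesis using le0[of x] x by (simp add: mult_right_mono_neg)
    qed
    ultimately show ?thesis using 0 g(3) by simp
  next
    case (Suc k)
    have px: "p k \<le> x" "x \<le> p k + h" using x Suc by (auto simp: p_def algebra_simps)
    have c: "integral {0..p k} g + integral {p k..x} g = integral {0..x} g"
      using px p0 by (intro comb) auto
    have s: "(x - p k) * g x \<le> integral {p k..x} g" "integral {p k..x} g \<le> (x - p k) * g (p k)"
      using sub[of "p k" x] px p0 by auto
    have s1: "h * g x \<le> (x - p k) * g x" using px le0[of x] x by (intro mult_right_mono_neg) auto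
    have s2: "(x - p k) * g (p k) \<le> 0" using px le0[of "p k"] p0 by (simp add: mult_nonneg_nonpos)
    have s3: "h * g x \<le> h * g (p k)" using g(1) px p0 x h by (auto simp: monotone_on_def)
    have "h * (\<Sum>k<m. g (p k)) = h * (\<Sum>k<k. g (p k)) + h * g (p k)"
      using Suc by (simp add: algebra_simps)
    moreover have "h * (\<Sum>k<m. g (p k)) \<le> integral {0..p k} g" using up[OF px(1)] Suc by simp
    ultimately have "\<bar>h * (\<Sum>k<m. g (p k)) - integral {0..x} g\<bar> \<le> - (h * g x)"
      using lo[OF px(1)] c s s1 s2 s3 by linarith
    then show ?thesis by (simp add: p_def)
  qed
qed

text \<open>Centred sums of an even function fold to half sums: the sample points become half-integers for an
  even number of terms, integers for an odd number.\<close>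

lemma symmetric_sum_even:
  fixes f :: "real \<Rightarrow> 'a::comm_ring_1"
  assumes "\<And>t. f (- t) = f t"
  shows "(\<Sum>j<2*m. f (real j - (real (2*m) - 1) / 2)) = 2 * (\<Sum>k<m. f (real k + 1/2))"
proof (induction m)
  case (Suc m)
  have "(\<Sum>j<2*Suc m. f (real j - (real (2*Suc m) - 1) / 2)) =
      (\<Sum>j<Suc (Suc (2*m)). f (real j - (real (2*m) + 1) / 2))"
    by (rule sum.cong) (auto simp: field_simps)
  also have "\<dots> = f (- (real m + 1/2)) + (\<Sum>j<2*m. f (real j - (real (2*m) - 1) / 2)) + f (real m + 1/2)"
  proof -
    have e: "real (Suc j) - (real (2*m) + 1) / 2 = real j - (real (2*m) - 1) / 2" for j
      by (simp add: field_simps)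
    have e0: "real 0 - (real (2*m) + 1) / 2 = - (real m + 1/2)" by (simp add: field_simps)
    have e1: "real (2*m) - (real (2*m) - 1) / 2 = real m + 1/2" by (simp add: field_simps)
    show ?thesis
      unfolding sum.lessThan_Suc_shift[of _ "Suc (2*m)"] o_def e e0
      unfolding sum.lessThan_Suc e1 by (simp only: add.assoc)
  qed
  finally show ?case unfolding Suc assms by (simp add: algebra_simps)
qed simp

lemma symmetric_sum_odd:
  fixes f :: "real \<Rightarrow> 'a::comm_ring_1"
  assumes "\<And>t. f (- t) = f t"
  shows "(\<Sum>j<2*m+1. f (real j - (real (2*m+1) - 1) / 2)) = f 0 + 2 * (\<Sum>k<m. f (real k + 1))"
proof (induction m)
  case (Suc m)
  have "(\<Sum>j<2*Suc m+1. f (real j - (real (2*Suc m+1) - 1) / 2)) =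
      (\<Sum>j<Suc (Suc (2*m+1)). f (real j - (real (2*m+1) + 1) / 2))"
    by (rule sum.cong) (auto simp: field_simps)
  also have "\<dots> = f (- (real m + 1)) + (\<Sum>j<2*m+1. f (real j - (real (2*m+1) - 1) / 2)) + f (real m + 1)"
  proof -
    have e: "real (Suc j) - (real (2*m+1) + 1) / 2 = real j - (real (2*m+1) - 1) / 2" for j
      by (simp add: field_simps)
    have e0: "real 0 - (real (2*m+1) + 1) / 2 = - (real m + 1)" by (simp add: field_simps)
    have e1: "real (2*m+1) - (real (2*m+1) - 1) / 2 = real m + 1" by (simp add: field_simps)
    show ?thesis
      unfolding sum.lessThan_Suc_shift[of _ "Suc (2*m+1)"] o_def e e0
      unfolding sum.lessThan_Suc[of _ "2*m+1"] e1 by (simp only: add.assoc)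
  qed
  finally show ?case unfolding Suc assms by (simp add: algebra_simps)
qed simp

text \<open>The error \<open>d m\<close> in Stirling's formula is \<open>1\<close> at \<open>m = 1\<close> and decreases, by
  \<open>(m + 1/2) ln (1 + 1/m) - 1\<close> at each step. The bounds \<open>2y/(2+y) \<le> ln (1+y) \<le> (y + y/(1+y))/2\<close> at
  \<open>y = 1/m\<close> place this step between \<open>0\<close> and \<open>1/(4m) - 1/(4(m+1))\<close>, which telescopes to at most
  \<open>1/4\<close>.\<close>

lemma ln_fact_Stirling:
  assumes "m \<ge> 1"
  shows "\<bar>ln (fact m) - ((real m + 1/2) * ln (real m) - real m)\<bar> \<le> 1"
proof -
  define d where "d = (\<lambda>m::nat. ln (fact m) - ((real m + 1/2) * ln (real m) - real m))"
  have "3/4 + 1 / (4 * real m) \<le> d m \<and> d m \<le> 1"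
    using assms
  proof (induction m rule: dec_induct)
    case base
    show ?case by (simp add: d_def)
  next
    case (step m)
    have m: "real m \<ge> 1" using step by simp
    define y where "y = 1 / real m"
    have y: "0 < y" using m by (simp add: y_def)
    have e: "d m - d (Suc m) = (real m + 1/2) * (ln (real m + 1) - ln (real m)) - 1"
    proof -
      have "ln (fact (Suc m) :: real) = ln (real m + 1) + ln (fact m)"
        by (simp add: ln_mult add.commute)
      then show ?thesis unfolding d_def by (simp add: algebra_simps)
    qed
    have l: "ln (real m + 1) - ln (real m) = ln (1 + y)"
      using m ln_div[of "real m + 1" "real m"] by (auto simp: y_def add_divide_distrib)
    have "ln (1 + y) \<ge> 2 * y / (2 + y)"
    proof -
      have "(\<lambda>t. ln (1 + t) - 2 * t / (2 + t)) 0 \<le> (\<lambda>t. ln (1 + t) - 2 * t / (2 + t)) y"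
      proof (rule DERIV_nonneg_imp_nondecreasing[OF less_imp_le[OF y]])
        fix t :: real assume t: "0 \<le> t" "t \<le> y"
        have "1 / (1 + t) - (2 * (2 + t) - 2 * t) / ((2 + t) * (2 + t)) = t^2 / ((1+t)*(2+t)^2)"
          using t by (simp add: divide_simps) (simp add: algebra_simps power2_eq_square)
        moreover have "((\<lambda>t. ln (1 + t) - 2 * t / (2 + t)) has_real_derivative
            (1 / (1 + t) - (2 * (2 + t) - 2 * t) / ((2 + t) * (2 + t)))) (at t)"
          using t by (auto intro!: derivative_eq_intros) 
        ultimately have "((\<lambda>t. ln (1 + t) - 2 * t / (2 + t)) has_real_derivative (t^2 / ((1+t)*(2+t)^2))) (at t)"
          by simp
        then show "\<exists>D. ((\<lambda>t. ln (1 + t) - 2 * t / (2 + t)) has_real_derivative D) (at t) \<and> 0 \<le> D"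
          using t by (intro exI[of _ "(t^2 / ((1+t)*(2+t)^2))"]) auto
      qed
      then show ?thesis by simp
    qed
    moreover have "ln (1 + y) \<le> (y + y / (1 + y)) / 2"
    proof -
      have "(\<lambda>t. (t + t / (1 + t)) / 2 - ln (1 + t)) 0 \<le> (\<lambda>t. (t + t / (1 + t)) / 2 - ln (1 + t)) y"
      proof (rule DERIV_nonneg_imp_nondecreasing[OF less_imp_le[OF y]])
        fix t :: real assume t: "0 \<le> t" "t \<le> y"
        have "(1 + ((1 + t) - t) / ((1 + t) * (1 + t))) / 2 - 1 / (1 + t) = t^2 / (2*(1+t)^2)"
          using t by (simp add: divide_simps) (simp add: algebra_simps power2_eq_square)
        moreover have "((\<lambda>t. (t + t / (1 + t)) / 2 - ln (1 + t)) has_real_derivative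
            ((1 + ((1 + t) - t) / ((1 + t) * (1 + t))) / 2 - 1 / (1 + t))) (at t)"
          using t by (auto intro!: derivative_eq_intros) 
        ultimately have "((\<lambda>t. (t + t / (1 + t)) / 2 - ln (1 + t)) has_real_derivative (t^2 / (2*(1+t)^2))) (at t)"
          by simp
        then show "\<exists>D. ((\<lambda>t. (t + t / (1 + t)) / 2 - ln (1 + t)) has_real_derivative D) (at t) \<and> 0 \<le> D"
          using t by (intro exI[of _ "(t^2 / (2*(1+t)^2))"]) auto
      qed
      then show ?thesis by simp
    qed
    moreover have "(real m + 1/2) * (2 * y / (2 + y)) = 1" using m by (simp add: y_def divide_simps)
    moreover have "(real m + 1/2) * ((y + y / (1 + y)) / 2) = 1 + 1 / (4 * real m) - 1 / (4 * real (Suc m))"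
      using m by (simp add: y_def divide_simps) (simp add: algebra_simps power2_eq_square)
    moreover have "(real m + 1/2) * (2 * y / (2 + y)) \<le> (real m + 1/2) * ln (1 + y)"
      by (rule mult_left_mono) (use calculation in auto)
    moreover have "(real m + 1/2) * ln (1 + y) \<le> (real m + 1/2) * ((y + y / (1 + y)) / 2)"
      by (rule mult_left_mono) (use calculation in auto)
    ultimately have "0 \<le> d m - d (Suc m) \<and> d m - d (Suc m) \<le> 1 / (4 * real m) - 1 / (4 * real (Suc m))"
      unfolding e l by linarith
    then show ?case using step.IH by auto
  qed
  moreover have "0 \<le> 1 / (4 * real m)" by simp
  ultimately have "\<bar>d m\<bar> \<le> 1" by linarith
  then show ?thesis unfolding d_def .
qed

text \<open>The comparison expression is \<open>ln ((n/2)!\<^sup>2)\<close> in Stirling's approximation up to a bounded term; it does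
  not see the parity of \<open>n\<close>. Its summand \<open>ln n\<close> is the origin of the factor \<open>N\<close> that separates
  \<open>extremal_ratio\<close> from the exponential of the \<open>log cot\<close> integral.\<close>

lemma ln_fact_halves:
  assumes "n \<ge> 1"
  shows "\<bar>ln (fact (n div 2)) + ln (fact (n - n div 2))
            - (real n * ln (real n / 2) - real n + ln (real n))\<bar> \<le> 5"
proof (cases "even n")
  case True
  then obtain m where n: "n = 2 * m" by auto
  then have m: "m \<ge> 1" using assms by simp
  have "ln (real (2 * m)) = ln 2 + ln (real m)" using m by (simp add: ln_mult)
  moreover have "0 \<le> ln (2::real)" "ln 2 \<le> (1::real)" using ln_2_less_1 by auto
  moreover have "real (2 * m) * ln (real (2 * m) / 2) = 2 * (real m * ln (real m))"
    "(real m + 1/2) * ln (real m) = real m * ln (real m) + ln (real m) / 2"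
    "2 * m div 2 = m" "2 * m - m = m" "real (2 * m) = 2 * real m"
    by (auto simp: algebra_simps)
  ultimately show ?thesis using ln_fact_Stirling[OF m] unfolding n abs_le_iff
    by (simp only:) linarith
next
  case False
  then obtain m where n: "n = 2 * m + 1" by (auto elim: oddE)
  have ln2: "0 \<le> ln (2::real)" "ln 2 \<le> (1::real)" using ln_2_less_1 by auto
  show ?thesis
  proof (cases "m = 0")
    case True
    then show ?thesis using ln2 by (simp add: n ln_div)
  next
    case False
    then have m: "m \<ge> 1" "real m \<ge> 1" by auto
    have h: "n div 2 = m" "n - m = Suc m" "real n = 2 * real m + 1"
      "(2 * real m + 1) / 2 = real m + 1/2"
      by (auto simp: n field_simps)
    have f: "ln (fact (Suc m) :: real) = ln (real m + 1) + ln (fact m)"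
      by (simp add: ln_mult add.commute)
    have "ln (real m + 1/2) - ln (real m) = ln (1 + 1 / (2 * real m))"
      using m ln_div[of "real m + 1/2" "real m"] by (simp add: add_divide_distrib)
    moreover have "ln (1 + 1 / (2 * real m)) \<le> 1 / (2 * real m)" using m by (intro ln_add_one_self_le_self) auto
    moreover have "0 \<le> ln (1 + 1 / (2 * real m))" using m by auto
    ultimately have "0 \<le> ln (real m + 1/2) - ln (real m)" "ln (real m + 1/2) - ln (real m) \<le> 1 / (2 * real m)"
      by auto
    then have "0 \<le> (2 * real m + 1) * (ln (real m + 1/2) - ln (real m))"
        "(2 * real m + 1) * (ln (real m + 1/2) - ln (real m)) \<le> (2 * real m + 1) * (1 / (2 * real m))"
      by (auto intro!: mult_nonneg_nonneg mult_left_mono simp del: times_divide_eq_right)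
    moreover have "(2 * real m + 1) * (1 / (2 * real m)) \<le> 3/2" using m by (simp add: field_simps)
    moreover have "ln (real m + 1) \<le> ln (2 * real m + 1)" "ln (2 * real m + 1) \<le> ln (2 * (real m + 1))"
      using m by auto
    moreover have "ln (2 * (real m + 1)) = ln 2 + ln (real m + 1)" using m by (subst ln_mult) auto
    moreover have "(2 * real m + 1) * (ln (real m + 1/2) - ln (real m))
        = (2 * real m + 1) * ln (real m + 1/2) - (2 * (real m * ln (real m)) + ln (real m))"
      "(real m + 1/2) * ln (real m) = real m * ln (real m) + ln (real m) / 2"
      by (auto simp: algebra_simps)
    ultimately show ?thesis using ln_fact_Stirling[OF m(1)] ln2 unfolding h f abs_le_iff
      by (simp only:) linarith
  qed
qed

text \<open>In \<open>ln (sin t) = ln t + ln_sinc t\<close> the singular part \<open>ln t\<close> is summed by Stirling's formula and integrated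
  in closed form, while \<open>ln_sinc\<close> is bounded, monotone and continuous on \<open>[0, \<pi>/2]\<close>; the value at \<open>0\<close> is
  the continuous extension.\<close>

definition ln_sinc :: "real \<Rightarrow> real" where
  "ln_sinc t = ln (if t = 0 then 1 else sin t / t)"

lemma ln_sinc_0 [simp]: "ln_sinc 0 = 0"
  by (simp add: ln_sinc_def)

lemma x_cos_le_sin:
  fixes t :: real assumes "0 \<le> t" "t \<le> pi / 2" shows "t * cos t \<le> sin t"
proof -
  have "(\<lambda>t. sin t - t * cos t) 0 \<le> (\<lambda>t. sin t - t * cos t) t"
  proof (rule DERIV_nonneg_imp_nondecreasing[OF assms(1)])
    fix u assume u: "0 \<le> u" "u \<le> t"
    have "((\<lambda>t. sin t - t * cos t) has_real_derivative u * sin u) (at u)"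
      by (auto intro!: derivative_eq_intros)
    moreover have "0 \<le> u * sin u" using u assms by (intro mult_nonneg_nonneg sin_ge_zero) auto
    ultimately show "\<exists>D. ((\<lambda>t. sin t - t * cos t) has_real_derivative D) (at u) \<and> 0 \<le> D" by blast
  qed
  then show ?thesis by simp
qed

lemma antimono_sinc:
  fixes s t :: real assumes "0 < s" "s \<le> t" "t \<le> pi / 2" shows "sin t / t \<le> sin s / s"
proof (rule DERIV_nonpos_imp_nonincreasing[OF assms(2)])
  fix u assume u: "s \<le> u" "u \<le> t"
  have "((\<lambda>t. sin t / t) has_real_derivative ((u * cos u - sin u) / u^2)) (at u)"
    using u assms by (auto intro!: derivative_eq_intros simp: power2_eq_square mult.commute)
  moreover have "(u * cos u - sin u) / u^2 \<le> 0"
    using x_cos_le_sin[of u] u assms by (intro divide_nonpos_nonneg) auto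
  ultimately show "\<exists>D. ((\<lambda>t. sin t / t) has_real_derivative D) (at u) \<and> D \<le> 0" by blast
qed

lemma sinc_pos: "0 \<le> t \<Longrightarrow> t \<le> pi / 2 \<Longrightarrow> 0 < (if t = 0 then 1 else sin t / t)"
  by (auto intro!: divide_pos_pos sin_gt_zero)

lemma antimono_ln_sinc: "antimono_on {0..pi/2} ln_sinc"
proof (rule monotone_onI)
  fix s t :: real assume st: "s \<in> {0..pi/2}" "t \<in> {0..pi/2}" "s \<le> t"
  have "(if t = 0 then 1 else sin t / t) \<le> (if s = 0 then 1 else sin s / s)"
    using st antimono_sinc[of s t] sin_x_le_x[of t] by (auto simp: divide_le_eq)
  then show "ln_sinc t \<le> ln_sinc s" using sinc_pos[of t] sinc_pos[of s] st 
    unfolding ln_sinc_def by (subst ln_le_cancel_iff) auto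
qed

lemma continuous_ln_sinc: "continuous_on {0..pi/2} ln_sinc"
proof -
  have "isCont (\<lambda>t::real. if t = 0 then 1 else sin t / t) t" for t
  proof (cases "t = 0")
    case True
    have "((\<lambda>x::real. sin x / x) \<longlongrightarrow> 1) (at 0)" by real_asymp
    then have "((\<lambda>t::real. if t = 0 then 1 else sin t / t) \<longlongrightarrow> 1) (at 0)"
      by (rule Lim_transform_eventually) (auto simp: eventually_at intro!: exI[of _ 1])
    then show ?thesis using True by (simp add: isCont_def)
  next
    case False
    have "isCont (\<lambda>t::real. sin t / t) t" using False by (intro continuous_intros)
    moreover have "\<forall>\<^sub>F s in nhds t. (if s = 0 then 1 else sin s / s) = sin s / s"
      using False by (auto intro: eventually_mono[OF t1_space_nhds])
    ultimately show ?thesis by (subst isCont_cong) auto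
  qed
  then have "continuous_on {0..pi/2} (\<lambda>t::real. if t = 0 then 1 else sin t / t)"
    by (intro continuous_at_imp_continuous_on) auto
  then show ?thesis unfolding ln_sinc_def
    by (intro continuous_on_ln) (use sinc_pos in force)+
qed

lemma ln_sinc_ge: "0 \<le> t \<Longrightarrow> t \<le> pi / 2 \<Longrightarrow> -1 \<le> ln_sinc t \<and> ln_sinc t \<le> 0"
proof -
  assume t: "0 \<le> t" "t \<le> pi / 2"
  have "ln_sinc (pi/2) \<le> ln_sinc t" "ln_sinc t \<le> ln_sinc 0"
    using t by (intro monotone_onD[OF antimono_ln_sinc]; simp)+
  moreover have "ln_sinc (pi/2) \<ge> -1"
  proof -
    have "ln_sinc (pi/2) = ln (2 / pi)" by (simp add: ln_sinc_def)
    moreover have "ln (1/2) \<le> ln (2 / pi)" using pi_less_4 by (subst ln_le_cancel_iff) (auto simp: field_simps)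
    moreover have "ln (1/2) = - ln (2::real)" by (simp add: ln_div)
    ultimately show ?thesis using ln_2_less_1 by linarith
  qed
  ultimately show ?thesis by simp
qed

text \<open>Jordan's inequality \<open>sin t \<ge> 2t/\<pi>\<close> at the complementary angle.\<close>

lemma cos_half_pi_ge:
  assumes "0 \<le> a" "a \<le> (1::real)" shows "1 - a \<le> cos (a * pi / 2)"
proof (cases "a = 1")
  case False
  define t where "t = (1 - a) * pi / 2"
  have t: "0 < t" "t \<le> pi / 2" using False assms by (auto simp: t_def)
  have "sin (pi/2) / (pi/2) \<le> sin t / t" using antimono_sinc[of t "pi/2"] t by simp
  then have "t * (2/pi) \<le> sin t" using t by (simp add: field_simps)
  moreover have "t * (2/pi) = 1 - a" by (simp add: t_def)
  moreover have "sin t = cos (a * pi / 2)" 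
    by (simp add: cos_sin_eq t_def algebra_simps diff_divide_distrib)
  ultimately show ?thesis by simp
qed simp

lemma antimono_ln_cos: "x < pi / 2 \<Longrightarrow> antimono_on {0..x} (\<lambda>t. ln (cos t))"
proof (rule monotone_onI)
  fix s t assume x: "x < pi / 2" and st: "s \<in> {0..x}" "t \<in> {0..x}" "s \<le> t"
  have "cos t \<le> cos s" using st x by (intro cos_monotone_0_pi_le) auto
  moreover have "0 < cos t" using st x by (intro cos_gt_zero_pi) auto
  ultimately show "ln (cos t) \<le> ln (cos s)" by simp
qed

lemma continuous_ln_cos: "x < pi / 2 \<Longrightarrow> continuous_on {0..x} (\<lambda>t::real. ln (cos t))"
  by (intro continuous_intros) (auto intro!: less_imp_neq[symmetric] cos_gt_zero_pi)

lemma has_integral_ln: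
  assumes "0 \<le> x" shows "(ln has_integral (x * ln x - x)) {0..(x::real)}"
proof (cases "x = 0")
  case False
  have "(ln has_integral ((\<lambda>t. t * ln t - t) x - (\<lambda>t. t * ln t - t) 0)) {0..x}"
  proof (rule fundamental_theorem_of_calculus_interior[OF assms])
    have "((\<lambda>t::real. t * ln t - t) \<longlongrightarrow> 0) (at_right 0)" by real_asymp
    moreover have "isCont (\<lambda>t::real. t * ln t - t) t" if "0 < t" for t
      using that by (intro continuous_intros) auto
    ultimately show "continuous_on {0..x} (\<lambda>t. t * ln t - t)"
      using False assms
      by (intro continuous_on_IccI) (auto simp: isCont_def intro!: filterlim_at_split[THEN iffD1, THEN conjunct1])
    fix t assume "t \<in> {0<..<x}"
    then have "((\<lambda>t. t * ln t - t) has_real_derivative ln t) (at t)"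
      by (auto intro!: derivative_eq_intros)
    then show "((\<lambda>t. t * ln t - t) has_vector_derivative ln t) (at t)"
      by (simp add: has_real_derivative_iff_has_vector_derivative)
  qed
  then show ?thesis by simp
qed (simp add: has_integral_refl)

text \<open>The identity of the integrands holds at \<open>0\<close> too, because \<open>cot 0 = 0\<close> and \<open>ln 0 = 0\<close>; the only improper
  integral left is that of \<open>ln\<close>, which has the primitive \<open>t ln t - t\<close>.\<close>

lemma integral_ln_cot:
  assumes "0 \<le> x" "x < pi / 2"
  shows "integral {0..x} (\<lambda>t. ln (cot t))
       = integral {0..x} (\<lambda>t. ln (cos t)) - integral {0..x} ln_sinc - (x * ln x - x)"
proof -
  have e: "ln (cot t) = ln (cos t) - ln_sinc t - ln t" if "t \<in> {0..x}" for t
  proof (cases "t = 0")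
    case False
    then have "0 < t" "0 < cos t" "0 < sin t" using that assms
      by (auto intro!: cos_gt_zero_pi sin_gt_zero)
    then show ?thesis using False by (simp add: ln_sinc_def cot_def ln_div)
  qed (simp add: cot_def)
  have c: "(\<lambda>t. ln (cos t)) integrable_on {0..x}" "ln_sinc integrable_on {0..x}"
    using continuous_ln_cos[of x] continuous_ln_sinc assms
    by (auto intro!: integrable_continuous_real intro: continuous_on_subset)
  have "((\<lambda>t. ln (cos t) - ln_sinc t - ln t) has_integral
     (integral {0..x} (\<lambda>t. ln (cos t)) - integral {0..x} ln_sinc - (x * ln x - x))) {0..x}"
    using c has_integral_ln[OF assms(1)] by (intro has_integral_diff) (auto simp: integrable_integral)
  then have "((\<lambda>t. ln (cot t)) has_integral
     (integral {0..x} (\<lambda>t. ln (cos t)) - integral {0..x} ln_sinc - (x * ln x - x))) {0..x}"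
    by (rule has_integral_eq[rotated]) (use e in auto)
  then show ?thesis by (rule integral_unique)
qed

lemma ln_sine_product:
  assumes "0 < h" "real m * h < pi"
  shows "ln (\<Prod>k=1..m. 2 * sin (real k * h))
       = real m * ln 2 + ln (fact m) + real m * ln h + (\<Sum>k<m. ln_sinc ((real k + 1) * h))"
  using assms(2)
proof (induction m)
  case (Suc m)
  have less: "real m * h < pi" using Suc.prems assms(1) by (simp add: algebra_simps)
  have pos: "sin (real k * h) > 0" if "k \<in> {1..Suc m}" for k
    using that assms(1) le_less_trans[OF mult_right_mono[of "real k" "real (Suc m)" h] Suc.prems]
    by (intro sin_gt_zero mult_pos_pos) (auto simp del: of_nat_Suc)
  define t where "t = real (Suc m) * h"
  have t: "t > 0" "sin t > 0" using assms(1) pos[of "Suc m"] by (auto simp: t_def)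
  have "ln (2 * sin t) = ln (2 * ((real m + 1) * (h * (sin t / t))))"
    using t assms(1) by (simp add: t_def add.commute)
  also have "\<dots> = ln 2 + (ln (real m + 1) + (ln h + ln (sin t / t)))"
    using t assms(1) by (subst ln_mult; (subst ln_mult; (subst ln_mult)?)?) auto
  finally have "ln (2 * sin t) = ln 2 + (ln (real m + 1) + (ln h + ln_sinc t))"
    using t by (simp add: ln_sinc_def)
  moreover have "ln (\<Prod>k=1..Suc m. 2 * sin (real k * h)) = ln (\<Prod>k=1..m. 2 * sin (real k * h)) + ln (2 * sin t)"
  proof -
    have "(\<Prod>k=1..Suc m. 2 * sin (real k * h)) = (\<Prod>k=1..m. 2 * sin (real k * h)) * (2 * sin t)"
      by (simp add: t_def)
    moreover have "0 < (\<Prod>k=1..m. 2 * sin (real k * h))" using pos by (intro prod_pos) auto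
    ultimately show ?thesis using t by (simp only: ln_mult_pos)
  qed
  moreover have "ln (fact (Suc m) :: real) = ln (real m + 1) + ln (fact m)"
    by (simp add: ln_mult add.commute)
  ultimately show ?case using Suc.IH[OF less] by (simp add: t_def algebra_simps)
qed simp

lemma sum_ln_cos_estimate:
  assumes h: "0 < h" and x: "x = real n * h / 2" "x < pi / 2"
  shows "\<bar>(\<Sum>j<n. ln (cos (h * (real j - (real n - 1) / 2)))) - 2 / h * integral {0..x} (\<lambda>t. ln (cos t))\<bar>
       \<le> - 2 * ln (cos x)"
proof -
  define d m where "d = (if even n then 1/2 else 1 :: real)" and "m = n div 2"
  let ?g = "\<lambda>t::real. ln (cos t)"
  have n: "real n = (if even n then 2 * real m else 2 * real m + 1)"
    by (auto simp: m_def elim!: evenE oddE)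
  have x0: "0 \<le> x" unfolding x(1) using h by simp
  have "\<bar>h * (\<Sum>k<m. ?g ((real k + d) * h)) - integral {0..x} ?g\<bar> \<le> - h * ?g x"
    using h x x0 n by (intro antimono_Riemann_sum antimono_ln_cos continuous_ln_cos)
      (auto simp: d_def algebra_simps)
  then have "\<bar>(h * (\<Sum>k<m. ?g ((real k + d) * h)) - integral {0..x} ?g) * (2 / h)\<bar> \<le> (- h * ?g x) * (2 / h)"
    by (rule abs_mult_right_mono) (use h in simp)
  then have *: "\<bar>2 * (\<Sum>k<m. ?g ((real k + d) * h)) - 2 / h * integral {0..x} ?g\<bar> \<le> - 2 * ?g x"
    using h by (simp add: algebra_simps)
  have "(\<Sum>j<n. ?g (h * (real j - (real n - 1) / 2))) = 2 * (\<Sum>k<m. ?g ((real k + d) * h))"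
  proof (cases "even n")
    case True
    then have "n = 2 * m" by (simp add: m_def)
    then show ?thesis using symmetric_sum_even[of "\<lambda>t. ?g (h * t)" m] True
      by (simp add: d_def mult.commute)
  next
    case False
    then have "n = 2 * m + 1" by (simp add: m_def)
    then show ?thesis using symmetric_sum_odd[of "\<lambda>t. ?g (h * t)" m] False
      by (simp add: d_def mult.commute)
  qed
  then show ?thesis using * by simp
qed

lemma sum_ln_sinc_estimate:
  assumes h: "0 < h" and x: "x = real n * h / 2" "real (n + 1) * h \<le> pi"
  shows "\<bar>(\<Sum>k<n div 2. ln_sinc ((real k + 1) * h)) + (\<Sum>k<n - n div 2. ln_sinc ((real k + 1) * h))
           - 2 / h * integral {0..x} ln_sinc\<bar> \<le> 3"
proof -
  define m where "m = n div 2"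
  have n: "real n = (if even n then 2 * real m else 2 * real m + 1)"
    by (auto simp: m_def elim!: evenE oddE)
  have "0 \<le> x" unfolding x(1) using h by simp
  moreover have "x \<le> pi / 2" using x h by (simp add: algebra_simps)
  ultimately have x2: "0 \<le> x" "x \<le> pi / 2" by blast+
  have "\<bar>h * (\<Sum>k<m. ln_sinc ((real k + 1) * h)) - integral {0..x} ln_sinc\<bar> \<le> - h * ln_sinc x"
    using h x n x2 monotone_on_subset[OF antimono_ln_sinc] continuous_on_subset[OF continuous_ln_sinc]
    by (intro antimono_Riemann_sum) (auto simp: algebra_simps split: if_splits)
  then have "\<bar>(h * (\<Sum>k<m. ln_sinc ((real k + 1) * h)) - integral {0..x} ln_sinc) * (2 / h)\<bar> \<le> (- h * ln_sinc x) * (2 / h)"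
    by (rule abs_mult_right_mono) (use h in simp)
  then have *: "\<bar>2 * (\<Sum>k<m. ln_sinc ((real k + 1) * h)) - 2 / h * integral {0..x} ln_sinc\<bar> \<le> 2"
    using h ln_sinc_ge[OF x2] by (simp add: algebra_simps)
  show ?thesis
  proof (cases "even n")
    case True
    then have "n - n div 2 = m" by (auto simp: m_def)
    then show ?thesis using * by (simp add: m_def)
  next
    case False
    then have e: "n - m = Suc m" by (auto simp: m_def elim: oddE)
    have "-1 \<le> ln_sinc ((real m + 1) * h) \<and> ln_sinc ((real m + 1) * h) \<le> 0"
      using h x False n by (intro ln_sinc_ge) (auto simp: algebra_simps)
    then show ?thesis using * unfolding m_def[symmetric] e sum.lessThan_Suc abs_le_iff
      unfolding m_def[symmetric] by linarith
  qed
qed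

lemma ln_mult_complement_le:
  fixes a :: real
  assumes "0 < a" "a < 1"
  shows "ln (a * (1 - a)) \<le> -1"
proof -
  have "a * (1 - a) \<le> 1/4" using zero_le_power2[of "a - 1/2"] by (simp add: power2_eq_square algebra_simps)
  then have "ln (a * (1 - a)) \<le> ln (1/4)" using assms by (subst ln_le_cancel_iff) auto
  also have "ln (1/4 :: real) = - 2 * ln 2" using ln_realpow[of 2 2] by (simp add: ln_div)
  finally show ?thesis using ln2_ge_two_thirds by simp
qed

text \<open>With \<open>h = \<pi>/N\<close> and \<open>x = nh/2\<close> the logarithm of the quotient is a Riemann sum of step \<open>h\<close> for
  \<open>(2/h) \<integral> ln cot\<close> over \<open>[0, x]\<close>. The cosines contribute an error of \<open>ln (cos x)\<close>, that is
  \<open>O(ln (1 - \<alpha>))\<close>, the sinc factors a bounded one, and the factorials the Stirling term \<open>- ln n\<close>,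
  which equals \<open>- ln N - ln \<alpha>\<close>. Bounded errors are absorbed since \<open>- ln (\<alpha>(1 - \<alpha>)) \<ge> 1\<close>.\<close>

lemma product_quotient_estimate:
  fixes N n :: nat
  assumes n: "1 \<le> n" "n < N"
  defines "h \<equiv> pi / real N" and "\<alpha> \<equiv> real n / real N"
  defines "E \<equiv> (\<Prod>j<n. 2 * cos (h * (real j - (real n - 1) / 2))) /
      ((\<Prod>k=1..n div 2. 2 * sin (real k * h)) * (\<Prod>k=1..n - n div 2. 2 * sin (real k * h)))"
  shows "\<bar>ln E + ln (real N) - 2 * real N / pi * integral {0..\<alpha> * pi / 2} (\<lambda>\<phi>. ln (cot \<phi>))\<bar>
       \<le> 10 * - ln (\<alpha> * (1 - \<alpha>))"
proof -
  define x where "x = real n * h / 2"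
  have h: "0 < h" using n by (simp add: h_def)
  have xa: "x = \<alpha> * pi / 2" by (simp add: x_def h_def \<alpha>_def)
  have a: "0 < \<alpha>" "\<alpha> < 1" using n by (auto simp: \<alpha>_def)
  have x: "0 < x" "x < pi / 2" using a by (auto simp: xa)
  have nh: "real (n + 1) * h \<le> pi"
    using n unfolding h_def by (simp add: divide_le_eq mult.commute)
  have cpos: "0 < cos (h * (real j - (real n - 1) / 2))" if "j < n" for j
  proof -
    have "real j + 1 \<le> real n" using that by linarith
    then have "\<bar>real j - (real n - 1) / 2\<bar> \<le> real n / 2"
      unfolding abs_le_iff by (simp add: field_simps)
    then have "\<bar>h * (real j - (real n - 1) / 2)\<bar> \<le> h * (real n / 2)"
      using h unfolding abs_mult by (intro mult_mono) auto
    also have "\<dots> < pi / 2" using x by (simp add: x_def mult.commute)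
    finally show ?thesis by (intro cos_gt_zero_pi) auto
  qed
  have spos: "0 < (\<Prod>k=1..m. 2 * sin (real k * h))" if "m \<le> n" for m
  proof (rule prod_pos)
    fix k assume k: "k \<in> {1..m}"
    have "real k * h \<le> real n * h" using k that h by (intro mult_right_mono) auto
    then have "real k * h < pi" using x by (simp add: x_def)
    then show "0 < 2 * sin (real k * h)" using k h by (auto intro!: sin_gt_zero)
  qed
  have lnC: "ln (\<Prod>j<n. 2 * cos (h * (real j - (real n - 1) / 2)))
      = real n * ln 2 + (\<Sum>j<n. ln (cos (h * (real j - (real n - 1) / 2))))"
  proof -
    have "ln (\<Prod>j<n. 2 * cos (h * (real j - (real n - 1) / 2)))
       = (\<Sum>j<n. ln (2 * cos (h * (real j - (real n - 1) / 2))))"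
      by (intro ln_prod) (auto dest: cpos)
    also have "\<dots> = (\<Sum>j<n. ln 2 + ln (cos (h * (real j - (real n - 1) / 2))))"
      using cpos by (intro sum.cong refl ln_mult_pos) auto
    finally show ?thesis by (simp add: sum.distrib)
  qed
  have lnS: "ln (\<Prod>k=1..m. 2 * sin (real k * h))
       = real m * ln 2 + ln (fact m) + real m * ln h + (\<Sum>k<m. ln_sinc ((real k + 1) * h))"
    if "m \<le> n" for m
  proof (rule ln_sine_product[OF h])
    have "real m * h \<le> real n * h" using that h by (intro mult_right_mono) auto
    then show "real m * h < pi" using x by (simp add: x_def)
  qed
  define m m' where "m = n div 2" and "m' = n - n div 2"
  have mm: "m \<le> n" "m' \<le> n" "real m + real m' = real n" by (auto simp: m_def m'_def)
  have lnE: "ln E = ln (\<Prod>j<n. 2 * cos (h * (real j - (real n - 1) / 2)))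
     - (ln (\<Prod>k=1..m. 2 * sin (real k * h)) + ln (\<Prod>k=1..m'. 2 * sin (real k * h)))"
  proof -
    have "ln (a / (b * c)) = ln a - (ln b + ln c)" if "0 < a" "0 < b" "0 < c" for a b c :: real
      using that by (simp add: ln_div ln_mult)
    moreover have "0 < (\<Prod>j<n. 2 * cos (h * (real j - (real n - 1) / 2)))"
      using cpos by (intro prod_pos) auto
    ultimately show ?thesis unfolding E_def m'_def[symmetric] unfolding m_def[symmetric]
      using spos[OF mm(1)] spos[OF mm(2)] by blast
  qed
  have *: "2 * real N / pi = 2 / h" by (simp add: h_def)
  have xln: "2 / h * (x * ln x - x) = real n * ln (real n / 2) + real n * ln h - real n"
  proof -
    have "ln x = ln (real n / 2) + ln h"
      using h n ln_mult_pos[of "real n / 2" h] by (simp add: x_def)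
    moreover have "2 / h * x = real n" using h by (simp add: x_def)
    ultimately show ?thesis by (simp add: right_diff_distrib ring_distribs mult.assoc[symmetric])
  qed
  have L: "2 * real N / pi * integral {0..\<alpha> * pi / 2} (\<lambda>\<phi>. ln (cot \<phi>))
     = 2 / h * integral {0..x} (\<lambda>t. ln (cos t)) - 2 / h * integral {0..x} ln_sinc
       - (real n * ln (real n / 2) + real n * ln h - real n)"
    unfolding * xa[symmetric] integral_ln_cot[OF less_imp_le[OF x(1)] x(2)] xln[symmetric]
    by (simp add: right_diff_distrib)
  have lnNn: "ln (real n) - ln (real N) = ln \<alpha>" using n by (simp add: \<alpha>_def ln_div)
  have "ln (1 - \<alpha>) \<le> ln (cos x)" using a cos_half_pi_ge[of \<alpha>] by (simp add: xa)
  moreover have "ln (\<alpha> * (1 - \<alpha>)) = ln \<alpha> + ln (1 - \<alpha>)" using a by (subst ln_mult) auto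
  moreover have "ln (\<alpha> * (1 - \<alpha>)) \<le> -1" using a by (rule ln_mult_complement_le)
  moreover have "ln (1 - \<alpha>) \<le> 0" "ln \<alpha> \<le> 0" using a by auto
  ultimately show ?thesis
    using sum_ln_cos_estimate[OF h x_def x(2)] sum_ln_sinc_estimate[OF h x_def nh]
      ln_fact_halves[OF n(1)] lnNn
    unfolding lnE lnC lnS[OF mm(1)] lnS[OF mm(2)] L m'_def[symmetric]
    unfolding m_def[symmetric]
    using arg_cong[OF mm(3), of "\<lambda>t. t * ln 2"] arg_cong[OF mm(3), of "\<lambda>t. t * ln h"]
    unfolding abs_le_iff distrib_right by linarith
qed

section \<open>Chords between roots of unity and Gaussian binomial coefficients\<close>

text \<open>The distance between two \<open>N\<close>-th roots of unity that are \<open>d\<close> steps apart.\<close>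

definition chord :: "nat \<Rightarrow> nat \<Rightarrow> real" where
  "chord N d = 2 * sin (pi * real d / real N)"

text \<open>The modulus of \<open>(1 - q) (1 - q\<^sup>2) \<dots> (1 - q\<^sup>k)\<close> for \<open>q = exp (2\<pi>i/N)\<close>.\<close>

definition chord_fact :: "nat \<Rightarrow> nat \<Rightarrow> real" where
  "chord_fact N k = (\<Prod>d=1..k. chord N d)"

text \<open>The modulus of the Gaussian binomial coefficient at \<open>q = exp (2\<pi>i/N)\<close>.\<close>

definition chord_binomial :: "nat \<Rightarrow> nat \<Rightarrow> nat \<Rightarrow> real" where
  "chord_binomial N n k = chord_fact N n / (chord_fact N k * chord_fact N (n - k))"

abbreviation unit_root :: "nat \<Rightarrow> nat \<Rightarrow> complex" where
  "unit_root N j \<equiv> cis (2 * pi * real j / real N)"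

lemma cis_diff: "cis x - cis y = 2 * \<i> * of_real (sin ((x - y) / 2)) * cis ((x + y) / 2)"
proof -
  have "cos x - cos y = - 2 * sin ((x - y) / 2) * sin ((x + y) / 2)"
  proof -
    have "(y - x) / 2 = - ((x - y) / 2)" by (simp add: field_simps)
    then have "sin ((y - x) / 2) = - sin ((x - y) / 2)" by (simp only: sin_minus)
    then show ?thesis unfolding cos_diff_cos by simp
  qed
  moreover have "sin x - sin y = 2 * sin ((x - y) / 2) * cos ((x + y) / 2)"
    using sin_diff_sin[of x y] by simp
  ultimately show ?thesis by (simp add: complex_eq_iff)
qed

lemma norm_cis_diff: "cmod (cis x - cis y) = 2 * \<bar>sin ((x - y) / 2)\<bar>"
  unfolding cis_diff by (simp add: norm_mult)

lemma chord_0 [simp]: "chord N 0 = 0"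
  by (simp add: chord_def)

lemma chord_nonneg: "d \<le> N \<Longrightarrow> 0 \<le> chord N d"
  unfolding chord_def by (auto intro!: mult_nonneg_nonneg sin_ge_zero simp: divide_le_eq)

lemma chord_pos: "0 < d \<Longrightarrow> d < N \<Longrightarrow> 0 < chord N d"
  unfolding chord_def by (auto intro!: mult_pos_pos sin_gt_zero divide_pos_pos simp: divide_less_eq)

lemma chord_le_2: "chord N d \<le> 2"
  by (simp add: chord_def)

lemma chord_complement: "d \<le> N \<Longrightarrow> chord N (N - d) = chord N d"
proof (cases "N = 0")
  case False
  assume "d \<le> N"
  then have "pi * real (N - d) / real N = pi - pi * real d / real N"
    using False by (simp add: of_nat_diff field_simps)
  then show ?thesis by (simp add: chord_def)
qed (simp add: chord_def)

lemma chord_mono: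
  assumes "d \<le> e" "d + e \<le> N" shows "chord N d \<le> chord N e"
proof (cases "N = 0")
  case False
  let ?x = "pi * real e / real N" and ?y = "pi * real d / real N"
  have "0 \<le> ?y" "?y \<le> ?x" "?x \<le> pi" using assms False by (auto simp: divide_simps)
  moreover have "?x + ?y \<le> pi"
  proof -
    have "?x + ?y = pi * (real (d + e) / real N)" by (simp add: algebra_simps add_divide_distrib)
    also have "\<dots> \<le> pi * 1" using assms False by (intro mult_left_mono) (auto simp: divide_simps)
    finally show ?thesis by simp
  qed
  moreover have "0 \<le> (x - y) / 2 \<and> (x - y) / 2 \<le> pi \<and> 0 \<le> (x + y) / 2 \<and> (x + y) / 2 \<le> pi / 2 \<and> - (pi / 2) \<le> (x + y) / 2"
    if "0 \<le> y" "y \<le> x" "x \<le> pi" "x + y \<le> pi" for x y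
    using that pi_gt_zero by auto
  ultimately have "0 \<le> (?x - ?y) / 2" "(?x - ?y) / 2 \<le> pi" "- (pi / 2) \<le> (?x + ?y) / 2" "(?x + ?y) / 2 \<le> pi / 2"
    by blast+
  then have "0 \<le> sin ((?x - ?y) / 2)" "0 \<le> cos ((?x + ?y) / 2)"
    by (blast intro: sin_ge_zero cos_ge_zero)+
  then have "sin ?x - sin ?y \<ge> 0" unfolding sin_diff_sin by simp
  then show ?thesis by (simp add: chord_def)
qed (simp add: chord_def)

lemma chord_add_le:
  assumes "a \<le> N" "b \<le> N" shows "chord N (a + b) \<le> chord N a + chord N b"
proof -
  have "pi * real (a + b) / real N = pi * real a / real N + pi * real b / real N"
    by (simp add: algebra_simps add_divide_distrib)
  then have "chord N (a + b) = chord N a * cos (pi * real b / real N) + cos (pi * real a / real N) * chord N b"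
    by (simp add: chord_def sin_add algebra_simps)
  also have "\<dots> \<le> chord N a * 1 + 1 * chord N b"
    using chord_nonneg assms by (intro add_mono mult_left_mono mult_right_mono) auto
  finally show ?thesis by simp
qed

lemma chord_fact_0 [simp]: "chord_fact N 0 = 1"
  by (simp add: chord_fact_def)

lemma chord_fact_Suc: "chord_fact N (Suc k) = chord_fact N k * chord N (Suc k)"
  by (simp add: chord_fact_def)

lemma chord_fact_pos: "k < N \<Longrightarrow> 0 < chord_fact N k"
  unfolding chord_fact_def by (intro prod_pos) (auto intro: chord_pos)

lemma chord_binomial_pos: "k \<le> n \<Longrightarrow> n < N \<Longrightarrow> 0 < chord_binomial N n k"
  unfolding chord_binomial_def by (auto intro!: divide_pos_pos mult_pos_pos chord_fact_pos)

lemma chord_binomial_sym: "k \<le> n \<Longrightarrow> chord_binomial N n (n - k) = chord_binomial N n k"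
  by (simp add: chord_binomial_def mult.commute)

lemma chord_binomial_0 [simp]: "n < N \<Longrightarrow> chord_binomial N n 0 = 1"
  using chord_fact_pos[of n N] by (simp add: chord_binomial_def)

lemma chord_binomial_self [simp]: "n < N \<Longrightarrow> chord_binomial N n n = 1"
  using chord_fact_pos[of n N] by (simp add: chord_binomial_def)

lemma chord_binomial_Suc_ratio:
  assumes "k < n" "n < N"
  shows "chord_binomial N n (Suc k) * chord N (Suc k) = chord_binomial N n k * chord N (n - k)"
proof -
  have "n - k = Suc (n - Suc k)" using assms by simp
  then have e: "chord_fact N (n - k) = chord_fact N (n - Suc k) * chord N (n - k)"
    by (metis chord_fact_Suc)
  have "chord_fact N k > 0" "chord_fact N (n - Suc k) > 0" "chord N (Suc k) > 0" "chord N (n - k) > 0"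
    using assms by (auto intro!: chord_fact_pos chord_pos)
  then show ?thesis unfolding chord_binomial_def e chord_fact_Suc by (simp add: field_simps)
qed

lemma chord_binomial_lower:
  assumes "k \<le> n" "Suc n < N"
  shows "chord_binomial N n k * chord N (Suc n) = chord_binomial N (Suc n) k * chord N (Suc n - k)"
proof -
  have e: "chord_fact N (Suc n - k) = chord_fact N (n - k) * chord N (Suc n - k)"
    using assms by (simp add: Suc_diff_le chord_fact_Suc)
  have "chord_fact N k > 0" "chord_fact N (n - k) > 0" "chord N (Suc n) > 0" "chord N (Suc n - k) > 0"
    using assms by (auto intro!: chord_fact_pos chord_pos)
  then show ?thesis unfolding chord_binomial_def e chord_fact_Suc by (simp add: field_simps)
qed

lemma chord_binomial_lower':
  assumes "k \<le> n" "Suc n < N"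
  shows "chord_binomial N n k * chord N (Suc n) = chord_binomial N (Suc n) (Suc k) * chord N (Suc k)"
proof -
  have "chord_fact N k > 0" "chord_fact N (n - k) > 0" "chord N (Suc n) > 0" "chord N (Suc k) > 0"
    using assms by (auto intro!: chord_fact_pos chord_pos)
  then show ?thesis unfolding chord_binomial_def chord_fact_Suc by (simp add: field_simps)
qed

text \<open>The monic polynomial whose roots are \<open>n\<close> consecutive \<open>N\<close>-th roots of unity, rotated by \<open>c\<close>.\<close>

definition arc_poly :: "nat \<Rightarrow> complex \<Rightarrow> nat \<Rightarrow> complex poly" where
  "arc_poly N c n = (\<Prod>i<n. [:- (c * unit_root N i), 1:])"

text \<open>The Pascal rule for Gaussian binomial coefficients, with the half-integer powers of \<open>q\<close> moved to one
  side so that only real chords and one phase for each term remain.\<close>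

lemma chord_Pascal:
  "of_real (chord N k) + cis (pi * real (k + m) / real N) * of_real (chord N m)
   = cis (pi * real m / real N) * of_real (chord N (k + m))"
proof -
  define a b where "a = pi * real k / real N" and "b = pi * real m / real N"
  have ab: "pi * real (k + m) / real N = a + b" by (simp add: a_def b_def algebra_simps add_divide_distrib)
  have "sin a = sin ((a + b) - b)" by simp
  also have "\<dots> = sin (a + b) * cos b - cos (a + b) * sin b" by (rule sin_diff)
  finally have "sin a = sin (a + b) * cos b - cos (a + b) * sin b" .
  then show ?thesis unfolding chord_def ab a_def[symmetric] b_def[symmetric]
    by (simp add: complex_eq_iff algebra_simps)
qed

text \<open>The \<open>q\<close>-binomial theorem at a root of unity. Pulling the phase of each coefficient out explicitly is
  what makes the moduli visible: they are the chord binomials, independently of \<open>c\<close>.\<close>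

lemma coeff_arc_poly:
  assumes "n < N" "k \<le> n"
  shows "coeff (arc_poly N c n) k
       = (- (c * cis (pi * (real n - 1) / real N))) ^ (n - k) * of_real (chord_binomial N n k)"
  using assms
proof (induction n arbitrary: k)
  case 0
  then show ?case by (simp add: arc_poly_def)
next
  case (Suc n)
  define w where "w = pi / real N"
  define B where "B = chord_binomial N"
  have pw: "(- (c * cis t)) ^ m = (- c) ^ m * cis (real m * t)" for t m
  proof -
    have "- (c * cis t) = (- c) * cis t" by simp
    then show ?thesis by (simp only: power_mult_distrib Complex.DeMoivre)
  qed
  have ww: "pi * t / real N = t * w" for t by (simp add: w_def)
  have deg: "coeff (arc_poly N c n) (Suc n) = 0"
  proof (rule coeff_eq_0)
    have "degree (arc_poly N c n) \<le> (\<Sum>i<n. degree [:- (c * unit_root N i), 1:])"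
      unfolding arc_poly_def by (rule order_trans[OF degree_prod_sum_le]) (auto intro: sum_mono)
    then show "degree (arc_poly N c n) < Suc n" by simp
  qed
  have rec: "arc_poly N c (Suc n) = arc_poly N c n * [:- (c * cis (2 * real n * w)), 1:]"
    by (simp add: arc_poly_def w_def mult_ac)
  have IH: "coeff (arc_poly N c n) k = (- c) ^ (n - k) * cis (real (n - k) * ((real n - 1) * w)) * of_real (B n k)"
    if "k \<le> n" for k
    using Suc.IH[of k] Suc.prems(1) that unfolding pw ww[of "real n - 1"] B_def by simp
  have goal: "coeff (arc_poly N c (Suc n)) k = (- c) ^ (Suc n - k) * cis (real (Suc n - k) * (real n * w)) * of_real (B (Suc n) k)"
  proof (cases k)
    case 0
    have "coeff (arc_poly N c (Suc n)) 0 = - (c * cis (2 * real n * w)) * coeff (arc_poly N c n) 0"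
      unfolding rec by (simp add: mult.commute)
    also have "\<dots> = (- c) ^ Suc n * (cis (2 * real n * w) * cis (real n * ((real n - 1) * w)))"
      using Suc.prems by (simp add: IH B_def)
    also have "cis (2 * real n * w) * cis (real n * ((real n - 1) * w)) = cis (real (Suc n) * (real n * w))"
      unfolding cis_mult by (rule arg_cong[of _ _ cis]) (simp add: algebra_simps)
    finally show ?thesis using 0 Suc.prems by (simp add: B_def)
  next
    case (Suc l)
    show ?thesis
    proof (cases "l = n")
      case True
      have "coeff (arc_poly N c (Suc n)) (Suc n) = coeff (arc_poly N c n) n"
        unfolding rec by (simp add: deg mult.commute[of _ "[:_, _:]"])
      then show ?thesis using IH[of n] True Suc.prems Suc by (simp add: B_def)
    next
      case False
      define m where "m = n - l"
      have l: "l < n" "n = l + m" "m > 0" using False Suc Suc.prems by (auto simp: m_def)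
      have cpos: "chord N (Suc n) > 0" using Suc.prems by (auto intro: chord_pos)
      define b where "b = B (Suc n) k / chord N (Suc n)"
      have b1: "B n k = b * chord N m"
        using chord_binomial_lower[of k n N] cpos l Suc Suc.prems by (simp add: b_def B_def field_simps)
      have b2: "B n l = b * chord N k"
        using chord_binomial_lower'[of l n N] cpos l Suc Suc.prems by (simp add: b_def B_def field_simps)
      have b3: "B (Suc n) k = b * chord N (Suc n)" using cpos by (simp add: b_def)
      have nk: "n - k = m - 1" "Suc n - k = m" "k \<le> n" "n - l = m" using l Suc by auto
      have "coeff (arc_poly N c (Suc n)) k = - (c * cis (2 * real n * w)) * coeff (arc_poly N c n) k + coeff (arc_poly N c n) l"
        unfolding rec Suc by (simp add: mult.commute[of _ "[:_, _:]"])
      also have "\<dots> = (- c) ^ m * (cis (2 * real n * w) * cis (real (m - 1) * ((real n - 1) * w)) * of_real (B n k)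
            + cis (real m * ((real n - 1) * w)) * of_real (B n l))"
      proof -
        have pm: "(- c) ^ m = - c * (- c) ^ (m - 1)" using l by (simp add: power_eq_if)
        show ?thesis unfolding IH[OF nk(3)] IH[OF less_imp_le[OF l(1)]] nk pm by (simp add: algebra_simps)
      qed
      also have "cis (2 * real n * w) * cis (real (m - 1) * ((real n - 1) * w)) = 
          cis (real m * ((real n - 1) * w)) * cis (real (k + m) * w)"
        using l unfolding cis_mult Suc by (intro arg_cong[of _ _ cis]) (simp add: of_nat_diff algebra_simps)
      also have "(- c) ^ m * (cis (real m * ((real n - 1) * w)) * cis (real (k + m) * w) * of_real (B n k)
            + cis (real m * ((real n - 1) * w)) * of_real (B n l))
          = (- c) ^ m * cis (real m * ((real n - 1) * w)) * of_real b *
            (of_real (chord N k) + cis (real (k + m) * w) * of_real (chord N m))"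
        unfolding b1 b2 by (simp add: algebra_simps)
      also have "\<dots> = (- c) ^ m * (cis (real m * ((real n - 1) * w)) * cis (real m * w)) * of_real (B (Suc n) k)"
        unfolding chord_Pascal[of N k m, unfolded ww] b3 using l Suc by (simp add: mult_ac)
      also have "cis (real m * ((real n - 1) * w)) * cis (real m * w) = cis (real m * (real n * w))"
        unfolding cis_mult by (intro arg_cong[of _ _ cis]) (simp add: algebra_simps)
      finally show ?thesis by (simp add: nk)
    qed
  qed
  show ?case unfolding goal pw ww B_def by simp
qed

lemma degree_arc_poly: "degree (arc_poly N c n) = n"
proof -
  have "degree (arc_poly N c n) = (\<Sum>i<n. degree [:- (c * unit_root N i), 1:])"
    unfolding arc_poly_def by (rule degree_prod_eq_sum_degree) auto
  then show ?thesis by simp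
qed

lemma norm_coeff_arc_poly:
  assumes "n < N" "k \<le> n" "cmod c = 1"
  shows "cmod (coeff (arc_poly N c n) k) = chord_binomial N n k"
  using chord_binomial_pos[OF assms(2,1)] assms(3)
  by (simp add: coeff_arc_poly[OF assms(1,2)] norm_mult norm_power)

lemma norm_arc_poly_le:
  assumes "n < N" "cmod c = 1" "cmod z = 1"
  shows "cmod (poly (arc_poly N c n) z) \<le> (\<Sum>k\<le>n. chord_binomial N n k)"
proof -
  have "cmod (poly (arc_poly N c n) z) \<le> (\<Sum>k\<le>n. cmod (coeff (arc_poly N c n) k * z ^ k))"
    unfolding poly_altdef degree_arc_poly by (rule norm_sum)
  also have "\<dots> = (\<Sum>k\<le>n. chord_binomial N n k)"
    using assms by (intro sum.cong) (auto simp: norm_mult norm_power norm_coeff_arc_poly)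
  finally show ?thesis .
qed

text \<open>For one rotation \<open>c\<close> all coefficients of the arc polynomial are positive reals. Its value at \<open>1\<close> is then
  the sum of the chord binomials, and also a product over the roots; geometrically, \<open>1\<close> is the point
  opposite to the centre of the arc.\<close>

lemma sum_chord_binomial:
  assumes "n < N"
  shows "(\<Sum>k\<le>n. chord_binomial N n k) = (\<Prod>j<n. 2 * cos (pi / real N * (real j - (real n - 1) / 2)))"
proof -
  define c where "c = - cis (- (pi * (real n - 1) / real N))"
  have c1: "- (c * cis (pi * (real n - 1) / real N)) = 1" by (simp add: c_def cis_mult)
  have "poly (arc_poly N c n) 1 = of_real (\<Sum>k\<le>n. chord_binomial N n k)"
    unfolding poly_altdef degree_arc_poly using assms by (simp add: coeff_arc_poly c1)
  moreover have "0 \<le> (\<Sum>k\<le>n. chord_binomial N n k)"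
    using chord_binomial_pos assms by (intro sum_nonneg) (auto intro: less_imp_le)
  ultimately have 1: "cmod (poly (arc_poly N c n) 1) = (\<Sum>k\<le>n. chord_binomial N n k)"
    by (simp del: of_real_sum)
  have "cmod (poly (arc_poly N c n) 1) = (\<Prod>j<n. cmod (1 - c * unit_root N j))"
    by (simp add: arc_poly_def poly_prod prod_norm[symmetric])
  also have "\<dots> = (\<Prod>j<n. 2 * cos (pi / real N * (real j - (real n - 1) / 2)))"
  proof (rule prod.cong[OF refl])
    fix j assume "j \<in> {..<n}"
    define x where "x = pi / real N * (real j - (real n - 1) / 2)"
    have "c * unit_root N j = - cis (2 * x)"
      unfolding c_def mult_minus_left cis_mult by (rule arg_cong[of _ _ uminus], rule arg_cong[of _ _ cis])
        (simp add: x_def algebra_simps diff_divide_distrib add_divide_distrib)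
    then have "1 - c * unit_root N j = 1 + cis (2 * x)" by simp
    also have "\<dots> = of_real (2 * cos x) * cis x"
      by (simp add: complex_eq_iff cos_double_cos sin_double power2_eq_square)
    finally have "cmod (1 - c * unit_root N j) = \<bar>2 * cos x\<bar>" by (simp add: norm_mult)
    moreover have "0 \<le> cos x"
    proof (rule cos_ge_zero)
      have j: "real j + 1 \<le> real n" "real n \<le> real N" using \<open>j \<in> {..<n}\<close> assms by auto
      then have "real j - (real n - 1) / 2 \<le> real N / 2" "- (real N / 2) \<le> real j - (real n - 1) / 2"
        by (auto simp: field_simps)
      then have "pi / real N * (real j - (real n - 1) / 2) \<le> pi / real N * (real N / 2)"
         "pi / real N * (- (real N / 2)) \<le> pi / real N * (real j - (real n - 1) / 2)"
        by (intro mult_left_mono; simp)+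
      then show "x \<le> pi / 2" "- (pi / 2) \<le> x" using assms by (auto simp: x_def)
    qed
    ultimately show "cmod (1 - c * unit_root N j) = 2 * cos x" by simp
  qed
  finally show ?thesis using 1 by simp
qed

lemma root_of_unity_orthogonality:
  assumes "k < N" "l < N"
  shows "(\<Sum>j<N. unit_root N j ^ k * cnj (unit_root N j ^ l))
       = (if k = l then of_nat N else 0)"
proof -
  define t where "t = 2 * pi * (real k - real l) / real N"
  have "unit_root N j ^ k * cnj (unit_root N j ^ l) = cis t ^ j" for j
  proof -
    show ?thesis unfolding Complex.DeMoivre cis_cnj cis_mult
      by (intro arg_cong[of _ _ cis]) (simp add: t_def algebra_simps diff_divide_distrib)
  qed
  then have e: "(\<Sum>j<N. unit_root N j ^ k * cnj (unit_root N j ^ l)) = (\<Sum>j<N. cis t ^ j)"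
    by simp
  show ?thesis
  proof (cases "k = l")
    case True
    then show ?thesis unfolding e by (simp add: t_def)
  next
    case False
    have "cis t \<noteq> 1"
    proof
      assume "cis t = 1"
      then have "cos t = 1" by (simp add: complex_eq_iff)
      then obtain i :: int where "t = of_int i * 2 * pi" using cos_one_2pi_int[of t] by auto
      then have "2 * pi * (real k - real l) = 2 * pi * (of_int i * real N)"
        using assms by (simp add: t_def field_simps)
      then have "real k - real l = of_int i * real N"
        by (metis mult_cancel_left pi_neq_zero zero_neq_numeral mult_eq_0_iff)
      then have i: "int k - int l = i * int N"
        by (metis of_int_eq_iff of_int_diff of_int_mult of_int_of_nat_eq)
      have "\<bar>int k - int l\<bar> < int N" using assms by auto
      then have "\<bar>i\<bar> * int N < 1 * int N" unfolding i abs_mult by simp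
      then have "\<bar>i\<bar> < 1" by (simp only: mult_less_cancel_right)
      then have "i = 0" by simp
      then show False using i False by simp
    qed
    moreover have "cis t ^ N = 1"
    proof -
      have "cis t ^ N = cis (2 * pi * of_int (int k - int l))"
        unfolding Complex.DeMoivre using assms by (intro arg_cong[of _ _ cis]) (simp add: t_def)
      then show ?thesis by (simp add: cis_multiple_2pi)
    qed
    ultimately show ?thesis unfolding e using False by (simp add: geometric_sum)
  qed
qed

lemma Parseval_roots_of_unity:
  assumes "degree p < N" "cmod c = 1"
  shows "(\<Sum>j<N. (cmod (poly p (c * unit_root N j)))\<^sup>2) = real N * (\<Sum>k<N. (cmod (coeff p k))\<^sup>2)"
proof -
  define z where "z = (\<lambda>j. unit_root N j)"
  define a where "a = (\<lambda>k. coeff p k * c ^ k)"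
  have pz: "poly p (c * z j) = (\<Sum>k<N. a k * z j ^ k)" for j
  proof -
    have "poly p (c * z j) = (\<Sum>k\<le>degree p. coeff p k * (c * z j) ^ k)" by (rule poly_altdef)
    also have "\<dots> = (\<Sum>k<N. coeff p k * (c * z j) ^ k)"
      using assms(1) by (intro sum.mono_neutral_left) (auto simp: coeff_eq_0)
    finally show ?thesis by (simp add: a_def power_mult_distrib mult_ac)
  qed
  have "complex_of_real (\<Sum>j<N. (cmod (poly p (c * z j)))\<^sup>2) = (\<Sum>j<N. poly p (c * z j) * cnj (poly p (c * z j)))"
    by (simp add: complex_norm_square[symmetric])
  also have "\<dots> = (\<Sum>j<N. \<Sum>k<N. \<Sum>l<N. a k * cnj (a l) * (z j ^ k * cnj (z j ^ l)))"
    unfolding pz cnj_sum sum_product by (intro sum.cong refl) (simp add: mult_ac)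
  also have "\<dots> = (\<Sum>k<N. \<Sum>l<N. \<Sum>j<N. a k * cnj (a l) * (z j ^ k * cnj (z j ^ l)))"
    by (subst sum.swap, rule sum.cong[OF refl], subst sum.swap, rule refl)
  also have "\<dots> = (\<Sum>k<N. \<Sum>l<N. a k * cnj (a l) * (if k = l then of_nat N else 0))"
    unfolding sum_distrib_left[symmetric] z_def
    by (intro sum.cong refl arg_cong2[of _ _ _ _ times]) (simp add: root_of_unity_orthogonality del: complex_cnj_power)
  also have "\<dots> = (\<Sum>k<N. of_nat N * (a k * cnj (a k)))"
    by (intro sum.cong refl) (simp add: if_distrib mult_ac cong: if_cong)
  also have "\<dots> = complex_of_real (real N * (\<Sum>k<N. (cmod (coeff p k))\<^sup>2))"
  proof -
    have "a k * cnj (a k) = of_real ((cmod (coeff p k))\<^sup>2)" for k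
      using assms(2) by (simp only: complex_norm_square[symmetric]) (simp add: a_def norm_mult norm_power)
    then show ?thesis by (simp add: sum_distrib_left)
  qed
  finally show ?thesis unfolding z_def of_real_eq_iff .
qed

lemma chord_fact_product_mono:
  assumes "j \<le> k" "k \<le> n div 2" "n < N"
  shows "chord_fact N k * chord_fact N (n - k) \<le> chord_fact N j * chord_fact N (n - j)"
  using assms(1,2)
proof (induction k rule: dec_induct)
  case (step k)
  have "n - k = Suc (n - Suc k)" using step by linarith
  then have e: "chord_fact N (n - k) = chord_fact N (n - Suc k) * chord N (n - k)"
    by (metis chord_fact_Suc)
  have k: "k < n" "n - Suc k < N" "k < N" using step assms(3) by auto
  have "chord N (Suc k) \<le> chord N (n - k)"
    using step assms by (intro chord_mono) auto
  then have "chord_fact N (Suc k) * chord_fact N (n - Suc k) \<le> chord_fact N k * chord_fact N (n - k)"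
    unfolding chord_fact_Suc e using chord_fact_pos k by (simp add: mult_left_mono less_imp_le mult_ac)
  then show ?case using step by simp
qed simp

text \<open>The product decreases up to the centre, since passing from \<open>k\<close> to \<open>k + 1\<close> multiplies it by
  \<open>chord (k + 1) / chord (n - k)\<close>.\<close>

lemma chord_fact_product_ge_central:
  assumes "k \<le> n" "n < N"
  shows "chord_fact N (n div 2) * chord_fact N (n - n div 2) \<le> chord_fact N k * chord_fact N (n - k)"
proof (cases "k \<le> n div 2")
  case True
  then show ?thesis by (rule chord_fact_product_mono) (use assms in auto)
next
  case False
  then have "n - k \<le> n div 2" by linarith
  then have "chord_fact N (n div 2) * chord_fact N (n - n div 2) \<le> chord_fact N (n - k) * chord_fact N (n - (n - k))"
    by (rule chord_fact_product_mono) (use assms in auto)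
  then show ?thesis using assms by (simp add: mult.commute)
qed

lemma sum_halves_le:
  fixes f :: "nat \<Rightarrow> real"
  assumes "\<And>i. 0 \<le> f i"
  shows "(\<Sum>k\<le>r. f (k div 2)) \<le> 2 * (\<Sum>i\<le>r. f i)"
proof -
  have e: "(\<Sum>k<2*m. f (k div 2)) = 2 * (\<Sum>i<m. f i)" for m
    by (induction m) auto
  have "(\<Sum>k\<le>r. f (k div 2)) \<le> (\<Sum>k<2 * Suc (r div 2). f (k div 2))"
    using assms by (intro sum_mono2) auto
  also have "\<dots> = 2 * (\<Sum>i<Suc (r div 2). f i)" by (rule e)
  also have "(\<Sum>i<Suc (r div 2). f i) \<le> (\<Sum>i\<le>r. f i)"
    using assms by (intro sum_mono2) auto
  finally show ?thesis by simp
qed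

text \<open>Log-concavity gives \<open>a 0 * a (2i) \<le> (a i)\<^sup>2\<close>, and with monotonicity
  \<open>a 0 * a (2i + 1) \<le> a i * a (i + 1) \<le> (a i)\<^sup>2\<close>. So every term on the left is bounded by a square,
  and every square is used at most twice.\<close>

lemma log_concave_sum_squares:
  fixes a :: "nat \<Rightarrow> real"
  assumes nonneg: "\<And>i. 0 \<le> a i"
    and decr: "\<And>i. i < r \<Longrightarrow> a (Suc i) \<le> a i"
    and conc: "\<And>i j. i + j \<le> r \<Longrightarrow> a 0 * a (i + j) \<le> a i * a j"
  shows "a 0 * (\<Sum>k\<le>r. a k) \<le> 2 * (\<Sum>k\<le>r. (a k)\<^sup>2)"
proof -
  have "a 0 * a k \<le> (a (k div 2))\<^sup>2" if "k \<le> r" for k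
  proof -
    have k: "k div 2 + (k - k div 2) = k" by simp
    have k2: "k - k div 2 = k div 2 \<or> k - k div 2 = Suc (k div 2) \<and> k div 2 < r"
      using that by presburger
    have "a 0 * a k \<le> a (k div 2) * a (k - k div 2)" using conc[of "k div 2" "k - k div 2"] k that by simp
    also have "a (k - k div 2) \<le> a (k div 2)" using k2 decr by auto
    then have "a (k div 2) * a (k - k div 2) \<le> a (k div 2) * a (k div 2)" by (intro mult_left_mono nonneg)
    finally show ?thesis by (simp add: power2_eq_square)
  qed
  then have "a 0 * (\<Sum>k\<le>r. a k) \<le> (\<Sum>k\<le>r. (a (k div 2))\<^sup>2)"
    unfolding sum_distrib_left by (intro sum_mono) auto
  also have "\<dots> \<le> 2 * (\<Sum>k\<le>r. (a k)\<^sup>2)" by (rule sum_halves_le) auto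
  finally show ?thesis .
qed

text \<open>Both products become differences of two cosines with the same first cosine; the remaining comparison
  is \<open>sin ((n + 1)\<pi>/N) * sin ((l - k)\<pi>/N) \<ge> 0\<close>.\<close>

lemma chord_product_le:
  assumes "k \<le> l" "l \<le> n" "n < N"
  shows "chord N (n - l) * chord N (Suc k) \<le> chord N (n - k) * chord N (Suc l)"
proof -
  define w where "w = pi / real N"
  have c: "chord N d = 2 * sin (real d * w)" for d by (simp add: chord_def w_def mult.commute)
  have w: "0 < w" "real N * w = pi" using assms by (auto simp: w_def)
  define s t where "s = real (Suc n) * w" and "t = real (l - k) * w"
  have "0 \<le> s" "s \<le> pi" "0 \<le> t" "t \<le> pi"
    using assms w mult_right_mono[of "real (Suc n)" "real N" w] mult_right_mono[of "real (l - k)" "real N" w]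
    by (auto simp: s_def t_def)
  then have st: "0 \<le> sin s * sin t" by (intro mult_nonneg_nonneg sin_ge_zero)
  have ss: "2 * (sin x * sin y) = cos (x - y) - cos (x + y)" for x y :: real
    by (simp add: sin_times_sin)
  have "real (n - l) * w + real (Suc k) * w = s - t"
    using assms by (simp add: s_def t_def of_nat_diff algebra_simps)
  then have e1: "2 * (sin (real (n - l) * w) * sin (real (Suc k) * w)) = cos (real (n - l) * w - real (Suc k) * w) - cos (s - t)"
    using ss[of "real (n - l) * w" "real (Suc k) * w"] by simp
  have "real (n - k) * w + real (Suc l) * w = s + t"
    using assms by (simp add: s_def t_def of_nat_diff algebra_simps)
  then have e2: "2 * (sin (real (n - k) * w) * sin (real (Suc l) * w)) = cos (real (n - k) * w - real (Suc l) * w) - cos (s + t)"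
    using ss[of "real (n - k) * w" "real (Suc l) * w"] by simp
  have e3: "real (n - l) * w - real (Suc k) * w = real (n - k) * w - real (Suc l) * w"
    using assms by (simp add: of_nat_diff algebra_simps)
  have "cos (s + t) \<le> cos (s - t)" using st by (simp add: cos_add cos_diff)
  then have "sin (real (n - l) * w) * sin (real (Suc k) * w) \<le> sin (real (n - k) * w) * sin (real (Suc l) * w)"
    using e1 e2 unfolding e3 by linarith
  then show ?thesis unfolding c by simp
qed

lemma chord_binomial_log_concave:
  assumes "m + i + j \<le> n" "n < N"
  shows "chord_binomial N n m * chord_binomial N n (m + i + j) \<le> chord_binomial N n (m + i) * chord_binomial N n (m + j)"
  using assms(1)
proof (induction j)
  case (Suc j)
  let ?B = "chord_binomial N n"
  have pos: "0 < chord N (Suc (m + i + j))" "0 < chord N (Suc (m + j))" "0 \<le> chord N (n - (m + i + j))"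
    "0 < ?B m" "0 < ?B (m + i)" "0 < ?B (m + j)" "0 < ?B (m + i + j)"
    using Suc.prems assms(2) by (auto intro!: chord_pos chord_nonneg chord_binomial_pos)
  have r1: "?B (Suc (m + i + j)) * chord N (Suc (m + i + j)) = ?B (m + i + j) * chord N (n - (m + i + j))"
    using Suc.prems assms(2) by (intro chord_binomial_Suc_ratio) auto
  have r2: "?B (Suc (m + j)) * chord N (Suc (m + j)) = ?B (m + j) * chord N (n - (m + j))"
    using Suc.prems assms(2) by (intro chord_binomial_Suc_ratio) auto
  have p: "chord N (n - (m + i + j)) * chord N (Suc (m + j)) \<le> chord N (n - (m + j)) * chord N (Suc (m + i + j))"
    using Suc.prems assms(2) by (intro chord_product_le) auto
  have "?B m * ?B (Suc (m + i + j)) * (chord N (Suc (m + i + j)) * chord N (Suc (m + j)))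
      = ?B m * ?B (m + i + j) * (chord N (n - (m + i + j)) * chord N (Suc (m + j)))"
    using r1 by (simp add: mult_ac)
  also have "\<dots> \<le> ?B (m + i) * ?B (m + j) * (chord N (n - (m + j)) * chord N (Suc (m + i + j)))"
    using Suc.IH Suc.prems p pos
    by (intro mult_mono[of "?B m * ?B (m + i + j)"]) (auto intro!: mult_nonneg_nonneg less_imp_le)
  also have "\<dots> = ?B (m + i) * ?B (Suc (m + j)) * (chord N (Suc (m + i + j)) * chord N (Suc (m + j)))"
    using r2 by (simp add: mult_ac)
  finally show ?case using pos by (simp add: mult_le_cancel_right)
qed simp

text \<open>A log-concave sequence has comparable \<open>\<ell>\<^sup>2\<close> norm and product of \<open>\<ell>\<^sup>1\<close> and maximum norm. The
  maximum sits at \<open>n div 2\<close>; the terms before it are the mirror images of terms after it.\<close>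

lemma chord_binomial_sum_squares_ge:
  assumes "n < N"
  shows "chord_binomial N n (n div 2) * (\<Sum>k\<le>n. chord_binomial N n k) \<le> 4 * (\<Sum>k\<le>n. (chord_binomial N n k)\<^sup>2)"
proof -
  define m r where "m = n div 2" and "r = n - n div 2"
  have mr: "m + r = n" "m \<le> r" by (auto simp: m_def r_def)
  define a where "a = (\<lambda>i. if i \<le> r then chord_binomial N n (m + i) else 0)"
  have "a 0 * (\<Sum>k\<le>r. a k) \<le> 2 * (\<Sum>k\<le>r. (a k)\<^sup>2)"
  proof (rule log_concave_sum_squares)
    show "0 \<le> a i" for i using chord_binomial_pos[of "m + i" n N] assms mr by (auto simp: a_def intro: less_imp_le)
    show "a (Suc i) \<le> a i" if "i < r" for i
    proof -
      let ?k = "m + i"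
      have k: "?k < n" using that mr by simp
      have "chord_binomial N n (Suc ?k) * chord N (Suc ?k) = chord_binomial N n ?k * chord N (n - ?k)"
        using k assms by (intro chord_binomial_Suc_ratio)
      also have "\<dots> \<le> chord_binomial N n ?k * chord N (Suc ?k)"
      proof (rule mult_left_mono[OF chord_mono])
        show "n - ?k \<le> Suc ?k" by (simp add: m_def)
        show "n - ?k + Suc ?k \<le> N" using k assms by simp
        show "0 \<le> chord_binomial N n ?k" using chord_binomial_pos[of ?k n N] k assms by simp
      qed
      finally show ?thesis using that chord_pos[of "Suc ?k" N] k assms by (simp add: a_def)
    qed
    show "a 0 * a (i + j) \<le> a i * a j" if "i + j \<le> r" for i j
      using that mr assms chord_binomial_log_concave[of m i j n N] by (simp add: a_def add.assoc)
  qed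
  moreover have "(\<Sum>k\<le>r. g (m + k)) = (\<Sum>k=m..n. g k)" for g :: "nat \<Rightarrow> real"
    using mr by (intro sum.reindex_bij_witness[of _ "\<lambda>k. k - m" "\<lambda>k. m + k"]) auto
  then have "(\<Sum>k\<le>r. a k) = (\<Sum>k=m..n. chord_binomial N n k)" "(\<Sum>k\<le>r. (a k)\<^sup>2) = (\<Sum>k=m..n. (chord_binomial N n k)\<^sup>2)"
    by (simp_all add: a_def)
  ultimately have 1: "chord_binomial N n m * (\<Sum>k=m..n. chord_binomial N n k) \<le> 2 * (\<Sum>k=m..n. (chord_binomial N n k)\<^sup>2)"
    by (simp add: a_def)
  have "(\<Sum>k<m. chord_binomial N n k) = (\<Sum>k=Suc r..n. chord_binomial N n k)"
    using mr by (intro sum.reindex_bij_witness[of _ "\<lambda>k. n - k" "\<lambda>k. n - k"]) (auto simp: chord_binomial_sym)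
  also have "\<dots> \<le> (\<Sum>k=m..n. chord_binomial N n k)"
    using mr assms by (intro sum_mono2) (auto intro!: less_imp_le chord_binomial_pos)
  finally have left: "(\<Sum>k<m. chord_binomial N n k) \<le> (\<Sum>k=m..n. chord_binomial N n k)" .
  have 2: "(\<Sum>k\<le>n. chord_binomial N n k) \<le> 2 * (\<Sum>k=m..n. chord_binomial N n k)"
  proof -
    have "{..n} = {..<m} \<union> {m..n}" using mr by auto
    then have "(\<Sum>k\<le>n. chord_binomial N n k) = (\<Sum>k<m. chord_binomial N n k) + (\<Sum>k=m..n. chord_binomial N n k)"
      by (simp add: sum.union_disjoint ivl_disj_int)
    with left show ?thesis by simp
  qed
  have 3: "(\<Sum>k=m..n. (chord_binomial N n k)\<^sup>2) \<le> (\<Sum>k\<le>n. (chord_binomial N n k)\<^sup>2)"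
    by (intro sum_mono2) auto
  have "0 \<le> chord_binomial N n m" using chord_binomial_pos[of m n N] mr assms by simp
  from mult_left_mono[OF 2 this] 1 3 show ?thesis unfolding m_def by linarith
qed

text \<open>The maximum over \<open>k\<close> of \<open>1 / (chord_fact k * chord_fact (n - k))\<close> times the maximum modulus of an arc
  polynomial on the unit circle. Twice this quantity bounds the values of all Lagrange basis polynomials
  with \<open>n\<close> nodes at the other roots of unity; up to an absolute constant and a factor
  \<open>\<alpha>(1 - \<alpha>)\<close> it is the norm of the inverse of a square contiguous submatrix.\<close>

definition extremal_ratio :: "nat \<Rightarrow> nat \<Rightarrow> real" where
  "extremal_ratio N n = (\<Sum>k\<le>n. chord_binomial N n k) / (chord_fact N (n div 2) * chord_fact N (n - n div 2))"

lemma sum_squares_binomial_le: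
  assumes "n < N"
  shows "(\<Sum>k\<le>n. (chord_binomial N n k)\<^sup>2) \<le> chord_fact N n * extremal_ratio N n"
proof -
  have "(\<Sum>k\<le>n. (chord_binomial N n k)\<^sup>2)
      \<le> (\<Sum>k\<le>n. chord_fact N n / (chord_fact N (n div 2) * chord_fact N (n - n div 2)) * chord_binomial N n k)"
  proof (rule sum_mono)
    fix k assume "k \<in> {..n}"
    then have k: "k \<le> n" by simp
    have "chord_binomial N n k \<le> chord_fact N n / (chord_fact N (n div 2) * chord_fact N (n - n div 2))"
      unfolding chord_binomial_def using k assms
      by (intro divide_left_mono chord_fact_product_ge_central mult_pos_pos)
         (auto intro!: chord_fact_pos less_imp_le[OF chord_fact_pos])
    then show "(chord_binomial N n k)\<^sup>2 \<le> chord_fact N n / (chord_fact N (n div 2) * chord_fact N (n - n div 2)) * chord_binomial N n k"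
      unfolding power2_eq_square using chord_binomial_pos[OF k assms] by (intro mult_right_mono) auto
  qed
  also have "\<dots> = chord_fact N n * extremal_ratio N n"
    by (simp add: extremal_ratio_def sum_divide_distrib sum_distrib_left mult_ac)
  finally show ?thesis .
qed

lemma sum_squares_binomial_ge:
  assumes "n < N"
  shows "chord_fact N n * extremal_ratio N n \<le> 4 * (\<Sum>k\<le>n. (chord_binomial N n k)\<^sup>2)"
  using chord_binomial_sum_squares_ge[OF assms] by (simp add: extremal_ratio_def chord_binomial_def)

section \<open>Lagrange interpolation at roots of unity\<close>

lemma unit_root_add: "unit_root N (i + j) = unit_root N i * unit_root N j"
  by (simp add: cis_mult distrib_left add_divide_distrib)

lemma unit_root_mod: "unit_root N (j mod N) = unit_root N j"
proof (cases "N = 0")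
  case False
  have "unit_root N j = unit_root N (N * (j div N) + j mod N)" by (simp only: mult_div_mod_eq)
  also have "\<dots> = unit_root N (N * (j div N)) * unit_root N (j mod N)" by (rule unit_root_add)
  also have "unit_root N (N * (j div N)) = cis (2 * pi * of_int (int (j div N)))"
    using False by (intro arg_cong[of _ _ cis]) (simp add: field_simps)
  also have "\<dots> = 1" by (rule cis_multiple_2pi) auto
  finally show ?thesis by simp
qed simp

lemma norm_unit_root_diff:
  assumes "i \<le> j" "j - i \<le> N"
  shows "cmod (unit_root N j - unit_root N i) = chord N (j - i)"
proof -
  have "(2 * pi * real j / real N - 2 * pi * real i / real N) / 2 = pi * real (j - i) / real N"
    using assms(1) by (simp add: of_nat_diff algebra_simps diff_divide_distrib)
  then show ?thesis using chord_nonneg[OF assms(2)] unfolding norm_cis_diff by (simp add: chord_def)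
qed

lemma inj_on_unit_root: "inj_on (unit_root N) {..<N}"
proof -
  have "i = j" if "i \<le> j" "j < N" "unit_root N i = unit_root N j" for i j
  proof -
    have "j - i < N" using that by simp
    then show ?thesis using norm_unit_root_diff[of i j N] chord_pos[of "j - i" N] that
      by (cases "i = j") auto
  qed
  then show ?thesis by (intro inj_onI) (metis lessThan_iff linear)
qed

lemma norm_sum_mult_power2_le:
  fixes a b :: "'i \<Rightarrow> complex"
  shows "(cmod (\<Sum>i\<in>I. a i * b i))\<^sup>2 \<le> (\<Sum>i\<in>I. (cmod (a i))\<^sup>2) * (\<Sum>i\<in>I. (cmod (b i))\<^sup>2)"
proof -
  have "cmod (\<Sum>i\<in>I. a i * b i) \<le> (\<Sum>i\<in>I. cmod (a i) * cmod (b i))"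
    by (rule order_trans[OF norm_sum]) (simp add: norm_mult)
  then have "(cmod (\<Sum>i\<in>I. a i * b i))\<^sup>2 \<le> (\<Sum>i\<in>I. cmod (a i) * cmod (b i))\<^sup>2"
    by (intro power_mono) auto
  also have "\<dots> \<le> (\<Sum>i\<in>I. (cmod (a i))\<^sup>2) * (\<Sum>i\<in>I. (cmod (b i))\<^sup>2)"
    by (rule Cauchy_Schwarz_ineq_sum)
  finally show ?thesis .
qed

definition lagrange_basis :: "complex set \<Rightarrow> complex \<Rightarrow> complex poly" where
  "lagrange_basis Z z = (\<Prod>t\<in>Z - {z}. Polynomial.smult (1 / (z - t)) [:- t, 1:])"

text \<open>The square of the Hilbert-Schmidt norm of the inverse Vandermonde matrix with nodes \<open>Z\<close>: the columns
  of the inverse are the coefficient vectors of the Lagrange basis.\<close>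

definition interpolation_constant :: "complex set \<Rightarrow> real" where
  "interpolation_constant Z = (\<Sum>z\<in>Z. \<Sum>k<card Z. (cmod (coeff (lagrange_basis Z z) k))\<^sup>2)"

lemma poly_lagrange_basis: "poly (lagrange_basis Z z) x = (\<Prod>t\<in>Z - {z}. (x - t) / (z - t))"
  unfolding lagrange_basis_def poly_prod by (intro prod.cong) (auto simp: diff_divide_distrib)

lemma poly_lagrange_basis_node:
  assumes "finite Z" "z \<in> Z" "x \<in> Z"
  shows "poly (lagrange_basis Z z) x = (if x = z then 1 else 0)"
  using assms unfolding poly_lagrange_basis by auto

lemma degree_lagrange_basis:
  assumes "finite Z" "z \<in> Z" shows "degree (lagrange_basis Z z) < card Z"
proof -
  have "degree (lagrange_basis Z z) \<le> (\<Sum>t\<in>Z - {z}. degree (Polynomial.smult (1 / (z - t)) [:- t, 1:]))"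
    unfolding lagrange_basis_def by (rule order_trans[OF degree_prod_sum_le]) (use assms in auto)
  also have "\<dots> \<le> (\<Sum>t\<in>Z - {z}. 1)" by (intro sum_mono) (auto intro: order_trans[OF degree_smult_le])
  also have "\<dots> < card Z" using assms card_gt_0_iff[of Z] by auto
  finally show ?thesis .
qed

text \<open>A polynomial of degree below \<open>card Z\<close> is recovered from its values on \<open>Z\<close> by Lagrange interpolation;
  the Cauchy-Schwarz inequality bounds each coefficient.\<close>

lemma interpolation_lower_bound:
  assumes Z: "finite Z" and m: "m \<le> card Z"
  shows "(\<Sum>k<m. (cmod (x k))\<^sup>2) \<le> interpolation_constant Z * (\<Sum>z\<in>Z. (cmod (\<Sum>k<m. x k * z ^ k))\<^sup>2)"
proof (cases "card Z = 0")
  case False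
  define p where "p = (\<Sum>k<m. monom (x k) k)"
  have pz: "poly p z = (\<Sum>k<m. x k * z ^ k)" for z by (simp add: p_def poly_sum poly_monom)
  have cp: "coeff p k = (if k < m then x k else 0)" for k
    by (simp add: p_def coeff_sum if_distrib cong: if_cong)
  have dp: "degree p < card Z"
  proof -
    have "degree p \<le> card Z - 1" using m by (intro degree_le) (auto simp: cp)
    then show ?thesis using False by simp
  qed
  define r where "r = (\<Sum>z\<in>Z. Polynomial.smult (poly p z) (lagrange_basis Z z))"
  have dr: "degree r < card Z"
  proof -
    have "degree r \<le> card Z - 1" unfolding r_def
    proof (rule degree_sum_le)
      fix z assume "z \<in> Z"
      then have "degree (lagrange_basis Z z) < card Z" by (rule degree_lagrange_basis[OF Z])
      then show "degree (Polynomial.smult (poly p z) (lagrange_basis Z z)) \<le> card Z - 1"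
        using degree_smult_le[of "poly p z" "lagrange_basis Z z"] by linarith
    qed (rule Z)
    then show ?thesis using False by simp
  qed
  have "p = r"
  proof (rule poly_eqI_degree[of Z])
    fix x assume x: "x \<in> Z"
    have "poly r x = (\<Sum>z\<in>Z. poly p z * (if x = z then 1 else 0))"
      unfolding r_def poly_sum using Z x by (intro sum.cong) (auto simp: poly_lagrange_basis_node)
    then show "poly p x = poly r x" using Z x by (simp add: if_distrib cong: if_cong)
  qed (use dp dr in auto)
  have "x k = (\<Sum>z\<in>Z. poly p z * coeff (lagrange_basis Z z) k)" if "k < m" for k
  proof -
    have "x k = coeff p k" using that by (simp add: cp)
    also have "\<dots> = coeff r k" by (simp only: \<open>p = r\<close>)
    finally show ?thesis by (simp add: r_def coeff_sum)
  qed
  then have "(\<Sum>k<m. (cmod (x k))\<^sup>2) \<le> (\<Sum>k<m. (\<Sum>z\<in>Z. (cmod (poly p z))\<^sup>2) * (\<Sum>z\<in>Z. (cmod (coeff (lagrange_basis Z z) k))\<^sup>2))"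
    by (intro sum_mono) (simp add: norm_sum_mult_power2_le)
  also have "\<dots> \<le> (\<Sum>k<card Z. (\<Sum>z\<in>Z. (cmod (poly p z))\<^sup>2) * (\<Sum>z\<in>Z. (cmod (coeff (lagrange_basis Z z) k))\<^sup>2))"
    using m by (intro sum_mono2) (auto intro!: mult_nonneg_nonneg sum_nonneg)
  also have "\<dots> = interpolation_constant Z * (\<Sum>z\<in>Z. (cmod (poly p z))\<^sup>2)"
    unfolding interpolation_constant_def sum_distrib_left[symmetric] by (subst sum.swap) (simp add: mult.commute)
  finally show ?thesis unfolding pz .
qed (use m in simp)

text \<open>The coefficient vectors of the Lagrange basis are dual to the vectors of powers of the nodes, so
  \<open>y z\<close> is the inner product of the moments \<open>v\<close> with the coefficients at \<open>z\<close>. Nodes outside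
  \<open>W\<close> only raise the number of available moments.\<close>

lemma interpolation_dual_lower_bound:
  assumes Z: "finite Z" and W: "W \<subseteq> Z"
  shows "(\<Sum>z\<in>W. (cmod (y z))\<^sup>2) \<le> interpolation_constant Z * (\<Sum>k<card Z. (cmod (\<Sum>z\<in>W. y z * cnj (z ^ k)))\<^sup>2)"
proof -
  have fW: "finite W" using Z W by (rule rev_finite_subset)
  define v where "v = (\<lambda>k. \<Sum>z\<in>W. y z * cnj (z ^ k))"
  have y: "y z = (\<Sum>k<card Z. cnj (coeff (lagrange_basis Z z) k) * v k)" if z: "z \<in> W" for z
  proof -
    let ?L = "lagrange_basis Z z"
    have L: "poly ?L x = (\<Sum>k<card Z. coeff ?L k * x ^ k)" for x
    proof -
      have "degree ?L < card Z" using degree_lagrange_basis[OF Z] z W by auto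
      then show ?thesis unfolding poly_altdef by (intro sum.mono_neutral_left) (auto simp: coeff_eq_0)
    qed
    have "(\<Sum>k<card Z. cnj (coeff ?L k) * v k) = (\<Sum>x\<in>W. \<Sum>k<card Z. cnj (coeff ?L k) * (y x * cnj (x ^ k)))"
      unfolding v_def sum_distrib_left by (rule sum.swap)
    also have "\<dots> = (\<Sum>x\<in>W. y x * cnj (poly ?L x))"
      unfolding L by (simp add: sum_distrib_left mult_ac)
    also have "\<dots> = (\<Sum>x\<in>W. y x * (if x = z then 1 else 0))"
      using z by (intro sum.cong refl) (simp add: poly_lagrange_basis_node[OF Z] subsetD[OF W])
    also have "\<dots> = y z" using fW z by (simp add: if_distrib cong: if_cong)
    finally show ?thesis by simp
  qed
  have "(\<Sum>z\<in>W. (cmod (y z))\<^sup>2) \<le> (\<Sum>z\<in>W. (\<Sum>k<card Z. (cmod (coeff (lagrange_basis Z z) k))\<^sup>2) * (\<Sum>k<card Z. (cmod (v k))\<^sup>2))"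
  proof (rule sum_mono)
    fix z assume z: "z \<in> W"
    show "(cmod (y z))\<^sup>2 \<le> (\<Sum>k<card Z. (cmod (coeff (lagrange_basis Z z) k))\<^sup>2) * (\<Sum>k<card Z. (cmod (v k))\<^sup>2)"
      using norm_sum_mult_power2_le[of "\<lambda>k. cnj (coeff (lagrange_basis Z z) k)" v "{..<card Z}"]
      unfolding y[OF z, symmetric] by simp
  qed
  also have "\<dots> \<le> interpolation_constant Z * (\<Sum>k<card Z. (cmod (v k))\<^sup>2)"
    unfolding sum_distrib_right[symmetric] interpolation_constant_def
    using W Z by (intro mult_right_mono sum_mono2 sum_nonneg) (auto intro: sum_nonneg)
  finally show ?thesis unfolding v_def .
qed

text \<open>Coefficient norms become values at all \<open>N\<close>-th roots of unity, which are explicit products of chords.\<close>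

lemma interpolation_constant_Parseval:
  assumes Z: "finite Z" "card Z \<le> N" and c: "cmod c = 1"
  shows "real N * interpolation_constant Z = (\<Sum>z\<in>Z. \<Sum>j<N. (cmod (poly (lagrange_basis Z z) (c * unit_root N j)))\<^sup>2)"
proof -
  have "real N * (\<Sum>k<card Z. (cmod (coeff (lagrange_basis Z z) k))\<^sup>2) =
      (\<Sum>j<N. (cmod (poly (lagrange_basis Z z) (c * unit_root N j)))\<^sup>2)" if "z \<in> Z" for z
  proof -
    have d: "degree (lagrange_basis Z z) < card Z" using degree_lagrange_basis[OF Z(1) that] .
    have "(\<Sum>k<card Z. (cmod (coeff (lagrange_basis Z z) k))\<^sup>2) = (\<Sum>k<N. (cmod (coeff (lagrange_basis Z z) k))\<^sup>2)"
      using d Z by (intro sum.mono_neutral_left) (auto simp: coeff_eq_0)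
    then show ?thesis using Parseval_roots_of_unity[of "lagrange_basis Z z" N c] d Z c by simp
  qed
  then show ?thesis unfolding interpolation_constant_def sum_distrib_left by simp
qed

lemma arc_product:
  assumes "i + n < N"
  shows "(\<Prod>t<n. chord N (n + i - t)) = chord_fact N (n + i) / chord_fact N i"
  using assms
proof (induction n)
  case 0
  then show ?case using chord_fact_pos[of i N] by simp
next
  case (Suc n)
  have "(\<Prod>t<Suc n. chord N (Suc n + i - t)) = chord N (Suc n + i) * (\<Prod>t<n. chord N (n + i - t))"
    unfolding prod.lessThan_Suc_shift by simp
  then show ?case using Suc by (simp add: chord_fact_Suc mult.commute)
qed

lemma norm_arc_poly_outside:
  assumes c: "cmod c = 1" and i: "n + i < N"
  shows "cmod (poly (arc_poly N c n) (c * unit_root N (n + i))) = chord_fact N (n + i) / chord_fact N i"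
proof -
  have "cmod (poly (arc_poly N c n) (c * unit_root N (n + i)))
      = (\<Prod>t<n. cmod (c * unit_root N (n + i) - c * unit_root N t))"
    by (simp add: arc_poly_def poly_prod prod_norm[symmetric])
  also have "\<dots> = (\<Prod>t<n. chord N (n + i - t))"
  proof (rule prod.cong[OF refl])
    fix t assume "t \<in> {..<n}"
    then show "cmod (c * unit_root N (n + i) - c * unit_root N t) = chord N (n + i - t)"
      using norm_unit_root_diff[of t "n + i" N] i c
      by (simp add: norm_mult right_diff_distrib[symmetric] del: of_nat_add)
  qed
  finally show ?thesis using arc_product[of i n N] i by (simp add: add.commute)
qed

lemma arc_poly_node:
  assumes "i < n" shows "poly (arc_poly N c n) (c * unit_root N i) = 0"
  using assms by (auto simp: arc_poly_def poly_prod)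

lemma sum_chord_binomial_ge:
  assumes "n + i < N"
  shows "chord_fact N (n + i) / chord_fact N i \<le> (\<Sum>k\<le>n. chord_binomial N n k)"
  using norm_arc_poly_outside[of 1 n i N] norm_arc_poly_le[of n N 1 "unit_root N (n + i)"] assms
  by (simp del: of_nat_add)

lemma extremal_ratio_ge_1:
  assumes "n < N" shows "1 \<le> extremal_ratio N n"
proof -
  have "chord_fact N (n div 2) * chord_fact N (n - n div 2) \<le> chord_fact N n"
    using chord_fact_product_ge_central[of 0 n N] assms by simp
  also have "\<dots> \<le> (\<Sum>k\<le>n. chord_binomial N n k)" using sum_chord_binomial_ge[of n 0 N] assms by simp
  finally show ?thesis unfolding extremal_ratio_def
    using chord_fact_pos[of "n div 2" N] chord_fact_pos[of "n - n div 2" N] assms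
    by (simp add: le_divide_eq mult_pos_pos)
qed

text \<open>The quotients are the values of the arc polynomial at the roots of unity off the arc, where it does
  not vanish; its coefficients are known by the \<open>q\<close>-binomial theorem.\<close>

lemma sum_squares_arc_poly:
  assumes c: "cmod c = 1" and n: "n < N"
  shows "(\<Sum>i<N-n. (chord_fact N (n + i) / chord_fact N i)\<^sup>2) = real N * (\<Sum>k\<le>n. (chord_binomial N n k)\<^sup>2)"
proof -
  have "(\<Sum>i<N-n. (chord_fact N (n + i) / chord_fact N i)\<^sup>2)
      = (\<Sum>i<N-n. (cmod (poly (arc_poly N c n) (c * unit_root N (n + i))))\<^sup>2)"
    using c by (intro sum.cong refl) (simp add: norm_arc_poly_outside del: of_nat_add)
  also have "\<dots> = (\<Sum>j=n..<N. (cmod (poly (arc_poly N c n) (c * unit_root N j)))\<^sup>2)"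
    using n by (intro sum.reindex_bij_witness[of _ "\<lambda>j. j - n" "\<lambda>i. n + i"]) auto
  also have "\<dots> = (\<Sum>j<N. (cmod (poly (arc_poly N c n) (c * unit_root N j)))\<^sup>2)"
    by (intro sum.mono_neutral_left) (auto simp: arc_poly_node)
  also have "\<dots> = real N * (\<Sum>k<N. (cmod (coeff (arc_poly N c n) k))\<^sup>2)"
    using n c by (intro Parseval_roots_of_unity) (simp_all add: degree_arc_poly)
  also have "(\<Sum>k<N. (cmod (coeff (arc_poly N c n) k))\<^sup>2) = (\<Sum>k\<le>n. (cmod (coeff (arc_poly N c n) k))\<^sup>2)"
    using n by (intro sum.mono_neutral_right) (auto simp: coeff_eq_0 degree_arc_poly)
  finally show ?thesis using n c by (simp add: norm_coeff_arc_poly)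
qed

lemma arc_derivative_product:
  assumes "i < n" "n \<le> N"
  shows "(\<Prod>t\<in>{..<n} - {i}. cmod (unit_root N i - unit_root N t)) = chord_fact N i * chord_fact N (n - 1 - i)"
proof -
  have s: "{..<n} - {i} = {..<i} \<union> {Suc i..<n}" using assms by auto
  have "(\<Prod>t<i. cmod (unit_root N i - unit_root N t)) = (\<Prod>d=1..i. chord N d)"
    using assms by (intro prod.reindex_bij_witness[of _ "\<lambda>d. i - d" "\<lambda>t. i - t"]) (auto simp: norm_unit_root_diff)
  moreover have "(\<Prod>t=Suc i..<n. cmod (unit_root N i - unit_root N t)) = (\<Prod>d=1..n-1-i. chord N d)"
    using assms by (intro prod.reindex_bij_witness[of _ "\<lambda>d. i + d" "\<lambda>t. t - i"])
      (auto simp: norm_unit_root_diff norm_minus_commute[of "unit_root N i"])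
  ultimately show ?thesis unfolding s by (subst prod.union_disjoint) (auto simp: chord_fact_def)
qed

text \<open>A chord \<open>D\<close> is at least as long as the shorter of two chords whose lengths fit on either side of it.\<close>

lemma inverse_chord_le:
  assumes "p < D" "r < N - D" "D < N"
  shows "1 / chord N D \<le> 1 / chord N (Suc p) + 1 / chord N (Suc r)"
proof -
  have pos: "0 < chord N (Suc p)" "0 < chord N (Suc r)" "0 < chord N D"
    using assms by (auto intro!: chord_pos)
  have "chord N (Suc p) \<le> chord N D \<or> chord N (Suc r) \<le> chord N D"
  proof (cases "Suc p + D \<le> N")
    case True
    then show ?thesis using assms chord_mono[of "Suc p" D N] by simp
  next
    case False
    then have "chord N (Suc r) \<le> chord N (N - D)" using assms by (intro chord_mono) auto
    then show ?thesis using assms by (simp add: chord_complement)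
  qed
  then have "1 / chord N D \<le> 1 / chord N (Suc p) \<or> 1 / chord N D \<le> 1 / chord N (Suc r)"
    using pos by (auto simp: frac_le)
  then show ?thesis using pos by (smt (verit) divide_pos_pos)
qed

text \<open>The factor \<open>1 / chord D\<close> of a Lagrange value is absorbed by lengthening one of the two chord factorials
  by one; the result has the shape \<open>1 / (chord_fact k * chord_fact (n - k))\<close> of a chord binomial, which
  is how the singular factor is controlled even when node and evaluation point are adjacent.\<close>

lemma lagrange_weight_le:
  assumes D: "D = n + j - i" "i < n" "n + j < N"
  shows "1 / (chord N D * (chord_fact N i * chord_fact N (n - 1 - i)))
      \<le> 1 / (chord_fact N i * chord_fact N (n - i)) + 1 / (chord_fact N (Suc i) * chord_fact N (n - Suc i))"
proof -
  define p where "p = n - 1 - i"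
  have p: "n - i = Suc p" "n - Suc i = p" "n - 1 - i = p" using D by (auto simp: p_def)
  have pos: "0 < chord_fact N i" "0 < chord_fact N p" using D by (auto intro!: chord_fact_pos simp: p_def)
  have "1 / chord N D \<le> 1 / chord N (Suc p) + 1 / chord N (Suc i)"
    using D by (intro inverse_chord_le) (auto simp: p_def)
  then have "(1 / chord N D) * (1 / (chord_fact N i * chord_fact N p)) \<le>
      (1 / chord N (Suc p) + 1 / chord N (Suc i)) * (1 / (chord_fact N i * chord_fact N p))"
    using pos by (intro mult_right_mono) auto
  then show ?thesis unfolding p chord_fact_Suc by (simp add: add_divide_distrib mult_ac)
qed

lemma prod_antimono_le_initial:
  fixes g :: "nat \<Rightarrow> real"
  assumes "finite U" "U \<subseteq> {1..M}"
    and "\<And>i j. 1 \<le> i \<Longrightarrow> i \<le> j \<Longrightarrow> j \<le> M \<Longrightarrow> g j \<le> g i" "\<And>i. 1 \<le> i \<Longrightarrow> i \<le> M \<Longrightarrow> 0 \<le> g i"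
  shows "(\<Prod>u\<in>U. g u) \<le> (\<Prod>i=1..card U. g i)"
  using assms(1,2)
proof (induction U rule: finite_linorder_max_induct)
  case (insert b A)
  have "insert b A \<subseteq> {1..b}" using insert.prems insert.hyps(2) less_imp_le by fastforce
  then have "card (insert b A) \<le> card {1..b}" by (intro card_mono) auto
  then have cb: "card (insert b A) \<le> b" by simp
  have cA: "card (insert b A) = Suc (card A)" using insert by (auto simp: card_insert_if)
  have b: "b \<le> M" using insert by auto
  have "(\<Prod>u\<in>insert b A. g u) = g b * (\<Prod>u\<in>A. g u)" using insert by (auto intro: prod.insert)
  also have "\<dots> \<le> g (Suc (card A)) * (\<Prod>i=1..card A. g i)"
    using insert cb cA b assms(3,4) by (intro mult_mono) (auto intro!: prod_nonneg)
  finally show ?case unfolding cA by (simp add: mult.commute)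
qed simp

lemma prod_chord_ratio_le:
  assumes U: "U \<subseteq> {1..<D}" and D: "D < N"
  shows "(\<Prod>u\<in>U. chord N (D - u) / chord N u) \<le> (\<Prod>i=1..card U. chord N (D - i) / chord N i)"
proof (rule prod_antimono_le_initial[of _ "D - 1"])
  show "finite U" using U by (rule finite_subset) simp
  show "U \<subseteq> {1..D - 1}" by (rule order_trans[OF U]) auto
  fix i j :: nat assume ij: "1 \<le> i" "i \<le> j" "j \<le> D - 1"
  have "chord N (D - 1 - (j - 1)) * chord N (Suc (i - 1)) \<le> chord N (D - 1 - (i - 1)) * chord N (Suc (j - 1))"
    using ij D by (intro chord_product_le) auto
  moreover have "D - 1 - (j - 1) = D - j" "Suc (i - 1) = i" "D - 1 - (i - 1) = D - i" "Suc (j - 1) = j"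
    using ij by auto
  ultimately show "chord N (D - j) / chord N j \<le> chord N (D - i) / chord N i"
    using ij D chord_pos[of i N] chord_pos[of j N] by (simp add: frac_le_eq divide_simps mult.commute)
next
  fix i assume "1 \<le> i" "i \<le> D - 1"
  then show "0 \<le> chord N (D - i) / chord N i" using D by (auto intro!: divide_nonneg_nonneg chord_nonneg)
qed

lemma prod_chord_down:
  assumes "p < D" "D \<le> N"
  shows "(\<Prod>i=1..p. chord N (D - i) / chord N i) = chord_fact N (D - 1) / (chord_fact N (D - 1 - p) * chord_fact N p)"
  using assms
proof (induction p)
  case 0
  then have "D - 1 < N" by linarith
  then show ?case using chord_fact_pos[of "D - 1" N] by simp
next
  case (Suc p)
  have e: "D - 1 - p = Suc (D - 1 - Suc p)" "D - Suc p = Suc (D - 1 - Suc p)" using Suc.prems by auto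
  have "chord_fact N (D - 1 - p) = chord_fact N (D - 1 - Suc p) * chord N (D - Suc p)"
    unfolding e(1) chord_fact_Suc e(2) ..
  moreover have "chord N (D - Suc p) > 0" using Suc.prems by (intro chord_pos) auto
  ultimately show ?case using Suc by (simp add: chord_fact_Suc field_simps)
qed

lemma prod_chord_up:
  assumes "D + r < N"
  shows "(\<Prod>i=1..r. chord N (D + i) / chord N i) = chord_fact N (D + r) / (chord_fact N D * chord_fact N r)"
  using assms
proof (induction r)
  case 0
  then show ?case using chord_fact_pos[of D N] by simp
next
  case (Suc r)
  then show ?case by (simp add: chord_fact_Suc mult_ac)
qed

text \<open>The left-hand side is the modulus of a Lagrange basis polynomial on an arc: the node has \<open>i\<close> nodes on
  one side and \<open>n - 1 - i\<close> on the other, and the evaluation point lies \<open>j + 1\<close> steps beyond the arc.\<close>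

lemma lagrange_weight_bound:
  assumes "i < n" "n + j < N"
  shows "chord_fact N (n + j) / chord_fact N j / (chord N (n + j - i) * (chord_fact N i * chord_fact N (n - 1 - i)))
     \<le> 2 * extremal_ratio N n"
proof -
  let ?C = "\<Sum>k\<le>n. chord_binomial N n k"
  let ?M = "chord_fact N (n div 2) * chord_fact N (n - n div 2)"
  have M: "0 < ?M" using assms by (auto intro!: mult_pos_pos chord_fact_pos)
  have g: "1 / (chord_fact N k * chord_fact N (n - k)) \<le> 1 / ?M" if "k \<le> n" for k
    using chord_fact_product_ge_central[OF that, of N] M assms that by (intro divide_left_mono mult_pos_pos) (auto intro!: chord_fact_pos)
  have "1 / (chord N (n + j - i) * (chord_fact N i * chord_fact N (n - 1 - i))) \<le> 1 / ?M + 1 / ?M"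
    using lagrange_weight_le[OF refl assms] g[of i] g[of "Suc i"] assms by linarith
  moreover have "chord_fact N (n + j) / chord_fact N j \<le> ?C" using sum_chord_binomial_ge assms by simp
  moreover have "0 \<le> chord_fact N (n + j) / chord_fact N j"
    using assms by (auto intro!: divide_nonneg_nonneg less_imp_le[OF chord_fact_pos])
  moreover have "0 \<le> ?C" using assms by (intro sum_nonneg) (auto intro!: less_imp_le[OF chord_binomial_pos])
  moreover have "0 \<le> 1 / (chord N (n + j - i) * (chord_fact N i * chord_fact N (n - 1 - i)))"
    using assms by (auto intro!: mult_nonneg_nonneg less_imp_le[OF chord_fact_pos] less_imp_le[OF chord_pos])
  ultimately have "(chord_fact N (n + j) / chord_fact N j) * (1 / (chord N (n + j - i) * (chord_fact N i * chord_fact N (n - 1 - i))))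
     \<le> ?C * (1 / ?M + 1 / ?M)"
    by (intro mult_mono)
  then show ?thesis by (simp add: extremal_ratio_def mult.commute[of _ 2])
qed

lemma norm_unit_root_diff_mod:
  assumes "s < N" "t < N"
  defines "d \<equiv> (t + N - s) mod N"
  shows "d < N" "unit_root N t = unit_root N s * unit_root N d"
proof -
  show "d < N" using assms by (simp add: d_def)
  have "unit_root N s * unit_root N d = unit_root N s * unit_root N (t + N - s)"
    unfolding d_def unit_root_mod ..
  also have "\<dots> = unit_root N (s + (t + N - s))" by (rule unit_root_add[symmetric])
  also have "s + (t + N - s) = t + N" using assms by simp
  also have "unit_root N (t + N) = unit_root N ((t + N) mod N)" by (rule unit_root_mod[symmetric])
  also have "(t + N) mod N = t" using assms by simp
  finally show "unit_root N t = unit_root N s * unit_root N d" ..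
qed

text \<open>For a fixed node \<open>s\<close> and evaluation point \<open>j\<close> an arc is the worst set of nodes. In the distance \<open>u\<close>
  from \<open>s\<close> each remaining node contributes the ratio of its distances to \<open>j\<close> and to \<open>s\<close>; on either
  side of \<open>s\<close>, up to \<open>j\<close>, this ratio decreases in \<open>u\<close>. Moving the nodes of each side next to \<open>s\<close>
  therefore increases the product, and the result is an arc around \<open>s\<close>.\<close>

lemma norm_lagrange_basis_le:
  assumes S: "S \<subseteq> {..<N}" "card S < N" and s: "s \<in> S" and j: "j < N" "j \<notin> S"
  shows "cmod (poly (lagrange_basis (unit_root N ` S) (unit_root N s)) (unit_root N j)) \<le> 2 * extremal_ratio N (card S)"
proof -
  have fS: "finite S" using S(1) by (rule finite_subset) simp
  define d where "d = (\<lambda>t. (t + N - s) mod N)"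
  have sN: "s < N" using S s by auto
  have d: "d t < N" "unit_root N t = unit_root N s * unit_root N (d t)" if "t < N" for t
    unfolding d_def using norm_unit_root_diff_mod[OF sN that] by blast+
  have inj: "inj_on d {..<N}"
    by (rule inj_onI) (metis d(2) inj_on_unit_root inj_onD lessThan_iff)
  have d0: "d s = 0" using sN by (simp add: d_def)
  define D U where "D = d j" and "U = d ` (S - {s})"
  have inj': "inj_on d (S - {s})" using inj S(1) by (auto intro: inj_on_subset)
  have D: "0 < D" "D < N"
  proof -
    have "D \<noteq> d s" using inj_onD[OF inj, of j s] j sN s by (auto simp: D_def)
    then show "0 < D" "D < N" using d0 d(1)[of j] j by (auto simp: D_def)
  qed
  have U: "0 < u" "u < N" "u \<noteq> D" if u: "u \<in> U" for u
  proof -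
    obtain t where t: "t \<in> S" "t \<noteq> s" "u = d t" using u by (auto simp: U_def)
    have tN: "t < N" using t S by auto
    show "u < N" using d(1) tN t by simp
    have "u \<noteq> d s" "u \<noteq> D" using inj_onD[OF inj, of t s] inj_onD[OF inj, of t j] t tN sN j by (auto simp: D_def)
    then show "0 < u" "u \<noteq> D" using d0 by auto
  qed
  have fU: "finite U" using fS by (simp add: U_def)
  define h where "h = (\<lambda>u. chord N (if u < D then D - u else u - D) / chord N u)"
  have e: "cmod ((unit_root N j - unit_root N t) / (unit_root N s - unit_root N t)) = h (d t)"
    if t: "t \<in> S - {s}" for t
  proof -
    have tN: "t < N" using t S by auto
    have u: "d t \<in> U" using t by (auto simp: U_def)
    have "cmod (unit_root N s - unit_root N t) = cmod (unit_root N s * (unit_root N (d t) - unit_root N 0))"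
      unfolding d(2)[OF tN] by (simp add: right_diff_distrib norm_minus_commute)
    also have "\<dots> = chord N (d t)" using norm_unit_root_diff[of 0 "d t" N] U[OF u] by (simp add: norm_mult)
    finally have 1: "cmod (unit_root N s - unit_root N t) = chord N (d t)" .
    have "cmod (unit_root N j - unit_root N t) = cmod (unit_root N s * (unit_root N D - unit_root N (d t)))"
      unfolding d(2)[OF tN] d(2)[OF j(1)] D_def by (simp add: right_diff_distrib)
    also have "\<dots> = cmod (unit_root N D - unit_root N (d t))" by (simp add: norm_mult)
    also have "\<dots> = chord N (if d t < D then D - d t else d t - D)"
      using norm_unit_root_diff[of "d t" D N] norm_unit_root_diff[of D "d t" N] U[OF u] D
      by (auto simp: norm_minus_commute)
    finally show ?thesis by (simp add: norm_divide 1 h_def)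
  qed
  have inj2: "inj_on (unit_root N) (insert s S)"
    by (rule inj_on_subset[OF inj_on_unit_root]) (use S sN in auto)
  have im: "unit_root N ` S - {unit_root N s} = unit_root N ` (S - {s})"
    using inj2 s by (auto dest: inj_onD)
  have "cmod (poly (lagrange_basis (unit_root N ` S) (unit_root N s)) (unit_root N j))
      = (\<Prod>t\<in>S - {s}. cmod ((unit_root N j - unit_root N t) / (unit_root N s - unit_root N t)))"
    unfolding poly_lagrange_basis im using inj2
    by (subst prod.reindex) (auto simp: prod_norm intro: inj_on_subset)
  also have "\<dots> = (\<Prod>t\<in>S - {s}. h (d t))" using e by (intro prod.cong) auto
  also have "\<dots> = (\<Prod>u\<in>U. h u)" unfolding U_def by (subst prod.reindex[OF inj']) simp
  finally have L: "cmod (poly (lagrange_basis (unit_root N ` S) (unit_root N s)) (unit_root N j)) = (\<Prod>u\<in>U. h u)" .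
  (* nodes met before j when leaving s forwards, and, measured backwards, the others *)
  define U1 U2 where "U1 = {u\<in>U. u < D}" and "U2 = (\<lambda>u. N - u) ` {u\<in>U. D < u}"
  have "u < D \<or> D < u" if "u \<in> U" for u using U(3)[OF that] by linarith
  then have U12: "U = U1 \<union> {u\<in>U. D < u}" "U1 \<inter> {u\<in>U. D < u} = {}" by (auto simp: U1_def)
  have injN: "inj_on (\<lambda>u. N - u) {u\<in>U. D < u}"
  proof (rule inj_onI)
    fix x y assume "x \<in> {u\<in>U. D < u}" "y \<in> {u\<in>U. D < u}" "N - x = N - y"
    moreover from this have "x < N" "y < N" using U(2) by auto
    ultimately show "x = y" by simp
  qed
  have cU2: "card U2 = card {u\<in>U. D < u}" unfolding U2_def by (rule card_image[OF injN])
  define p r where "p = card U1" and "r = card U2"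
  have "card U = p + r" unfolding p_def r_def cU2 using U12 fU by (subst U12(1), subst card_Un_disjoint) (auto simp: U1_def)
  moreover have "card U = card S - 1" unfolding U_def card_image[OF inj'] using s fS by simp
  moreover have "card S > 0" using s fS by (auto simp: card_gt_0_iff)
  ultimately have n: "card S = p + r + 1" by simp
  have U1: "U1 \<subseteq> {1..<D}" using U by (auto simp: U1_def Suc_le_eq)
  have U2: "U2 \<subseteq> {1..<N - D}"
  proof
    fix v assume "v \<in> U2"
    then obtain u where "u \<in> U" "D < u" "v = N - u" by (auto simp: U2_def)
    with U(2)[of u] show "v \<in> {1..<N - D}" by auto
  qed
  have p: "p < D" using card_mono[OF _ U1] D by (simp add: p_def)
  have r: "r < N - D" using card_mono[OF _ U2] D by (simp add: r_def)
  have h1: "(\<Prod>u\<in>U1. h u) = (\<Prod>u\<in>U1. chord N (D - u) / chord N u)"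
    by (intro prod.cong) (auto simp: h_def U1_def)
  have h2: "(\<Prod>u\<in>{u\<in>U. D < u}. h u) = (\<Prod>u\<in>U2. chord N (N - D - u) / chord N u)"
    unfolding U2_def prod.reindex[OF injN] o_def
  proof (rule prod.cong[OF refl])
    fix u assume "u \<in> {u\<in>U. D < u}"
    then have u: "D < u" "u < N" using U by auto
    have "N - D - (N - u) = u - D" using u by simp
    then show "h u = chord N (N - D - (N - u)) / chord N (N - u)"
      using u by (simp add: h_def chord_complement)
  qed
  have "(\<Prod>i=1..r. chord N (N - D - i) / chord N i) = (\<Prod>i=1..r. chord N (D + i) / chord N i)"
  proof (rule prod.cong[OF refl])
    fix i assume "i \<in> {1..r}"
    then have "D + i \<le> N" using r by auto
    then show "chord N (N - D - i) / chord N i = chord N (D + i) / chord N i"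
      using chord_complement[of "D + i" N] by simp
  qed
  then have up: "(\<Prod>i=1..r. chord N (N - D - i) / chord N i) = chord_fact N (D + r) / (chord_fact N D * chord_fact N r)"
    using prod_chord_up[of D r N] r by simp
  have "(\<Prod>u\<in>U. h u) = (\<Prod>u\<in>U1. h u) * (\<Prod>u\<in>{u\<in>U. D < u}. h u)"
    using fU U12 by (subst U12(1), subst prod.union_disjoint) (auto simp: U1_def)
  also have "\<dots> \<le> (\<Prod>i=1..p. chord N (D - i) / chord N i) * (\<Prod>i=1..r. chord N (N - D - i) / chord N i)"
    unfolding h1 h2 p_def r_def
  proof (intro mult_mono)
    show "(\<Prod>u\<in>U1. chord N (D - u) / chord N u) \<le> (\<Prod>i=1..card U1. chord N (D - i) / chord N i)"
      using U1 D by (intro prod_chord_ratio_le) auto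
    show "(\<Prod>u\<in>U2. chord N (N - D - u) / chord N u) \<le> (\<Prod>i=1..card U2. chord N (N - D - i) / chord N i)"
      using U2 D by (intro prod_chord_ratio_le) auto
    have "u \<le> N" if "u \<in> U2" for u
    proof -
      have "u < N - D" using subsetD[OF U2 that] by simp
      then show ?thesis by linarith
    qed
    then show "0 \<le> (\<Prod>u\<in>U2. chord N (N - D - u) / chord N u)"
      by (intro prod_nonneg ballI divide_nonneg_nonneg chord_nonneg) auto
  qed (use p r D in \<open>auto intro!: prod_nonneg divide_nonneg_nonneg chord_nonneg simp: p_def r_def\<close>)
  also have "\<dots> = (chord_fact N (D - 1) / (chord_fact N (D - 1 - p) * chord_fact N p)) * (chord_fact N (D + r) / (chord_fact N D * chord_fact N r))"
    using prod_chord_down[of p D N] p D up by simp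
  also have "\<dots> = chord_fact N (card S + (D - 1 - p)) / chord_fact N (D - 1 - p) / (chord N (card S + (D - 1 - p) - r) * (chord_fact N r * chord_fact N (card S - 1 - r)))"
  proof -
    have x: "card S + (D - 1 - p) = D + r" "D + r - r = D" "card S - 1 - r = p" using n p by auto
    have y: "chord_fact N D = chord_fact N (D - 1) * chord N D" using D chord_fact_Suc[of N "D - 1"] by simp
    have "0 < chord_fact N (D - 1)" using D by (intro chord_fact_pos) auto
    then show ?thesis unfolding x y by (simp add: field_simps)
  qed
  also have "\<dots> \<le> 2 * extremal_ratio N (card S)"
    using n p r by (intro lagrange_weight_bound) auto
  finally show ?thesis unfolding L .
qed

lemma interpolation_constant_le:
  assumes S: "S \<subseteq> {..<N}" "card S < N"
  shows "interpolation_constant (unit_root N ` S) \<le> 4 * real N * (extremal_ratio N (card S))\<^sup>2"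
proof (cases "N = 0")
  case False
  let ?Z = "unit_root N ` S" and ?E = "extremal_ratio N (card S)"
  have fS: "finite S" using S(1) by (rule finite_subset) simp
  have inj: "inj_on (unit_root N) S" using inj_on_unit_root S(1) by (rule inj_on_subset)
  have card: "card ?Z = card S" using inj by (rule card_image)
  have E: "1 \<le> ?E" using extremal_ratio_ge_1 S by simp
  have le: "(cmod (poly (lagrange_basis ?Z z) (1 * unit_root N j)))\<^sup>2 \<le> (2 * ?E)\<^sup>2"
    if z: "z \<in> ?Z" and j: "j < N" for z j
  proof -
    obtain s where s: "s \<in> S" "z = unit_root N s" using z by auto
    have "cmod (poly (lagrange_basis ?Z z) (unit_root N j)) \<le> 2 * ?E"
    proof (cases "j \<in> S")
      case True
      then show ?thesis using poly_lagrange_basis_node[of ?Z z "unit_root N j"] fS z E by auto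
    next
      case False
      then show ?thesis unfolding s(2) using norm_lagrange_basis_le[OF S s(1) j] by simp
    qed
    then show ?thesis by (intro power_mono) auto
  qed
  have "real N * interpolation_constant ?Z = (\<Sum>z\<in>?Z. \<Sum>j<N. (cmod (poly (lagrange_basis ?Z z) (1 * unit_root N j)))\<^sup>2)"
    using fS card S(2) by (intro interpolation_constant_Parseval) auto
  also have "\<dots> \<le> (\<Sum>z\<in>?Z. \<Sum>j<N. (2 * ?E)\<^sup>2)" using le by (intro sum_mono) auto
  also have "\<dots> = real (card S) * (real N * (2 * ?E)\<^sup>2)" by (simp add: card)
  also have "\<dots> \<le> real N * (real N * (2 * ?E)\<^sup>2)" using S(2) by (intro mult_right_mono) auto
  finally show ?thesis using False by (simp add: power2_eq_square mult_ac)
qed (use S in simp)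

section \<open>Interpolation at consecutive roots of unity\<close>

definition arc_nodes :: "nat \<Rightarrow> complex \<Rightarrow> nat \<Rightarrow> complex set" where
  "arc_nodes N c n = (\<lambda>i. c * unit_root N i) ` {..<n}"

lemma inj_on_arc_nodes: "cmod c = 1 \<Longrightarrow> n \<le> N \<Longrightarrow> inj_on (\<lambda>i. c * unit_root N i) {..<n}"
  by (rule inj_onI) (use inj_onD[OF inj_on_unit_root[of N]] in auto)

lemma sum_inverse_products_arc:
  assumes "n < N"
  shows "(\<Sum>k\<le>n. (1 / (chord_fact N k * chord_fact N (n - k)))\<^sup>2)
       = (\<Sum>k\<le>n. (chord_binomial N n k)\<^sup>2) / (chord_fact N n)\<^sup>2"
  using chord_fact_pos[OF assms] unfolding sum_divide_distrib
  by (intro sum.cong refl) (simp add: chord_binomial_def power_divide)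

lemma norm_lagrange_basis_arc:
  assumes c: "cmod c = 1" and "i < n" "n + j < N"
  shows "cmod (poly (lagrange_basis (arc_nodes N c n) (c * unit_root N i)) (c * unit_root N (n + j)))
     = chord_fact N (n + j) / chord_fact N j / (chord N (n + j - i) * (chord_fact N i * chord_fact N (n - 1 - i)))"
proof -
  let ?w = "\<lambda>i. c * unit_root N i"
  have inj: "inj_on ?w {..<n}" using c assms by (intro inj_on_arc_nodes) auto
  have c0: "c \<noteq> 0" using c by auto
  have im: "arc_nodes N c n - {?w i} = ?w ` ({..<n} - {i})"
    using inj assms(2) unfolding arc_nodes_def by (auto dest: inj_onD)
  have "cmod (poly (lagrange_basis (arc_nodes N c n) (?w i)) (?w (n + j)))
      = (\<Prod>t\<in>{..<n} - {i}. cmod ((?w (n + j) - ?w t) / (?w i - ?w t)))"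
    unfolding poly_lagrange_basis im using inj
    by (subst prod.reindex) (auto simp: prod_norm intro: inj_on_subset)
  also have "\<dots> = (\<Prod>t\<in>{..<n} - {i}. cmod (unit_root N (n + j) - unit_root N t))
      / (\<Prod>t\<in>{..<n} - {i}. cmod (unit_root N i - unit_root N t))"
    unfolding prod_dividef[symmetric] right_diff_distrib[symmetric]
    using c c0 by (intro prod.cong refl) (simp add: norm_divide norm_mult del: of_nat_add)
  also have "(\<Prod>t\<in>{..<n} - {i}. cmod (unit_root N i - unit_root N t)) = chord_fact N i * chord_fact N (n - 1 - i)"
    using assms by (intro arc_derivative_product) auto
  also have "(\<Prod>t\<in>{..<n} - {i}. cmod (unit_root N (n + j) - unit_root N t)) = (\<Prod>t\<in>{..<n} - {i}. chord N (n + j - t))"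
    using assms by (intro prod.cong refl norm_unit_root_diff) auto
  also have "\<dots> = (\<Prod>t<n. chord N (n + j - t)) / chord N (n + j - i)"
  proof -
    have "0 < chord N (n + j - i)" using assms by (intro chord_pos) auto
    then show ?thesis using assms by (subst prod.remove[of "{..<n}" i]) auto
  qed
  also have "\<dots> = chord_fact N (n + j) / chord_fact N j / chord N (n + j - i)"
    using arc_product[of j n N] assms by (simp add: add.commute)
  finally show ?thesis by simp
qed

text \<open>For an arc the squares of the Lagrange values are bounded by a product of a function of the node and
  a function of the evaluation point. Both sums are \<open>\<ell>\<^sup>2\<close> norms of chord binomials, the second by
  Parseval, and \<open>\<Sum>B\<^sup>2 \<le> (max B) * (\<Sum>B)\<close>. Summing instead of estimating all values by the largest saves
  a factor \<open>N\<close> against the bound for arbitrary nodes: the values concentrate near the centres of the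
  arc and of its complement.\<close>

lemma interpolation_constant_arc_le:
  assumes c: "cmod c = 1" and n: "n < N"
  shows "interpolation_constant (arc_nodes N c n) \<le> 5 * (extremal_ratio N n)\<^sup>2"
proof -
  let ?w = "\<lambda>i. c * unit_root N i" and ?Z = "arc_nodes N c n" and ?E = "extremal_ratio N n"
  let ?B2 = "\<Sum>k\<le>n. (chord_binomial N n k)\<^sup>2"
  let ?R = "\<lambda>j. chord_fact N (n + j) / chord_fact N j"
  define g where "g = (\<lambda>k. 1 / (chord_fact N k * chord_fact N (n - k)))"
  have inj: "inj_on ?w {..<n}" using c n by (intro inj_on_arc_nodes) auto
  have card: "card ?Z = n" unfolding arc_nodes_def card_image[OF inj] by simp
  have fZ: "finite ?Z" by (simp add: arc_nodes_def)
  have E: "1 \<le> ?E" using extremal_ratio_ge_1 n by simp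
  have G: "0 < chord_fact N n" using n by (rule chord_fact_pos)
  have gn: "0 \<le> g k" if "k \<le> n" for k
    unfolding g_def using that n by (auto intro!: mult_nonneg_nonneg less_imp_le[OF chord_fact_pos])
  have Rn: "0 \<le> ?R j" if "j < N - n" for j
    using that by (intro divide_nonneg_nonneg less_imp_le[OF chord_fact_pos]) auto
  have sub: "(\<Sum>j<N. (cmod (poly (lagrange_basis ?Z (?w i)) (?w j)))\<^sup>2)
      \<le> 1 + (2 * (g i)\<^sup>2 + 2 * (g (Suc i))\<^sup>2) * (real N * ?B2)" if i: "i < n" for i
  proof -
    have in1: "?w i \<in> ?Z" using i by (auto simp: arc_nodes_def)
    have s: "{..<N} = {..<n} \<union> {n..<N}" using n by auto
    have "(\<Sum>j<n. (cmod (poly (lagrange_basis ?Z (?w i)) (?w j)))\<^sup>2) = (\<Sum>j<n. if j = i then 1 else 0)"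
    proof (rule sum.cong[OF refl])
      fix j assume j: "j \<in> {..<n}"
      then have "?w j \<in> ?Z" by (auto simp: arc_nodes_def)
      then have "poly (lagrange_basis ?Z (?w i)) (?w j) = (if ?w j = ?w i then 1 else 0)"
        by (rule poly_lagrange_basis_node[OF fZ in1])
      moreover have "?w j = ?w i \<longleftrightarrow> j = i" using inj_onD[OF inj, of j i] i j by auto
      ultimately show "(cmod (poly (lagrange_basis ?Z (?w i)) (?w j)))\<^sup>2 = (if j = i then 1 else 0)" by simp
    qed
    also have "\<dots> = 1" using i by simp
    finally have 1: "(\<Sum>j<n. (cmod (poly (lagrange_basis ?Z (?w i)) (?w j)))\<^sup>2) = 1" .
    have "(\<Sum>j=n..<N. (cmod (poly (lagrange_basis ?Z (?w i)) (?w j)))\<^sup>2)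
        = (\<Sum>j<N-n. (cmod (poly (lagrange_basis ?Z (?w i)) (?w (n + j))))\<^sup>2)"
      using n by (intro sum.reindex_bij_witness[of _ "\<lambda>i. n + i" "\<lambda>j. j - n"]) auto
    also have "\<dots> \<le> (\<Sum>j<N-n. (2 * (g i)\<^sup>2 + 2 * (g (Suc i))\<^sup>2) * (?R j)\<^sup>2)"
    proof (rule sum_mono)
      fix j assume j: "j \<in> {..<N - n}"
      then have jn: "n + j < N" by auto
      have "cmod (poly (lagrange_basis ?Z (?w i)) (?w (n + j)))
         = ?R j * (1 / (chord N (n + j - i) * (chord_fact N i * chord_fact N (n - 1 - i))))"
        using norm_lagrange_basis_arc[OF c i jn] by simp
      also have "\<dots> \<le> ?R j * (g i + g (Suc i))"
        using lagrange_weight_le[OF refl i jn] Rn j unfolding g_def by (intro mult_left_mono) auto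
      finally have "(cmod (poly (lagrange_basis ?Z (?w i)) (?w (n + j))))\<^sup>2 \<le> (?R j * (g i + g (Suc i)))\<^sup>2"
        by (intro power_mono) auto
      also have "\<dots> = (g i + g (Suc i))\<^sup>2 * (?R j)\<^sup>2" by (simp only: power_mult_distrib mult.commute)
      also have "\<dots> \<le> (2 * (g i)\<^sup>2 + 2 * (g (Suc i))\<^sup>2) * (?R j)\<^sup>2"
        using sum_squares_bound[of "g i" "g (Suc i)"] by (intro mult_right_mono) (auto simp: power2_sum)
      finally show "(cmod (poly (lagrange_basis ?Z (?w i)) (?w (n + j))))\<^sup>2 \<le> (2 * (g i)\<^sup>2 + 2 * (g (Suc i))\<^sup>2) * (?R j)\<^sup>2" .
    qed
    also have "\<dots> = (2 * (g i)\<^sup>2 + 2 * (g (Suc i))\<^sup>2) * (real N * ?B2)"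
      unfolding sum_distrib_left[symmetric] sum_squares_arc_poly[OF c n] ..
    finally show ?thesis unfolding s using 1 by (subst sum.union_disjoint) auto
  qed
  have "real N * interpolation_constant ?Z = (\<Sum>z\<in>?Z. \<Sum>j<N. (cmod (poly (lagrange_basis ?Z z) (?w j)))\<^sup>2)"
    using fZ card n c by (intro interpolation_constant_Parseval) auto
  also have "\<dots> = (\<Sum>i<n. \<Sum>j<N. (cmod (poly (lagrange_basis ?Z (?w i)) (?w j)))\<^sup>2)"
    by (subst (1) arc_nodes_def, subst sum.reindex[OF inj]) simp
  also have "\<dots> \<le> (\<Sum>i<n. 1 + (2 * (g i)\<^sup>2 + 2 * (g (Suc i))\<^sup>2) * (real N * ?B2))"
    using sub by (intro sum_mono) auto
  also have "\<dots> = real n + (2 * (\<Sum>i<n. (g i)\<^sup>2) + 2 * (\<Sum>i<n. (g (Suc i))\<^sup>2)) * (real N * ?B2)"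
    by (simp add: sum.distrib flip: sum_distrib_left sum_distrib_right)
  also have "\<dots> \<le> real N + (4 * (\<Sum>k\<le>n. (g k)\<^sup>2)) * (real N * ?B2)"
  proof -
    have "(\<Sum>i<n. (g i)\<^sup>2) \<le> (\<Sum>k\<le>n. (g k)\<^sup>2)" by (intro sum_mono2) auto
    moreover have "(\<Sum>i<n. (g (Suc i))\<^sup>2) \<le> (\<Sum>k\<le>n. (g k)\<^sup>2)"
      using sum.lessThan_Suc_shift[of "\<lambda>i. (g i)\<^sup>2" n] by (simp add: lessThan_Suc_atMost)
    moreover have "0 \<le> real N * ?B2" by (intro mult_nonneg_nonneg sum_nonneg) auto
    ultimately show ?thesis using n by (intro add_mono mult_right_mono) auto
  qed
  also have "(\<Sum>k\<le>n. (g k)\<^sup>2) = ?B2 / (chord_fact N n)\<^sup>2"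
    unfolding g_def by (rule sum_inverse_products_arc[OF n])
  also have "real N + (4 * (?B2 / (chord_fact N n)\<^sup>2)) * (real N * ?B2) = real N * (1 + 4 * (?B2 / chord_fact N n)\<^sup>2)"
    by (simp add: algebra_simps power_divide power2_eq_square)
  finally have "interpolation_constant ?Z \<le> 1 + 4 * (?B2 / chord_fact N n)\<^sup>2" using n by simp
  also have "(?B2 / chord_fact N n)\<^sup>2 \<le> ?E\<^sup>2"
    using sum_squares_binomial_le[OF n] G
    by (intro power_mono divide_nonneg_nonneg sum_nonneg) (auto simp: divide_le_eq mult.commute)
  also have "1 \<le> ?E\<^sup>2" using E by (simp add: one_le_power)
  finally show ?thesis by simp
qed

text \<open>By \<open>chord n \<le> chord (n - k) + chord k\<close> a chord binomial of order \<open>n\<close> is bounded by two neighbouring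
  ones of order \<open>n - 1\<close>; the price is the factor \<open>chord n\<close>, of order \<open>\<alpha>(1 - \<alpha>)\<close>.\<close>

lemma sum_inverse_products_ge:
  assumes n: "1 \<le> n" "n < N"
  shows "(chord N n)\<^sup>2 * (\<Sum>k\<le>n. (chord_binomial N n k)\<^sup>2)
    \<le> 4 * (chord_fact N n)\<^sup>2 * (\<Sum>i<n. (1 / (chord_fact N i * chord_fact N (n - 1 - i)))\<^sup>2)"
proof -
  define q where "q = (\<lambda>i. if i < n then 1 / (chord_fact N i * chord_fact N (n - 1 - i)) else 0)"
  define q' where "q' = (\<lambda>i. if i = 0 then 0 else q (i - 1))"
  let ?G = "chord_fact N n"
  have G: "0 < ?G" using n by (intro chord_fact_pos) auto
  have b: "chord N n * chord_binomial N n k \<le> ?G * (q k + q' k)" if k: "k \<le> n" for k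
  proof -
    have B: "0 < chord_binomial N n k" using chord_binomial_pos[OF k] n by simp
    have 1: "chord N (n - k) * chord_binomial N n k = ?G * q k"
    proof (cases "k < n")
      case True
      then have e: "n - k = Suc (n - 1 - k)" by simp
      have "chord_fact N (n - k) = chord_fact N (n - 1 - k) * chord N (n - k)"
        unfolding e chord_fact_Suc ..
      moreover have "0 < chord N (n - k)" using True n by (intro chord_pos) auto
      ultimately show ?thesis using True by (simp add: chord_binomial_def q_def)
    next
      case False
      then show ?thesis using k by (simp add: q_def)
    qed
    have 2: "chord N k * chord_binomial N n k = ?G * q' k"
    proof (cases k)
      case (Suc l)
      have "0 < chord N (Suc l)" using Suc k n by (intro chord_pos) auto
      then show ?thesis using Suc k by (simp add: chord_binomial_def q_def q'_def chord_fact_Suc)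
    qed (simp add: q'_def)
    have "chord N n \<le> chord N (n - k) + chord N k" using chord_add_le[of "n - k" N k] k n by simp
    then have "chord N n * chord_binomial N n k \<le> (chord N (n - k) + chord N k) * chord_binomial N n k"
      using B by (intro mult_right_mono) auto
    then show ?thesis using 1 2 by (simp add: algebra_simps)
  qed
  have "(chord N n)\<^sup>2 * (\<Sum>k\<le>n. (chord_binomial N n k)\<^sup>2) = (\<Sum>k\<le>n. (chord N n * chord_binomial N n k)\<^sup>2)"
    by (simp add: sum_distrib_left power_mult_distrib)
  also have "\<dots> \<le> (\<Sum>k\<le>n. ?G\<^sup>2 * (2 * (q k)\<^sup>2 + 2 * (q' k)\<^sup>2))"
  proof (rule sum_mono)
    fix k assume "k \<in> {..n}"
    then have k: "k \<le> n" by simp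
    have "0 \<le> chord N n * chord_binomial N n k"
      using chord_binomial_pos[OF k] n by (intro mult_nonneg_nonneg chord_nonneg) (auto intro: less_imp_le)
    then have "(chord N n * chord_binomial N n k)\<^sup>2 \<le> (?G * (q k + q' k))\<^sup>2"
      using b[OF k] by (intro power_mono)
    also have "\<dots> \<le> ?G\<^sup>2 * (2 * (q k)\<^sup>2 + 2 * (q' k)\<^sup>2)"
      unfolding power_mult_distrib using sum_squares_bound[of "q k" "q' k"]
      by (intro mult_left_mono) (auto simp: power2_sum)
    finally show "(chord N n * chord_binomial N n k)\<^sup>2 \<le> ?G\<^sup>2 * (2 * (q k)\<^sup>2 + 2 * (q' k)\<^sup>2)" .
  qed
  also have "\<dots> = ?G\<^sup>2 * (2 * (\<Sum>k\<le>n. (q k)\<^sup>2) + 2 * (\<Sum>k\<le>n. (q' k)\<^sup>2))"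
    by (simp only: sum.distrib sum_distrib_left[symmetric])
  also have "(\<Sum>k\<le>n. (q k)\<^sup>2) = (\<Sum>k<n. (q k)\<^sup>2)"
    by (intro sum.mono_neutral_right) (auto simp: q_def)
  also have "(\<Sum>k\<le>n. (q' k)\<^sup>2) = (\<Sum>k<n. (q k)\<^sup>2)"
    using sum.lessThan_Suc_shift[of "\<lambda>i. (q' i)\<^sup>2" n] by (simp add: lessThan_Suc_atMost q'_def)
  also have "(\<Sum>k<n. (q k)\<^sup>2) = (\<Sum>i<n. (1 / (chord_fact N i * chord_fact N (n - 1 - i)))\<^sup>2)"
    by (intro sum.cong) (auto simp: q_def)
  finally show ?thesis by (simp add: mult_ac)
qed

text \<open>Off the arc, the matrix of Lagrange values equals, up to unimodular factors for rows and columns, a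
  matrix with positive entries: \<open>z_j - z_i\<close> is, up to a constant phase, a positive chord times the product of the half-angle
  phases of \<open>z_j\<close> and \<open>z_i\<close>. A combination of the basis polynomials with matching phases therefore has no
  cancellation. As every chord is at most \<open>2\<close>, the matrix dominates a rank-one matrix, and the weights
  \<open>q i\<close> at the nodes are optimal for that one.\<close>

lemma arc_extremal_polynomial:
  assumes c: "cmod c = 1" and n: "1 \<le> n" "n < N"
  shows "\<exists>p. degree p < n \<and> p \<noteq> 0 \<and>
     (chord N n * extremal_ratio N n / 16)\<^sup>2 * (\<Sum>z\<in>arc_nodes N c n. (cmod (poly p z))\<^sup>2) \<le> (\<Sum>k<n. (cmod (coeff p k))\<^sup>2)"
proof -
  let ?w = "\<lambda>i. c * unit_root N i" and ?P = "arc_poly N c n"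
  let ?R = "\<lambda>j. chord_fact N (n + j) / chord_fact N j"
  let ?B2 = "\<Sum>k\<le>n. (chord_binomial N n k)\<^sup>2"
  define q where "q = (\<lambda>i. 1 / (chord_fact N i * chord_fact N (n - 1 - i)))"
  define Q where "Q = (\<Sum>i<n. (q i)\<^sup>2)"
  define half where "half = (\<lambda>i. cis (pi * real i / real N))"
  have hh: "unit_root N i = half i * half i" for i
    unfolding half_def cis_mult by (rule arg_cong[of _ _ cis]) simp
  have nh: "cmod (half i) = 1" for i by (simp add: half_def)
  have c0: "c \<noteq> 0" using c by auto
  have h0: "half i \<noteq> 0" for i by (simp add: half_def)
  have inj: "inj_on ?w {..<n}" using c n by (intro inj_on_arc_nodes) auto
  have q: "0 < q i" if "i < n" for i
    using that n unfolding q_def by (intro divide_pos_pos mult_pos_pos chord_fact_pos) auto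
  define T where "T = (\<lambda>i. \<Prod>t\<in>{..<n} - {i}. [:- ?w t, 1:])"
  (* the half-angle phase cancels the phase of 1 / (z_j - z_i) *)
  define a where "a = (\<lambda>i. half i * of_real ((q i)\<^sup>2))"
  define p where "p = (\<Sum>i<n. Polynomial.smult (a i) (T i))"
  have T: "?P = [:- ?w i, 1:] * T i" if "i < n" for i
    unfolding arc_poly_def T_def using that by (intro prod.remove) auto
  have degT: "degree (T i) \<le> n - 1" if "i < n" for i
  proof -
    have "degree (T i) \<le> (\<Sum>t\<in>{..<n} - {i}. degree [:- ?w t, 1:])"
      unfolding T_def by (rule order_trans[OF degree_prod_sum_le]) auto
    then show ?thesis using that by simp
  qed
  have "degree p \<le> n - 1" unfolding p_def
  proof (rule degree_sum_le)
    fix i assume "i \<in> {..<n}"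
    then show "degree (Polynomial.smult (a i) (T i)) \<le> n - 1" using order_trans[OF degree_smult_le degT] by simp
  qed simp
  then have dp: "degree p < n" using n by simp
  have node: "cmod (poly p (?w i)) = q i" if i: "i < n" for i
  proof -
    have "poly (T t) (?w i) = 0" if "t < n" "t \<noteq> i" for t
      using that i unfolding T_def poly_prod by (intro prod_zero) auto
    then have "poly p (?w i) = (\<Sum>t<n. if t = i then a i * poly (T i) (?w i) else 0)"
      unfolding p_def poly_sum by (intro sum.cong) auto
    also have "\<dots> = a i * poly (T i) (?w i)" using i by simp
    also have "cmod \<dots> = (q i)\<^sup>2 * (\<Prod>t\<in>{..<n} - {i}. cmod (?w i - ?w t))"
      by (simp add: a_def norm_mult norm_power nh T_def poly_prod prod_norm)
    also have "(\<Prod>t\<in>{..<n} - {i}. cmod (?w i - ?w t)) = (\<Prod>t\<in>{..<n} - {i}. cmod (unit_root N i - unit_root N t))"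
      using c by (intro prod.cong) (auto simp: norm_mult right_diff_distrib[symmetric])
    also have "\<dots> = 1 / q i"
      using arc_derivative_product[of i n N] i n by (simp add: q_def)
    finally show ?thesis using q[OF i] by (simp add: power2_eq_square)
  qed
  have outside: "?R j * Q / 2 \<le> cmod (poly p (?w (n + j)))" if j: "n + j < N" for j
  proof -
    let ?x = "?w (n + j)"
    have diff: "?x - ?w i = c * half (n + j) * half i * \<i> * of_real (chord N (n + j - i))" if "i < n" for i
    proof -
      have e1: "(2 * pi * real (n + j) / real N - 2 * pi * real i / real N) / 2 = pi * real (n + j - i) / real N"
        using that by (simp add: of_nat_diff algebra_simps diff_divide_distrib add_divide_distrib)
      have e2: "cis ((2 * pi * real (n + j) / real N + 2 * pi * real i / real N) / 2) = half (n + j) * half i"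
        unfolding half_def cis_mult by (rule arg_cong[of _ _ cis]) (simp add: add_divide_distrib)
      show ?thesis unfolding right_diff_distrib[symmetric] cis_diff e1 e2 by (simp add: chord_def mult_ac)
    qed
    have summand: "a i * poly (T i) ?x = poly ?P ?x / (c * half (n + j) * \<i>) * of_real ((q i)\<^sup>2 / chord N (n + j - i))"
      if i: "i < n" for i
    proof -
      have "0 < chord N (n + j - i)" using i j by (intro chord_pos) auto
      then have "complex_of_real (chord N (n + j - i)) \<noteq> 0" by simp
      moreover have "poly ?P ?x = (?x - ?w i) * poly (T i) ?x" unfolding T[OF i] by (simp add: algebra_simps del: of_nat_add)
      ultimately show ?thesis unfolding diff[OF i] a_def using c0 h0 by (simp add: field_simps)
    qed
    have "poly p ?x = (\<Sum>i<n. poly ?P ?x / (c * half (n + j) * \<i>) * of_real ((q i)\<^sup>2 / chord N (n + j - i)))"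
      unfolding p_def poly_sum poly_smult by (intro sum.cong refl summand) auto
    also have "\<dots> = poly ?P ?x / (c * half (n + j) * \<i>) * of_real (\<Sum>i<n. (q i)\<^sup>2 / chord N (n + j - i))"
      by (simp only: sum_distrib_left of_real_sum)
    finally have "cmod (poly p ?x) = ?R j * \<bar>\<Sum>i<n. (q i)\<^sup>2 / chord N (n + j - i)\<bar>"
      using norm_arc_poly_outside[OF c j] c nh by (simp only: norm_mult norm_divide norm_of_real norm_ii mult_1_right div_by_1)
    moreover have "Q / 2 \<le> (\<Sum>i<n. (q i)\<^sup>2 / chord N (n + j - i))"
      unfolding Q_def sum_divide_distrib
    proof (rule sum_mono)
      fix i assume "i \<in> {..<n}"
      then show "(q i)\<^sup>2 / 2 \<le> (q i)\<^sup>2 / chord N (n + j - i)"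
        using j by (intro divide_left_mono chord_le_2 mult_pos_pos chord_pos) auto
    qed
    moreover have "0 \<le> ?R j" using j by (intro divide_nonneg_nonneg less_imp_le[OF chord_fact_pos]) auto
    ultimately show ?thesis using mult_left_mono[of "Q / 2" "\<bar>\<Sum>i<n. (q i)\<^sup>2 / chord N (n + j - i)\<bar>" "?R j"] by simp
  qed
  have Qpos: "0 < Q" unfolding Q_def using n by (intro sum_pos zero_less_power q) (auto simp: lessThan_empty_iff)
  have sumnodes: "(\<Sum>z\<in>arc_nodes N c n. (cmod (poly p z))\<^sup>2) = Q"
    unfolding arc_nodes_def sum.reindex[OF inj] Q_def by (intro sum.cong) (auto simp: node)
  have "real N * (Q\<^sup>2 / 4 * ?B2) = (\<Sum>j<N-n. (?R j * Q / 2)\<^sup>2)"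
  proof -
    have "(\<Sum>j<N-n. (?R j * Q / 2)\<^sup>2) = Q\<^sup>2 / 4 * (\<Sum>j<N-n. (?R j)\<^sup>2)"
      unfolding sum_distrib_left by (intro sum.cong refl) (simp add: power_mult_distrib power_divide mult_ac)
    then show ?thesis unfolding sum_squares_arc_poly[OF c n(2)] by simp
  qed
  also have "\<dots> \<le> (\<Sum>j<N-n. (cmod (poly p (?w (n + j))))\<^sup>2)"
  proof (rule sum_mono)
    fix j assume "j \<in> {..<N - n}"
    then have j: "n + j < N" by auto
    have "0 \<le> ?R j * Q / 2"
      using j Qpos by (intro divide_nonneg_nonneg mult_nonneg_nonneg less_imp_le[OF chord_fact_pos]) auto
    then show "(?R j * Q / 2)\<^sup>2 \<le> (cmod (poly p (?w (n + j))))\<^sup>2" using outside[OF j] by (intro power_mono)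
  qed
  also have "\<dots> = (\<Sum>j=n..<N. (cmod (poly p (?w j)))\<^sup>2)"
    using n by (intro sum.reindex_bij_witness[of _ "\<lambda>j. j - n" "\<lambda>i. n + i"]) auto
  also have "\<dots> \<le> (\<Sum>j<N. (cmod (poly p (?w j)))\<^sup>2)" by (intro sum_mono2) auto
  also have "\<dots> = real N * (\<Sum>k<N. (cmod (coeff p k))\<^sup>2)"
    using dp n c by (intro Parseval_roots_of_unity) auto
  also have "(\<Sum>k<N. (cmod (coeff p k))\<^sup>2) = (\<Sum>k<n. (cmod (coeff p k))\<^sup>2)"
    using dp n by (intro sum.mono_neutral_right) (auto simp: coeff_eq_0)
  finally have big: "Q\<^sup>2 / 4 * ?B2 \<le> (\<Sum>k<n. (cmod (coeff p k))\<^sup>2)" using n by simp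
  let ?G = "chord_fact N n" and ?E = "extremal_ratio N n" and ?f = "chord N n"
  have G: "0 < ?G" using n by (intro chord_fact_pos) auto
  have B0: "0 \<le> ?B2" by (intro sum_nonneg) auto
  have "?G\<^sup>2 * ((?f * ?E / 16)\<^sup>2 * Q) = (?G * ?E)\<^sup>2 * (?f\<^sup>2 * Q / 256)"
    by (simp add: power_mult_distrib power_divide mult_ac)
  also have "\<dots> \<le> (4 * ?B2)\<^sup>2 * (?f\<^sup>2 * Q / 256)"
    using sum_squares_binomial_ge[OF n(2)] G extremal_ratio_ge_1[OF n(2)] Qpos
    by (intro mult_right_mono power_mono) (auto intro!: mult_nonneg_nonneg)
  also have "\<dots> = (?f\<^sup>2 * ?B2) * (?B2 * Q / 16)" by (simp add: power2_eq_square)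
  also have "\<dots> \<le> (4 * ?G\<^sup>2 * Q) * (?B2 * Q / 16)"
    using sum_inverse_products_ge[OF n] B0 Qpos unfolding Q_def q_def by (intro mult_right_mono) auto
  also have "\<dots> = ?G\<^sup>2 * (Q\<^sup>2 / 4 * ?B2)" by (simp add: power2_eq_square)
  finally have "(?f * ?E / 16)\<^sup>2 * Q \<le> Q\<^sup>2 / 4 * ?B2" using G by (simp add: mult_le_cancel_left_pos)
  then have fin: "(?f * ?E / 16)\<^sup>2 * Q \<le> (\<Sum>k<n. (cmod (coeff p k))\<^sup>2)" using big by linarith
  have "p \<noteq> 0" using node[of 0] q[of 0] n by auto
  then show ?thesis using dp fin sumnodes by (intro exI[of _ p]) auto
qed

section \<open>Singular values and Rayleigh quotients\<close>

lemma of_real_norm_square: "(complex_of_real (cmod z))\<^sup>2 = z * cnj z"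
  by (metis complex_norm_square of_real_power)

lemma eigenvalue_iff_kernel:
  fixes B :: "complex mat"
  assumes B: "B \<in> carrier_mat n n"
  shows "eigenvalue B \<mu> \<longleftrightarrow> (\<exists>x. (\<exists>i<n. x i \<noteq> 0) \<and> (\<forall>i<n. (\<Sum>j<n. B $$ (i, j) * x j) = \<mu> * x i))"
proof
  have mv: "vec_index (B *\<^sub>v v) i = (\<Sum>j<n. B $$ (i, j) * vec_index v j)" if "v \<in> carrier_vec n" "i < n" for v i
    using that B by (simp add: scalar_prod_def atLeast0LessThan)
  {
    assume "eigenvalue B \<mu>"
    then obtain v where v: "v \<in> carrier_vec n" "v \<noteq> 0\<^sub>v n" "B *\<^sub>v v = \<mu> \<cdot>\<^sub>v v"
      using B by (auto simp: eigenvalue_def eigenvector_def)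
    have "\<exists>i<n. vec_index v i \<noteq> 0"
    proof (rule ccontr)
      assume "\<not> ?thesis"
      then have "v = 0\<^sub>v n" using v(1) by (intro eq_vecI) auto
      then show False using v(2) by simp
    qed
    moreover have "(\<Sum>j<n. B $$ (i, j) * vec_index v j) = \<mu> * vec_index v i" if "i < n" for i
      using mv[OF v(1) that] v that by simp
    ultimately show "\<exists>x. (\<exists>i<n. x i \<noteq> 0) \<and> (\<forall>i<n. (\<Sum>j<n. B $$ (i, j) * x j) = \<mu> * x i)"
      by (intro exI[of _ "vec_index v"]) auto
  }
  {
    assume "\<exists>x. (\<exists>i<n. x i \<noteq> 0) \<and> (\<forall>i<n. (\<Sum>j<n. B $$ (i, j) * x j) = \<mu> * x i)"
    then obtain x i where x: "i < n" "x i \<noteq> 0" "\<And>i. i < n \<Longrightarrow> (\<Sum>j<n. B $$ (i, j) * x j) = \<mu> * x i" by auto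
    define v where "v = Matrix.vec n x"
    have v: "v \<in> carrier_vec n" by (simp add: v_def)
    have "v \<noteq> 0\<^sub>v n" using x(1,2) by (auto simp: v_def dest!: arg_cong[of _ _ "\<lambda>v. vec_index v i"])
    moreover have "B *\<^sub>v v = \<mu> \<cdot>\<^sub>v v"
    proof (rule eq_vecI)
      fix k assume "k < dim_vec (\<mu> \<cdot>\<^sub>v v)"
      then have k: "k < n" by (simp add: v_def)
      have "vec_index (B *\<^sub>v v) k = (\<Sum>j<n. B $$ (k, j) * vec_index v j)" using mv[OF v k] .
      also have "\<dots> = (\<Sum>j<n. B $$ (k, j) * x j)" by (intro sum.cong) (auto simp: v_def)
      finally show "vec_index (B *\<^sub>v v) k = vec_index (\<mu> \<cdot>\<^sub>v v) k" using x(3)[OF k] k by (simp add: v_def)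
    qed (use B in \<open>simp add: v_def\<close>)
    ultimately show "eigenvalue B \<mu>" unfolding eigenvalue_def eigenvector_def using v B by auto
  }
qed

text \<open>A log-convex sequence that increases once grows geometrically.\<close>

lemma log_convex_bounded_nonincreasing:
  fixes a :: "nat \<Rightarrow> real"
  assumes nn: "\<And>k. 0 \<le> a k" and conv: "\<And>k. (a (Suc k))\<^sup>2 \<le> a k * a (Suc (Suc k))" and bd: "\<And>k. a k \<le> M"
  shows "a 1 \<le> a 0"
proof (rule ccontr)
  assume "\<not> a 1 \<le> a 0"
  then have gt: "a 0 < a 1" by simp
  have "a 0 \<noteq> 0"
  proof
    assume "a 0 = 0"
    then have "(a 1)\<^sup>2 \<le> 0" using conv[of 0] by simp
    then show False using gt nn[of 0] by simp
  qed
  then have a0: "0 < a 0" using nn[of 0] by simp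
  define r where "r = a 1 / a 0"
  have r: "1 < r" using gt a0 by (simp add: r_def)
  have step: "0 < a k \<and> r * a k \<le> a (Suc k)" for k
  proof (induction k)
    case 0
    then show ?case using a0 by (simp add: r_def)
  next
    case (Suc k)
    have p: "0 < a (Suc k)" using Suc r by (smt (verit) mult_pos_pos)
    have "r * a k * a (Suc k) \<le> a (Suc k) * a (Suc k)" using Suc p by (intro mult_right_mono) auto
    also have "\<dots> \<le> a k * a (Suc (Suc k))" using conv[of k] by (simp add: power2_eq_square)
    finally have "a k * (r * a (Suc k)) \<le> a k * a (Suc (Suc k))" by (simp add: mult_ac)
    then show ?case using Suc p by (simp add: mult_le_cancel_left_pos)
  qed
  have "r ^ k * a 0 \<le> a k" for k
  proof (induction k)
    case (Suc k)
    have "r ^ Suc k * a 0 = r * (r ^ k * a 0)" by simp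
    also have "\<dots> \<le> r * a k" using Suc r by (intro mult_left_mono) auto
    also have "\<dots> \<le> a (Suc k)" using step by blast
    finally show ?case .
  qed simp
  moreover obtain k where "M / a 0 < r ^ k" using real_arch_pow[OF r] by blast
  then have "M < r ^ k * a 0" using a0 by (simp add: divide_less_eq)
  ultimately show False using bd[of k] by (meson not_less order_trans)
qed

text \<open>The powers of \<open>b / r\<close> are bounded because its spectral radius is below \<open>1\<close>. For a Hermitian matrix the
  squared norms \<open>a k\<close> of the iterates are log-convex, by the Cauchy-Schwarz inequality, and a bounded
  log-convex sequence does not increase. This replaces a unitary diagonalisation.\<close>

lemma hermitian_norm_le_spectral_bound:
  fixes b :: "nat \<Rightarrow> nat \<Rightarrow> complex" and x :: "nat \<Rightarrow> complex"
  assumes herm: "\<And>i j. i < n \<Longrightarrow> j < n \<Longrightarrow> b j i = cnj (b i j)"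
    and ev: "\<And>\<mu> x. (\<exists>i<n. x i \<noteq> 0) \<Longrightarrow> (\<And>i. i < n \<Longrightarrow> (\<Sum>j<n. b i j * x j) = \<mu> * x i) \<Longrightarrow> cmod \<mu> < r"
    and r: "0 < r"
  shows "(\<Sum>i<n. (cmod (\<Sum>j<n. b i j * x j))\<^sup>2) \<le> r\<^sup>2 * (\<Sum>i<n. (cmod (x i))\<^sup>2)"
proof (cases "n = 0")
  case False
  define b' where "b' = (\<lambda>i j. b i j / of_real r)"
  define B where "B = Matrix.mat n n (\<lambda>(i, j). b' i j)"
  have B: "B \<in> carrier_mat n n" by (simp add: B_def)
  have "spectral_radius B < 1"
  proof -
    have "spectral_radius B \<in> cmod ` spectrum B" using False by (intro spectral_radius_mem_max[OF B]) auto
    then obtain \<mu> where mu: "eigenvalue B \<mu>" "spectral_radius B = cmod \<mu>" by (auto simp: spectrum_def)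
    obtain x where x: "\<exists>i<n. x i \<noteq> 0" "\<forall>i<n. (\<Sum>j<n. B $$ (i, j) * x j) = \<mu> * x i"
      using mu(1) unfolding eigenvalue_iff_kernel[OF B] by blast
    have "(\<Sum>j<n. b i j * x j) = (of_real r * \<mu>) * x i" if "i < n" for i
    proof -
      have "(\<Sum>j<n. b i j * x j) = of_real r * (\<Sum>j<n. B $$ (i, j) * x j)"
        unfolding sum_distrib_left using that r by (intro sum.cong) (auto simp: B_def b'_def)
      then show ?thesis using x(2) that by simp
    qed
    then have "cmod (of_real r * \<mu>) < r" by (intro ev[OF x(1)])
    then show ?thesis using r mu(2) by (simp add: norm_mult)
  qed
  moreover have "\<exists>n_as. jordan_nf B n_as"
    using char_poly_factorized[OF B] jordan_nf_exists[OF B] by blast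
  ultimately obtain c where c: "\<And>k. norm_bound (B ^\<^sub>m k) c"
    using spectral_radius_jnf_norm_bound_less_1[OF B] by blast
  have pc: "B ^\<^sub>m k \<in> carrier_mat n n" for k using B by simp
  have cb: "cmod ((B ^\<^sub>m k) $$ (i, j)) \<le> c" if "i < n" "j < n" for i j k
  proof -
    have "dim_row (B ^\<^sub>m k) = n" "dim_col (B ^\<^sub>m k) = n" using pc[of k] by blast+
    then show ?thesis using c[of k, unfolded norm_bound_def] that by (simp only:)
  qed
  define F where "F = (\<lambda>(y :: nat \<Rightarrow> complex) i. \<Sum>j<n. b' i j * y j)"
  have Fpow: "(F ^^ k) y i = (\<Sum>j<n. (B ^\<^sub>m k) $$ (i, j) * y j)" if "i < n" for k y i
    using that
  proof (induction k arbitrary: y i)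
    case 0
    have "(\<Sum>j<n. (B ^\<^sub>m 0) $$ (i, j) * y j) = (\<Sum>j<n. if j = i then y j else 0)"
      using B 0 by (intro sum.cong) auto
    then show ?case using 0 by simp
  next
    case (Suc k)
    have "(F ^^ Suc k) y i = (F ^^ k) (F y) i" by (simp add: funpow_swap1)
    also have "\<dots> = (\<Sum>l<n. (B ^\<^sub>m k) $$ (i, l) * (\<Sum>j<n. b' l j * y j))" using Suc by (simp add: F_def)
    also have "\<dots> = (\<Sum>j<n. (\<Sum>l<n. (B ^\<^sub>m k) $$ (i, l) * b' l j) * y j)"
      unfolding sum_distrib_left sum_distrib_right by (subst sum.swap) (simp add: mult.assoc)
    also have "\<dots> = (\<Sum>j<n. (B ^\<^sub>m Suc k) $$ (i, j) * y j)"
    proof (rule sum.cong[OF refl])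
      fix j assume "j \<in> {..<n}"
      then have j: "j < n" by simp
      have "(B ^\<^sub>m Suc k) $$ (i, j) = (\<Sum>l<n. (B ^\<^sub>m k) $$ (i, l) * B $$ (l, j))"
        using pc[of k] B j Suc.prems by (simp add: scalar_prod_def atLeast0LessThan)
      also have "\<dots> = (\<Sum>l<n. (B ^\<^sub>m k) $$ (i, l) * b' l j)" using j by (intro sum.cong) (auto simp: B_def)
      finally show "(\<Sum>l<n. (B ^\<^sub>m k) $$ (i, l) * b' l j) * y j = (B ^\<^sub>m Suc k) $$ (i, j) * y j" by simp
    qed
    finally show ?case .
  qed
  define y where "y = (\<lambda>k. (F ^^ k) x)"
  define a where "a = (\<lambda>k. \<Sum>i<n. (cmod (y k i))\<^sup>2)"
  have yS: "y (Suc k) = F (y k)" for k by (simp add: y_def)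
  have herm': "b' j i = cnj (b' i j)" if "i < n" "j < n" for i j
    using herm[OF that] by (simp add: b'_def)
  have adj: "(\<Sum>i<n. F u i * cnj (v i)) = (\<Sum>i<n. u i * cnj (F v i))" for u v
  proof -
    have "(\<Sum>i<n. F u i * cnj (v i)) = (\<Sum>j<n. \<Sum>i<n. b' i j * u j * cnj (v i))"
      unfolding F_def sum_distrib_right by (rule sum.swap)
    also have "\<dots> = (\<Sum>j<n. \<Sum>i<n. u j * cnj (b' j i * v i))"
    proof (intro sum.cong refl)
      fix j i assume "j \<in> {..<n}" "i \<in> {..<n}"
      then have "b' j i = cnj (b' i j)" by (intro herm') auto
      then show "b' i j * u j * cnj (v i) = u j * cnj (b' j i * v i)" by simp
    qed
    finally show ?thesis by (simp add: F_def sum_distrib_left)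
  qed
  have "(a (Suc k))\<^sup>2 \<le> a k * a (Suc (Suc k))" for k
  proof -
    have "complex_of_real (a (Suc k)) = (\<Sum>i<n. y (Suc k) i * cnj (y (Suc k) i))"
      by (simp add: a_def of_real_norm_square)
    also have "\<dots> = (\<Sum>i<n. y k i * cnj (y (Suc (Suc k)) i))" unfolding yS[of k] yS[of "Suc k"] by (rule adj)
    finally have "a (Suc k) \<le> cmod (\<Sum>i<n. y k i * cnj (y (Suc (Suc k)) i))"
      by (metis abs_ge_self norm_of_real)
    also have "\<dots> \<le> (\<Sum>i<n. cmod (y k i) * cmod (y (Suc (Suc k)) i))"
      by (rule order_trans[OF norm_sum]) (simp add: norm_mult)
    finally have "(a (Suc k))\<^sup>2 \<le> (\<Sum>i<n. cmod (y k i) * cmod (y (Suc (Suc k)) i))\<^sup>2"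
      by (intro power_mono) (auto simp: a_def sum_nonneg)
    also have "\<dots> \<le> a k * a (Suc (Suc k))" unfolding a_def by (rule Cauchy_Schwarz_ineq_sum)
    finally show ?thesis .
  qed
  moreover have "a k \<le> (\<Sum>i<n. (\<Sum>j<n. c * cmod (x j))\<^sup>2)" for k
    unfolding a_def
  proof (intro sum_mono power_mono)
    fix i assume "i \<in> {..<n}"
    then have i: "i < n" by simp
    have "cmod (y k i) \<le> (\<Sum>j<n. cmod ((B ^\<^sub>m k) $$ (i, j) * x j))"
      unfolding y_def Fpow[OF i] by (rule norm_sum)
    also have "\<dots> \<le> (\<Sum>j<n. c * cmod (x j))"
      using cb[OF i] by (intro sum_mono) (auto simp: norm_mult intro!: mult_right_mono)
    finally show "cmod (y k i) \<le> (\<Sum>j<n. c * cmod (x j))" .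
  qed auto
  ultimately have "a 1 \<le> a 0"
    by (intro log_convex_bounded_nonincreasing[of a]) (auto simp: a_def sum_nonneg)
  moreover have "a 1 = (\<Sum>i<n. (cmod (\<Sum>j<n. b i j * x j))\<^sup>2) / r\<^sup>2"
  proof -
    have "cmod (y 1 i) = cmod (\<Sum>j<n. b i j * x j) / r" for i
    proof -
      have "y 1 i = (\<Sum>j<n. b i j * x j) / of_real r"
        by (simp add: y_def F_def b'_def sum_divide_distrib)
      then show ?thesis using r by (simp add: norm_divide)
    qed
    then show ?thesis by (simp add: a_def power_divide sum_divide_distrib)
  qed
  moreover have "a 0 = (\<Sum>i<n. (cmod (x i))\<^sup>2)" by (simp add: a_def y_def)
  ultimately show ?thesis using r by (simp add: divide_le_eq mult.commute)
qed simp

text \<open>The limit case of the strict norm bound; allowing \<open>cmod \<mu> \<le> r\<close> makes the bound attained by the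
  extreme eigenvalue.\<close>

lemma hermitian_form_le_spectral_bound:
  fixes b :: "nat \<Rightarrow> nat \<Rightarrow> complex" and x :: "nat \<Rightarrow> complex"
  assumes herm: "\<And>i j. i < n \<Longrightarrow> j < n \<Longrightarrow> b j i = cnj (b i j)"
    and ev: "\<And>\<mu> x. (\<exists>i<n. x i \<noteq> 0) \<Longrightarrow> (\<And>i. i < n \<Longrightarrow> (\<Sum>j<n. b i j * x j) = \<mu> * x i) \<Longrightarrow> cmod \<mu> \<le> r"
    and r: "0 \<le> r"
  shows "Re (\<Sum>i<n. cnj (x i) * (\<Sum>j<n. b i j * x j)) \<le> r * (\<Sum>i<n. (cmod (x i))\<^sup>2)"
proof (rule field_le_epsilon)
  fix e :: real assume e: "0 < e"
  let ?X = "\<Sum>i<n. (cmod (x i))\<^sup>2" and ?bx = "\<lambda>i. \<Sum>j<n. b i j * x j"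
  have X: "0 \<le> ?X" by (intro sum_nonneg) auto
  define d where "d = e / (?X + 1)"
  have d: "0 < d" "d * ?X \<le> e" using e X by (auto simp: d_def divide_le_eq mult_left_mono)
  have "(\<Sum>i<n. (cmod (?bx i))\<^sup>2) \<le> (r + d)\<^sup>2 * ?X"
  proof (rule hermitian_norm_le_spectral_bound[OF herm])
    fix \<mu> x assume "\<exists>i<n. x i \<noteq> 0" "\<And>i. i < n \<Longrightarrow> (\<Sum>j<n. b i j * x j) = \<mu> * x i"
    from ev[OF this] show "cmod \<mu> < r + d" using d by simp
  qed (use r d in auto)
  then have "?X * (\<Sum>i<n. (cmod (?bx i))\<^sup>2) \<le> ?X * ((r + d)\<^sup>2 * ?X)" using X by (intro mult_left_mono)
  also have "\<dots> = ((r + d) * ?X)\<^sup>2" by (simp add: power2_eq_square mult_ac)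
  finally have *: "?X * (\<Sum>i<n. (cmod (?bx i))\<^sup>2) \<le> ((r + d) * ?X)\<^sup>2" .
  have "Re (\<Sum>i<n. cnj (x i) * ?bx i) \<le> cmod (\<Sum>i<n. cnj (x i) * ?bx i)" by (rule complex_Re_le_cmod)
  also have "\<dots> \<le> (\<Sum>i<n. cmod (x i) * cmod (?bx i))"
    by (rule order_trans[OF norm_sum]) (simp add: norm_mult)
  also have "\<dots> \<le> (r + d) * ?X"
  proof (rule power2_le_imp_le)
    have "(\<Sum>i<n. cmod (x i) * cmod (?bx i))\<^sup>2 \<le> ?X * (\<Sum>i<n. (cmod (?bx i))\<^sup>2)"
      by (rule Cauchy_Schwarz_ineq_sum)
    then show "(\<Sum>i<n. cmod (x i) * cmod (?bx i))\<^sup>2 \<le> ((r + d) * ?X)\<^sup>2" using * by linarith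
  qed (use r d X in auto)
  also have "\<dots> \<le> r * ?X + e" using d by (simp add: distrib_right)
  finally show "Re (\<Sum>i<n. cnj (x i) * ?bx i) \<le> r * ?X + e" .
qed

lemma mat_adjoint_dims [simp]: "dim_row (mat_adjoint A) = dim_col A" "dim_col (mat_adjoint A) = dim_row A"
  by (simp_all add: mat_adjoint_def)

lemma mat_adjoint_carrier [simp]: "A \<in> carrier_mat m n \<Longrightarrow> mat_adjoint A \<in> carrier_mat n m"
  by (intro carrier_matI) auto

lemma mat_adjoint_index:
  fixes A :: "complex mat"
  assumes "i < dim_col A" "j < dim_row A"
  shows "mat_adjoint A $$ (i, j) = cnj (A $$ (j, i))"
  using assms by (simp add: mat_adjoint_def mat_of_rows_index conjugate_complex_def)

lemma mat_adjoint_adjoint: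
  fixes A :: "complex mat" shows "mat_adjoint (mat_adjoint A) = A"
  by (rule eq_matI) (auto simp: mat_adjoint_index)

lemma gram_index:
  fixes A :: "complex mat"
  assumes "A \<in> carrier_mat m n" "k < n" "l < n"
  shows "(mat_adjoint A * A) $$ (k, l) = (\<Sum>i<m. cnj (A $$ (i, k)) * A $$ (i, l))"
  using assms by (auto simp: scalar_prod_def mat_adjoint_index atLeast0LessThan)

lemma gram_form:
  fixes A :: "complex mat"
  assumes A: "A \<in> carrier_mat m n"
  shows "(\<Sum>k<n. cnj (x k) * (\<Sum>l<n. (mat_adjoint A * A) $$ (k, l) * x l))
       = of_real (\<Sum>i<m. (cmod (\<Sum>l<n. A $$ (i, l) * x l))\<^sup>2)"
proof -
  have "(\<Sum>k<n. cnj (x k) * (\<Sum>l<n. (mat_adjoint A * A) $$ (k, l) * x l))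
      = (\<Sum>k<n. \<Sum>l<n. \<Sum>i<m. (A $$ (i, l) * x l) * cnj (A $$ (i, k) * x k))"
    unfolding sum_distrib_left
    by (intro sum.cong refl) (simp add: gram_index[OF A] sum_distrib_left sum_distrib_right mult_ac del: index_mult_mat)
  also have "\<dots> = (\<Sum>i<m. \<Sum>k<n. \<Sum>l<n. (A $$ (i, l) * x l) * cnj (A $$ (i, k) * x k))"
  proof -
    have "(\<Sum>k<n. \<Sum>l<n. \<Sum>i<m. (A $$ (i, l) * x l) * cnj (A $$ (i, k) * x k))
        = (\<Sum>k<n. \<Sum>i<m. \<Sum>l<n. (A $$ (i, l) * x l) * cnj (A $$ (i, k) * x k))"
      by (intro sum.cong refl sum.swap)
    also have "\<dots> = (\<Sum>i<m. \<Sum>k<n. \<Sum>l<n. (A $$ (i, l) * x l) * cnj (A $$ (i, k) * x k))"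
      by (rule sum.swap)
    finally show ?thesis .
  qed
  also have "\<dots> = (\<Sum>i<m. (\<Sum>l<n. A $$ (i, l) * x l) * cnj (\<Sum>k<n. A $$ (i, k) * x k))"
    unfolding cnj_sum sum_product by (intro sum.cong refl sum.swap)
  finally show ?thesis by (simp add: of_real_norm_square del: cnj_sum complex_cnj_mult)
qed

definition singular_value_mset :: "complex mat \<Rightarrow> real multiset" where
  "singular_value_mset A = image_mset (\<lambda>z. sqrt (Re z)) (proots (char_poly (mat_adjoint A * A)))"

lemma gram_carrier: "A \<in> carrier_mat m n \<Longrightarrow> mat_adjoint A * A \<in> carrier_mat n n"
  by auto

lemma proots_gram:
  fixes A :: "complex mat"
  assumes "A \<in> carrier_mat m n"
  shows "set_mset (proots (char_poly (mat_adjoint A * A))) = Collect (eigenvalue (mat_adjoint A * A))"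
    and "size (proots (char_poly (mat_adjoint A * A))) = n"
proof -
  let ?H = "mat_adjoint A * A"
  have H: "?H \<in> carrier_mat n n" using assms by (rule gram_carrier)
  have "char_poly ?H \<noteq> 0" using degree_monic_char_poly[OF H] by auto
  then show "set_mset (proots (char_poly ?H)) = Collect (eigenvalue ?H)"
    using eigenvalue_root_char_poly[OF H] by auto
  show "size (proots (char_poly ?H)) = n"
    using degree_monic_char_poly[OF H] by (simp add: size_proots_complex)
qed

lemma eigenvalue_gram:
  fixes A :: "complex mat"
  assumes A: "A \<in> carrier_mat m n"
    and x: "\<exists>k<n. x k \<noteq> 0" "\<And>k. k < n \<Longrightarrow> (\<Sum>l<n. (mat_adjoint A * A) $$ (k, l) * x l) = \<mu> * x k"
  shows "\<mu> = of_real (Re \<mu>)" "0 \<le> Re \<mu>"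
    "(\<Sum>i<m. (cmod (\<Sum>l<n. A $$ (i, l) * x l))\<^sup>2) = Re \<mu> * (\<Sum>k<n. (cmod (x k))\<^sup>2)"
proof -
  let ?X = "\<Sum>k<n. (cmod (x k))\<^sup>2" and ?Y = "\<Sum>i<m. (cmod (\<Sum>l<n. A $$ (i, l) * x l))\<^sup>2"
  obtain k where "k < n" "x k \<noteq> 0" using x by auto
  then have X: "0 < ?X" by (intro sum_pos2[of _ k]) auto
  have "complex_of_real ?Y = (\<Sum>k<n. cnj (x k) * (\<mu> * x k))"
    unfolding gram_form[OF A, symmetric] using x(2) by (intro sum.cong) auto
  also have "\<dots> = \<mu> * of_real ?X"
    by (simp add: sum_distrib_left of_real_norm_square mult_ac)
  finally have e: "complex_of_real ?Y = \<mu> * of_real ?X" .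
  have X0: "complex_of_real ?X \<noteq> 0" using X by (simp del: of_real_sum)
  have m: "\<mu> = of_real (?Y / ?X)"
    unfolding of_real_divide nonzero_eq_divide_eq[OF X0] by (rule e[symmetric])
  then have mu: "Re \<mu> = ?Y / ?X" "\<mu> = of_real (Re \<mu>)" by (simp_all only: m Re_complex_of_real)
  show "\<mu> = of_real (Re \<mu>)" by (rule mu(2))
  show "0 \<le> Re \<mu>" unfolding mu(1) using X by (intro divide_nonneg_nonneg sum_nonneg) auto
  show "?Y = Re \<mu> * ?X" unfolding mu(1) using X by simp
qed

lemma size_singular_value_mset: "A \<in> carrier_mat m n \<Longrightarrow> size (singular_value_mset A) = n"
  by (simp add: singular_value_mset_def proots_gram(2))

lemma singular_value_witness:
  fixes A :: "complex mat"
  assumes A: "A \<in> carrier_mat m n" and \<sigma>: "\<sigma> \<in># singular_value_mset A"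
  shows "0 \<le> \<sigma>"
    "\<exists>x. (\<exists>k<n. x k \<noteq> 0) \<and> (\<Sum>i<m. (cmod (\<Sum>l<n. A $$ (i, l) * x l))\<^sup>2) = \<sigma>\<^sup>2 * (\<Sum>k<n. (cmod (x k))\<^sup>2)"
proof -
  obtain z where z: "eigenvalue (mat_adjoint A * A) z" "\<sigma> = sqrt (Re z)"
    using \<sigma> proots_gram(1)[OF A] by (auto simp: singular_value_mset_def)
  obtain x where x: "\<exists>k<n. x k \<noteq> 0" "\<And>k. k < n \<Longrightarrow> (\<Sum>l<n. (mat_adjoint A * A) $$ (k, l) * x l) = z * x k"
    using z(1) eigenvalue_iff_kernel[OF gram_carrier[OF A]] by blast
  note e = eigenvalue_gram[OF A x]
  show "0 \<le> \<sigma>" using z(2) e(2) by simp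
  show "\<exists>x. (\<exists>k<n. x k \<noteq> 0) \<and> (\<Sum>i<m. (cmod (\<Sum>l<n. A $$ (i, l) * x l))\<^sup>2) = \<sigma>\<^sup>2 * (\<Sum>k<n. (cmod (x k))\<^sup>2)"
    using x(1) e z(2) by (intro exI[of _ x]) auto
qed

lemma gram_hermitian:
  fixes A :: "complex mat"
  assumes "A \<in> carrier_mat m n" "k < n" "l < n"
  shows "(mat_adjoint A * A) $$ (l, k) = cnj ((mat_adjoint A * A) $$ (k, l))"
  by (simp add: gram_index[OF assms(1)] assms mult.commute del: index_mult_mat)

lemma singular_values_upper:
  fixes A :: "complex mat"
  assumes A: "A \<in> carrier_mat m n" and s: "0 \<le> s" "\<And>\<sigma>. \<sigma> \<in># singular_value_mset A \<Longrightarrow> \<sigma> \<le> s"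
  shows "(\<Sum>i<m. (cmod (\<Sum>l<n. A $$ (i, l) * x l))\<^sup>2) \<le> s\<^sup>2 * (\<Sum>k<n. (cmod (x k))\<^sup>2)"
proof -
  have "Re (\<Sum>k<n. cnj (x k) * (\<Sum>l<n. (mat_adjoint A * A) $$ (k, l) * x l)) \<le> s\<^sup>2 * (\<Sum>k<n. (cmod (x k))\<^sup>2)"
  proof (rule hermitian_form_le_spectral_bound)
    fix \<mu> x assume x: "\<exists>k<n. x k \<noteq> 0" "\<And>k. k < n \<Longrightarrow> (\<Sum>l<n. (mat_adjoint A * A) $$ (k, l) * x l) = \<mu> * x k"
    note e = eigenvalue_gram[OF A x]
    have "eigenvalue (mat_adjoint A * A) \<mu>" using x eigenvalue_iff_kernel[OF gram_carrier[OF A]] by blast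
    then have "sqrt (Re \<mu>) \<in># singular_value_mset A" using proots_gram(1)[OF A] by (auto simp: singular_value_mset_def)
    then have "sqrt (Re \<mu>) \<le> s" by (rule s(2))
    then have "Re \<mu> \<le> s\<^sup>2" using e(2) by (simp add: sqrt_le_D)
    moreover have "Im \<mu> = 0" using arg_cong[OF e(1), of Im] by simp
    ultimately show "cmod \<mu> \<le> s\<^sup>2" using e(2) by (simp add: cmod_eq_Re)
  next
    show "(mat_adjoint A * A) $$ (l, k) = cnj ((mat_adjoint A * A) $$ (k, l))" if "k < n" "l < n" for k l
      using that by (rule gram_hermitian[OF A])
  qed simp
  then show ?thesis unfolding gram_form[OF A] by simp
qed

text \<open>The upper bound for quadratic forms applies to \<open>c * I - A\<^sup>* A\<close>, where \<open>c\<close> is any number above all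
  eigenvalues of \<open>A\<^sup>* A\<close>: its eigenvalues lie between \<open>0\<close> and \<open>c - s\<^sup>2\<close>.\<close>

lemma singular_values_lower:
  fixes A :: "complex mat"
  assumes A: "A \<in> carrier_mat m n" and s: "0 \<le> s" "\<And>\<sigma>. \<sigma> \<in># singular_value_mset A \<Longrightarrow> s \<le> \<sigma>"
  shows "s\<^sup>2 * (\<Sum>k<n. (cmod (x k))\<^sup>2) \<le> (\<Sum>i<m. (cmod (\<Sum>l<n. A $$ (i, l) * x l))\<^sup>2)"
proof -
  let ?H = "\<lambda>k l. (mat_adjoint A * A) $$ (k, l)" and ?X = "\<Sum>k<n. (cmod (x k))\<^sup>2"
  define c where "c = s\<^sup>2 + (\<Sum>\<sigma>\<in>set_mset (singular_value_mset A). \<sigma>\<^sup>2)"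
  have c: "\<sigma>\<^sup>2 \<le> c" if "\<sigma> \<in># singular_value_mset A" for \<sigma>
  proof -
    have "\<sigma>\<^sup>2 \<le> (\<Sum>\<sigma>\<in>set_mset (singular_value_mset A). \<sigma>\<^sup>2)"
      using that by (intro member_le_sum) auto
    then show ?thesis by (simp add: c_def add_increasing)
  qed
  have cs: "0 \<le> c - s\<^sup>2" by (simp add: c_def sum_nonneg)
  define b where "b = (\<lambda>k l. (if k = l then of_real c else 0) - ?H k l)"
  have bx: "(\<Sum>l<n. b k l * x l) = of_real c * x k - (\<Sum>l<n. ?H k l * x l)" if "k < n" for k x
  proof -
    have "(\<Sum>l<n. b k l * x l) = (\<Sum>l<n. if l = k then of_real c * x k else 0) - (\<Sum>l<n. ?H k l * x l)"
      unfolding b_def sum_subtractf[symmetric] by (intro sum.cong refl) (auto simp: left_diff_distrib simp del: index_mult_mat)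
    then show ?thesis using that by simp
  qed
  have "Re (\<Sum>k<n. cnj (x k) * (\<Sum>l<n. b k l * x l)) \<le> (c - s\<^sup>2) * ?X"
  proof (rule hermitian_form_le_spectral_bound)
    show "b l k = cnj (b k l)" if "k < n" "l < n" for k l
      unfolding b_def using gram_hermitian[OF A that] by (simp del: index_mult_mat)
  next
    fix \<mu> x assume x: "\<exists>k<n. x k \<noteq> 0" "\<And>k. k < n \<Longrightarrow> (\<Sum>l<n. b k l * x l) = \<mu> * x k"
    have x': "(\<Sum>l<n. ?H k l * x l) = (of_real c - \<mu>) * x k" if "k < n" for k
      using bx[OF that, of x] x(2)[OF that] by (simp add: algebra_simps del: index_mult_mat)
    note e = eigenvalue_gram[OF A x(1) x']
    have "eigenvalue (mat_adjoint A * A) (of_real c - \<mu>)"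
      using x(1) x' eigenvalue_iff_kernel[OF gram_carrier[OF A]] by blast
    then have in1: "sqrt (Re (of_real c - \<mu>)) \<in># singular_value_mset A"
      using proots_gram(1)[OF A] by (auto simp: singular_value_mset_def simp del: minus_complex.simps)
    have "s\<^sup>2 \<le> (sqrt (Re (of_real c - \<mu>)))\<^sup>2" using s(1) s(2)[OF in1] by (intro power_mono)
    moreover have "(sqrt (Re (of_real c - \<mu>)))\<^sup>2 \<le> c" by (rule c[OF in1])
    ultimately have "s\<^sup>2 \<le> c - Re \<mu>" "c - Re \<mu> \<le> c" using e(2) by auto
    moreover have "Im \<mu> = 0" using arg_cong[OF e(1), of Im] by simp
    ultimately show "cmod \<mu> \<le> c - s\<^sup>2" by (simp add: cmod_eq_Re)
  qed (rule cs)
  moreover have "(\<Sum>k<n. cnj (x k) * (\<Sum>l<n. b k l * x l)) = of_real (c * ?X) - of_real (\<Sum>i<m. (cmod (\<Sum>l<n. A $$ (i, l) * x l))\<^sup>2)"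
  proof -
    have "(\<Sum>k<n. cnj (x k) * (\<Sum>l<n. b k l * x l)) = (\<Sum>k<n. of_real c * (x k * cnj (x k)) - cnj (x k) * (\<Sum>l<n. ?H k l * x l))"
    proof (intro sum.cong refl)
      fix k assume "k \<in> {..<n}"
      then have k: "k < n" by simp
      show "cnj (x k) * (\<Sum>l<n. b k l * x l) = of_real c * (x k * cnj (x k)) - cnj (x k) * (\<Sum>l<n. ?H k l * x l)"
        unfolding bx[OF k] right_diff_distrib by (simp only: mult_ac)
    qed
    also have "\<dots> = of_real (c * ?X) - (\<Sum>k<n. cnj (x k) * (\<Sum>l<n. ?H k l * x l))"
      unfolding sum_subtractf by (simp add: sum_distrib_left of_real_norm_square del: index_mult_mat)
    finally show ?thesis unfolding gram_form[OF A] .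
  qed
  ultimately show ?thesis by (simp add: left_diff_distrib)
qed

lemma singular_values_alt: "singular_values A = rev (sorted_list_of_multiset (singular_value_mset A))"
  by (simp add: singular_values_def singular_value_mset_def)

lemma singular_values_first_last:
  assumes A: "A \<in> carrier_mat m n" and n: "1 \<le> n"
  shows "singular_values A ! 0 \<in># singular_value_mset A" "\<sigma> \<in># singular_value_mset A \<Longrightarrow> \<sigma> \<le> singular_values A ! 0"
    "singular_values A ! (n - 1) \<in># singular_value_mset A" "\<sigma> \<in># singular_value_mset A \<Longrightarrow> singular_values A ! (n - 1) \<le> \<sigma>"
proof -
  define xs where "xs = sorted_list_of_multiset (singular_value_mset A)"
  have xs: "sorted xs" "mset xs = singular_value_mset A" by (auto simp: xs_def)
  have len: "length xs = n" using size_singular_value_mset[OF A] xs(2) by (metis size_mset)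
  have s: "singular_values A = rev xs" by (simp add: singular_values_alt xs_def)
  have e: "singular_values A ! 0 = xs ! (n - 1)" "singular_values A ! (n - 1) = xs ! 0"
    unfolding s using len n by (auto simp: rev_nth)
  have mem: "\<sigma> \<in># singular_value_mset A \<longleftrightarrow> (\<exists>i<n. \<sigma> = xs ! i)" for \<sigma>
    unfolding xs(2)[symmetric] set_mset_mset set_conv_nth len by auto
  show "singular_values A ! 0 \<in># singular_value_mset A" "singular_values A ! (n - 1) \<in># singular_value_mset A"
    unfolding mem e using n by (auto intro: exI[of _ "n - 1"] exI[of _ 0])
  show "\<sigma> \<in># singular_value_mset A \<Longrightarrow> \<sigma> \<le> singular_values A ! 0"
    unfolding mem e using sorted_nth_mono[OF xs(1), of _ "n - 1"] len n by auto
  show "\<sigma> \<in># singular_value_mset A \<Longrightarrow> singular_values A ! (n - 1) \<le> \<sigma>"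
    unfolding mem e using sorted_nth_mono[OF xs(1), of 0] len n by auto
qed

text \<open>The block matrices \<open>((AB, 0), (B, 0))\<close> and \<open>((0, 0), (B, BA))\<close> are similar by way of
  \<open>((1, A), (0, 1))\<close>.\<close>

lemma char_poly_mult_swap:
  fixes A B :: "complex mat"
  assumes A: "A \<in> carrier_mat m n" and B: "B \<in> carrier_mat n m"
  shows "char_poly (A * B) * [:0, 1:] ^ n = [:0, 1:] ^ m * char_poly (B * A)"
proof -
  let ?M1 = "four_block_mat (A * B) (0\<^sub>m m n) B (0\<^sub>m n n)"
  let ?M2 = "four_block_mat (0\<^sub>m m m) (0\<^sub>m m n) B (B * A)"
  let ?P = "four_block_mat (1\<^sub>m m) A (0\<^sub>m n m) (1\<^sub>m n)"
  let ?Q = "four_block_mat (1\<^sub>m m) (- A) (0\<^sub>m n m) (1\<^sub>m n)"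
  have AB: "A * B \<in> carrier_mat m m" and BA: "B * A \<in> carrier_mat n n" using A B by auto
  have zero: "char_poly (0\<^sub>m k k :: complex mat) = [:0, 1:] ^ k" for k
  proof -
    have "diag_mat (0\<^sub>m k k :: complex mat) = replicate k 0"
      by (rule nth_equalityI) (auto simp: diag_mat_def)
    then show ?thesis
      by (subst char_poly_upper_triangular[of _ k]) (auto simp: upper_triangular_def prod_list_replicate)
  qed
  have fact: "\<exists>es. char_poly C = (\<Prod>a\<leftarrow>es. [:- a, 1:])" if "C \<in> carrier_mat k k" for C :: "complex mat" and k
    using char_poly_factorized[OF that] by blast
  have uz: "- 0\<^sub>m n n = (0\<^sub>m n n :: complex mat)" by (rule eq_matI) auto
  have AA: "A + - A = 0\<^sub>m m n" using A by (intro eq_matI) auto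
  have PQ: "?P * ?Q = 1\<^sub>m (m + n)" "?Q * ?P = 1\<^sub>m (m + n)"
    using A by (subst mult_four_block_mat[of _ m m _ n _ n _ _ m _ n]; simp add: uz AA)+
  have PM: "?P * ?M2 = four_block_mat (A * B) (A * (B * A)) B (B * A)"
    using A B by (subst mult_four_block_mat[of _ m m _ n _ n _ _ m _ n]; simp)
  have "?P * ?M2 * ?Q = four_block_mat (A * B) (- (A * B * A) + A * (B * A)) B (- (B * A) + B * A)"
    unfolding PM using A B AB BA by (subst mult_four_block_mat[of _ m m _ n _ n _ _ m _ n]; simp)
  also have "- (A * B * A) + A * (B * A) = 0\<^sub>m m n"
    using A B by (simp add: assoc_mult_mat[of _ m n _ m _ n])
  also have "- (B * A) + B * A = 0\<^sub>m n n" using BA by simp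
  finally have M1: "?M1 = ?P * ?M2 * ?Q" by (rule sym)
  have "?M1 \<in> carrier_mat (m + n) (m + n)" "?M2 \<in> carrier_mat (m + n) (m + n)"
    "?P \<in> carrier_mat (m + n) (m + n)" "?Q \<in> carrier_mat (m + n) (m + n)"
    using four_block_carrier_mat[OF AB zero_carrier_mat] four_block_carrier_mat[OF zero_carrier_mat BA]
      four_block_carrier_mat[OF one_carrier_mat one_carrier_mat] by blast+
  then have "similar_mat ?M1 ?M2"
    by (intro similar_matI[OF _ PQ M1]) blast
  then have "char_poly ?M1 = char_poly ?M2" by (rule char_poly_similar)
  moreover have "char_poly ?M1 = char_poly (A * B) * char_poly (0\<^sub>m n n :: complex mat)"
    by (rule char_poly_0_block'[OF refl fact[OF AB] fact[OF zero_carrier_mat] AB B zero_carrier_mat])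
  moreover have "char_poly ?M2 = char_poly (0\<^sub>m m m :: complex mat) * char_poly (B * A)"
    by (rule char_poly_0_block'[OF refl fact[OF zero_carrier_mat] fact[OF BA] zero_carrier_mat B BA])
  ultimately show ?thesis by (simp add: zero)
qed

text \<open>The Gram matrix of a wide matrix has \<open>n - m\<close> additional zero eigenvalues. They are the last entries of
  the decreasing list, beyond the position that the condition number reads.\<close>

lemma singular_value_mset_adjoint:
  fixes A :: "complex mat"
  assumes A: "A \<in> carrier_mat m n" and mn: "m \<le> n"
  shows "singular_value_mset A = replicate_mset (n - m) 0 + singular_value_mset (mat_adjoint A)"
proof -
  let ?p = "char_poly (A * mat_adjoint A)" and ?q = "char_poly (mat_adjoint A * A)"
  have AA: "A * mat_adjoint A \<in> carrier_mat m m" "mat_adjoint A * A \<in> carrier_mat n n" using A by auto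
  have ne: "?p \<noteq> 0" "?q \<noteq> 0" using degree_monic_char_poly[OF AA(1)] degree_monic_char_poly[OF AA(2)] by auto
  have "proots (?p * [:0, 1:] ^ n) = proots ([:0, 1:] ^ m * ?q)"
    using char_poly_mult_swap[OF A mat_adjoint_carrier[OF A]] by simp
  then have e: "proots ?p + repeat_mset n {#0#} = repeat_mset m {#0#} + proots ?q"
    using ne by (simp add: proots_mult proots_power)
  have "proots ?q = replicate_mset (n - m) 0 + proots ?p"
  proof (rule multiset_eqI)
    fix z show "count (proots ?q) z = count (replicate_mset (n - m) 0 + proots ?p) z"
      using arg_cong[OF e, of "\<lambda>M. count M z"] mn by (cases "z = 0") (simp_all del: count_proots)
  qed
  then show ?thesis by (simp add: singular_value_mset_def mat_adjoint_adjoint)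
qed

lemma singular_values_wide:
  fixes A :: "complex mat"
  assumes A: "A \<in> carrier_mat m n" and mn: "m \<le> n" and i: "i < m"
  shows "singular_values A ! i = singular_values (mat_adjoint A) ! i"
proof -
  let ?s = "sorted_list_of_multiset (singular_value_mset (mat_adjoint A))"
  have nn: "\<And>\<sigma>. \<sigma> \<in># singular_value_mset (mat_adjoint A) \<Longrightarrow> 0 \<le> \<sigma>"
    using singular_value_witness(1)[OF mat_adjoint_carrier[OF A]] by blast
  have "sorted (replicate (n - m) 0 @ ?s)" using nn by (auto simp: sorted_append)
  moreover have "mset (replicate (n - m) 0 @ ?s) = singular_value_mset A"
    using singular_value_mset_adjoint[OF A mn] by simp
  ultimately have "sorted_list_of_multiset (singular_value_mset A) = replicate (n - m) 0 @ ?s"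
    using sorted_list_of_multiset_mset[of "replicate (n - m) 0 @ ?s"] by (simp only: sorted_sort_id)
  then have "singular_values A = singular_values (mat_adjoint A) @ replicate (n - m) 0"
    by (simp add: singular_values_alt)
  moreover have "length (singular_values (mat_adjoint A)) = m"
    using size_singular_value_mset[OF mat_adjoint_carrier[OF A]] by (simp add: singular_values_alt flip: size_mset)
  ultimately show ?thesis using i by (simp add: nth_append)
qed

lemma condition_number_adjoint:
  fixes A :: "complex mat"
  assumes A: "A \<in> carrier_mat m n" and mn: "1 \<le> m" "m \<le> n"
  shows "condition_number A = condition_number (mat_adjoint A)"
  using A mn singular_values_wide[OF A mn(2), of 0] singular_values_wide[OF A mn(2), of "m - 1"]
  by (simp add: condition_number_def min_def)

text \<open>At an eigenvector of the Gram matrix the two hypotheses bound the corresponding singular value by \<open>a\<close> from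
  above and by \<open>1 / c\<close> from below.\<close>

lemma ln_condition_number_le:
  fixes A :: "complex mat"
  assumes A: "A \<in> carrier_mat m n" and mn: "1 \<le> n" "n \<le> m" and ac: "0 < a" "0 < c"
    and upper: "\<And>x. (\<Sum>i<m. (cmod (\<Sum>k<n. A $$ (i, k) * x k))\<^sup>2) \<le> a\<^sup>2 * (\<Sum>k<n. (cmod (x k))\<^sup>2)"
    and lower: "\<And>x. (\<Sum>k<n. (cmod (x k))\<^sup>2) \<le> c\<^sup>2 * (\<Sum>i<m. (cmod (\<Sum>k<n. A $$ (i, k) * x k))\<^sup>2)"
  shows "ln_ereal (condition_number A) \<le> ereal (ln a + ln c)"
proof -
  define s t where "s = singular_values A ! 0" and "t = singular_values A ! (n - 1)"
  have kappa: "condition_number A = ereal s / ereal t"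
    using A mn by (simp add: condition_number_def s_def t_def min_def)
  have sv: "0 \<le> \<sigma> \<and> \<sigma> \<le> a \<and> 1 \<le> c * \<sigma>" if \<sigma>: "\<sigma> \<in># singular_value_mset A" for \<sigma>
  proof -
    obtain x where x: "\<exists>k<n. x k \<noteq> 0" "(\<Sum>i<m. (cmod (\<Sum>l<n. A $$ (i, l) * x l))\<^sup>2) = \<sigma>\<^sup>2 * (\<Sum>k<n. (cmod (x k))\<^sup>2)"
      using singular_value_witness(2)[OF A \<sigma>] by blast
    obtain k where "k < n" "x k \<noteq> 0" using x(1) by auto
    then have X: "0 < (\<Sum>k<n. (cmod (x k))\<^sup>2)" by (intro sum_pos2[of _ k]) auto
    have "\<sigma>\<^sup>2 \<le> a\<^sup>2" using upper[of x] X unfolding x(2) by (simp add: mult_le_cancel_right_pos)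
    moreover have "1 * (\<Sum>k<n. (cmod (x k))\<^sup>2) \<le> (c * \<sigma>)\<^sup>2 * (\<Sum>k<n. (cmod (x k))\<^sup>2)"
      using lower[of x] unfolding x(2) by (simp add: power_mult_distrib mult_ac)
    then have "1\<^sup>2 \<le> (c * \<sigma>)\<^sup>2" using X by (simp add: mult_le_cancel_right_pos del: mult_1)
    ultimately show ?thesis using singular_value_witness(1)[OF A \<sigma>] ac
      power2_le_imp_le[of \<sigma> a] power2_le_imp_le[of 1 "c * \<sigma>"] by simp
  qed
  have s: "0 \<le> s" "s \<le> a" "1 \<le> c * s" using sv singular_values_first_last(1)[OF A mn(1)] by (auto simp: s_def)
  have t: "0 \<le> t" "t \<le> a" "1 \<le> c * t" using sv singular_values_first_last(3)[OF A mn(1)] by (auto simp: t_def)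
  have pos: "0 < s" "0 < t" using s t by (auto simp: less_le)
  have "\<not> s / t \<le> 0" using divide_pos_pos[OF pos] by linarith
  then have "ln_ereal (condition_number A) = ereal (ln (s / t))"
    using pos by (simp add: kappa ln_ereal_def)
  also have "ln (s / t) \<le> ln (a * c)"
  proof -
    have "s / t \<le> a * c" 
      using mult_mono[OF s(2) t(3)] pos ac by (simp add: divide_le_eq mult_ac)
    then show ?thesis using pos ac by simp
  qed
  also have "ln (a * c) = ln a + ln c" using ac by (simp add: ln_mult)
  finally show ?thesis by simp
qed

text \<open>The vectors \<open>x\<close> and \<open>y\<close> are test vectors for the smallest and the largest singular value. A vanishing
  smallest singular value makes the condition number infinite.\<close>

lemma ln_condition_number_ge:
  fixes A :: "complex mat"
  assumes A: "A \<in> carrier_mat m n" and mn: "1 \<le> n" "n \<le> m" and bd: "0 < b" "0 < d"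
    and x: "\<exists>k<n. x k \<noteq> 0" "d\<^sup>2 * (\<Sum>i<m. (cmod (\<Sum>k<n. A $$ (i, k) * x k))\<^sup>2) \<le> (\<Sum>k<n. (cmod (x k))\<^sup>2)"
    and y: "\<exists>k<n. y k \<noteq> 0" "b\<^sup>2 * (\<Sum>k<n. (cmod (y k))\<^sup>2) \<le> (\<Sum>i<m. (cmod (\<Sum>k<n. A $$ (i, k) * y k))\<^sup>2)"
  shows "ereal (ln b + ln d) \<le> ln_ereal (condition_number A)"
proof -
  define s t where "s = singular_values A ! 0" and "t = singular_values A ! (n - 1)"
  have kappa: "condition_number A = ereal s / ereal t"
    using A mn by (simp add: condition_number_def s_def t_def min_def)
  have nn: "0 \<le> s" "0 \<le> t"
    using singular_value_witness(1)[OF A] singular_values_first_last(1,3)[OF A mn(1)] by (auto simp: s_def t_def)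
  have pos: "0 < (\<Sum>k<n. (cmod (z k))\<^sup>2)" if z: "\<exists>k<n. z k \<noteq> 0" for z :: "nat \<Rightarrow> complex"
  proof -
    obtain k where "k < n" "z k \<noteq> 0" using z by auto
    then show ?thesis by (intro sum_pos2[of _ k]) auto
  qed
  have "(\<Sum>i<m. (cmod (\<Sum>k<n. A $$ (i, k) * y k))\<^sup>2) \<le> s\<^sup>2 * (\<Sum>k<n. (cmod (y k))\<^sup>2)"
    using singular_values_first_last(2)[OF A mn(1)] nn by (intro singular_values_upper[OF A]) (auto simp: s_def)
  then have "b\<^sup>2 * (\<Sum>k<n. (cmod (y k))\<^sup>2) \<le> s\<^sup>2 * (\<Sum>k<n. (cmod (y k))\<^sup>2)" using y(2) by linarith
  then have "b\<^sup>2 \<le> s\<^sup>2" using pos[OF y(1)] by (simp add: mult_le_cancel_right_pos)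
  then have bs: "b \<le> s" using power2_le_imp_le[of b s] nn by simp
  have "t\<^sup>2 * (\<Sum>k<n. (cmod (x k))\<^sup>2) \<le> (\<Sum>i<m. (cmod (\<Sum>k<n. A $$ (i, k) * x k))\<^sup>2)"
    using singular_values_first_last(4)[OF A mn(1)] nn by (intro singular_values_lower[OF A]) (auto simp: t_def)
  then have "d\<^sup>2 * (t\<^sup>2 * (\<Sum>k<n. (cmod (x k))\<^sup>2)) \<le> d\<^sup>2 * (\<Sum>i<m. (cmod (\<Sum>k<n. A $$ (i, k) * x k))\<^sup>2)"
    by (intro mult_left_mono) auto
  then have "(d * t)\<^sup>2 * (\<Sum>k<n. (cmod (x k))\<^sup>2) \<le> 1 * (\<Sum>k<n. (cmod (x k))\<^sup>2)"
    using x(2) by (simp add: power_mult_distrib mult.assoc)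
  then have "(d * t)\<^sup>2 \<le> 1\<^sup>2" using pos[OF x(1)] by (simp add: mult_le_cancel_right_pos del: mult_1)
  then have dt: "d * t \<le> 1" by (rule power2_le_imp_le) simp
  have s: "0 < s" using bs bd by simp
  show ?thesis
  proof (cases "t = 0")
    case True
    then have "condition_number A = \<infinity>" using s by (simp add: kappa divide_ereal_def)
    then show ?thesis by (simp add: ln_ereal_def)
  next
    case False
    then have t: "0 < t" using nn by simp
    have "ln (b * d) \<le> ln (s / t)"
    proof -
      have "b * (d * t) \<le> s * 1" using bs dt bd nn by (intro mult_mono) auto
      then have "b * d \<le> s / t" using t by (simp add: le_divide_eq mult_ac)
      then show ?thesis using bd s t by simp
    qed
    moreover have "\<not> s / t \<le> 0" using divide_pos_pos[OF s t] by linarith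
    then have "ln_ereal (condition_number A) = ereal (ln (s / t))"
      using s t by (simp add: kappa ln_ereal_def)
    ultimately show ?thesis using bd by (simp add: ln_mult)
  qed
qed

section \<open>Submatrices of the Fourier matrix\<close>

lemma unit_root_power_commute: "unit_root N s ^ t = unit_root N t ^ s"
  by (simp add: Complex.DeMoivre mult_ac)

lemma unit_root_power: "unit_root N s ^ t = cis (2 * pi * real s * real t / real N)"
  by (simp add: Complex.DeMoivre mult_ac)

lemma unit_root_power_mod: "unit_root N s ^ (t mod N) = unit_root N s ^ t"
  by (metis unit_root_mod unit_root_power_commute)

lemma submatrix_fourier:
  assumes S: "S \<subseteq> {..<N}" and T: "T \<subseteq> {..<N}"
  shows "submatrix (fourier_matrix N) S T \<in> carrier_mat (card S) (card T)"
    and "\<And>i k. i < card S \<Longrightarrow> k < card T \<Longrightarrow>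
      submatrix (fourier_matrix N) S T $$ (i, k) = unit_root N (pick S i) ^ pick T k"
proof -
  have dims: "dim_row (fourier_matrix N) = N" "dim_col (fourier_matrix N) = N"
    by (simp_all add: fourier_matrix_def)
  have sets: "{i. i < N \<and> i \<in> S} = S" "{i. i < N \<and> i \<in> T} = T" using S T by auto
  show "submatrix (fourier_matrix N) S T \<in> carrier_mat (card S) (card T)"
    by (intro carrier_matI) (simp_all add: dim_submatrix dims sets)
  fix i k assume ik: "i < card S" "k < card T"
  have p: "pick S i < N" "pick T k < N" using pick_in_set_le[OF ik(1)] pick_in_set_le[OF ik(2)] S T by auto
  have "submatrix (fourier_matrix N) S T $$ (i, k) = fourier_matrix N $$ (pick S i, pick T k)"
    using ik by (intro submatrix_index) (simp_all add: dims sets)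
  also have "\<dots> = exp (\<i> * of_real (2 * pi * real (pick S i) * real (pick T k) / real N))"
    using p by (simp add: fourier_matrix_def mult_ac)
  also have "\<dots> = unit_root N (pick S i) ^ pick T k" by (subst unit_root_power) (simp only: cis_conv_exp)
  finally show "submatrix (fourier_matrix N) S T $$ (i, k) = unit_root N (pick S i) ^ pick T k" .
qed

lemma bij_betw_pick: assumes "finite S" shows "bij_betw (pick S) {..<card S} S"
proof -
  have inj: "inj_on (pick S) {..<card S}"
    by (rule inj_onI) (metis lessThan_iff linorder_neqE_nat nat_neq_iff pick_mono_le)
  have "pick S ` {..<card S} \<subseteq> S" using pick_in_set_le by auto
  moreover have "card (pick S ` {..<card S}) = card S" using inj by (simp add: card_image)
  ultimately have "pick S ` {..<card S} = S" using assms by (simp add: card_subset_eq)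
  then show ?thesis using inj by (simp add: bij_betw_def)
qed

lemma sum_pick:
  assumes "finite S" shows "(\<Sum>i<card S. g (pick S i)) = sum g S"
  by (rule sum.reindex_bij_betw[OF bij_betw_pick[OF assms]])

text \<open>Vectors indexed by \<open>0, 1, \<dots>\<close> as in a submatrix are the same as functions on the index set \<open>S\<close>.\<close>

lemma vector_on_pick:
  assumes "finite S"
  obtains x' where "\<And>i. i < card S \<Longrightarrow> x i = x' (pick S i)"
proof
  fix i assume "i < card S"
  then show "x i = (\<lambda>s. x (the_inv_into {..<card S} (pick S) s)) (pick S i)"
    using bij_betw_pick[OF assms] by (simp add: the_inv_into_f_f bij_betw_def)
qed

text \<open>The whole Fourier matrix is \<open>sqrt N\<close> times a unitary matrix, by Parseval.\<close>

lemma fourier_Bessel: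
  assumes S: "S \<subseteq> {..<N}" and T: "T \<subseteq> {..<N}" and N: "1 \<le> N"
  shows "(\<Sum>s\<in>S. (cmod (\<Sum>t\<in>T. x t * unit_root N s ^ t))\<^sup>2) \<le> real N * (\<Sum>t\<in>T. (cmod (x t))\<^sup>2)"
proof -
  have fT: "finite T" using T by (rule finite_subset) simp
  define p where "p = (\<Sum>t\<in>T. monom (x t) t)"
  have cp: "coeff p k = (if k \<in> T then x k else 0)" for k
    using fT by (simp add: p_def coeff_sum if_distrib cong: if_cong)
  have "degree p \<le> N - 1" using T by (intro degree_le) (auto simp: cp)
  then have deg: "degree p < N" using N by simp
  have "(\<Sum>s\<in>S. (cmod (\<Sum>t\<in>T. x t * unit_root N s ^ t))\<^sup>2) = (\<Sum>s\<in>S. (cmod (poly p (1 * unit_root N s)))\<^sup>2)"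
    by (simp add: p_def poly_sum poly_monom)
  also have "\<dots> \<le> (\<Sum>s<N. (cmod (poly p (1 * unit_root N s)))\<^sup>2)"
    using S by (intro sum_mono2) auto
  also have "\<dots> = real N * (\<Sum>k<N. (cmod (coeff p k))\<^sup>2)"
    using deg by (intro Parseval_roots_of_unity) auto
  also have "(\<Sum>k<N. (cmod (coeff p k))\<^sup>2) = (\<Sum>t\<in>T. (cmod (x t))\<^sup>2)"
    using T by (intro sum.mono_neutral_cong_right) (auto simp: cp)
  finally show ?thesis .
qed

definition cyclic_arc :: "nat \<Rightarrow> nat \<Rightarrow> nat \<Rightarrow> nat set" where
  "cyclic_arc N a n = (\<lambda>i. (a + i) mod N) ` {..<n}"

lemma inj_on_arc:
  fixes a n N :: nat
  assumes "n \<le> N" shows "inj_on (\<lambda>i. (a + i) mod N) {..<n}"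
proof -
  have "i = j" if "i \<le> j" "j < N" "(a + i) mod N = (a + j) mod N" for i j
  proof -
    have "N dvd (a + j) - (a + i)" using that by (intro mod_eq_dvd_iff_nat[THEN iffD1]) auto
    then have "N dvd j - i" by simp
    then show ?thesis using that dvd_imp_le[of N "j - i"] by (cases "i = j") auto
  qed
  then show ?thesis using assms by (intro inj_onI) (metis lessThan_iff linear order_less_le_trans)
qed

lemma card_arc: "n \<le> N \<Longrightarrow> card (cyclic_arc N a n) = n"
  unfolding cyclic_arc_def by (subst card_image[OF inj_on_arc]) auto

lemma arc_subset: "1 \<le> N \<Longrightarrow> cyclic_arc N a n \<subseteq> {..<N}"
  by (auto simp: cyclic_arc_def)

lemma arc_mono: "m \<le> n \<Longrightarrow> cyclic_arc N a m \<subseteq> cyclic_arc N a n"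
  unfolding cyclic_arc_def by (intro image_mono) auto

lemma cyclically_contiguous_arc:
  assumes S: "S \<subseteq> {..<N}" and N: "1 \<le> N" and c: "cyclically_contiguous N S"
  obtains a where "S = cyclic_arc N a (card S)"
proof -
  obtain a l where al: "S = (\<lambda>i. i mod N) ` {a..<a + l}" using c by (auto simp: cyclically_contiguous_def)
  have "{a..<a + l} = (\<lambda>i. a + i) ` {..<l}" 
    using image_add_atLeastLessThan[of a 0 l] by (simp add: atLeast0LessThan add.commute)
  then have S': "S = cyclic_arc N a l" by (simp add: al cyclic_arc_def image_image)
  show ?thesis
  proof (cases "l \<le> N")
    case True
    then show ?thesis using that[of a] S' card_arc[of l N a] by simp
  next
    case False
    have "cyclic_arc N a N = {..<N}"
      by (rule card_subset_eq) (use arc_subset[OF N] in \<open>auto simp: card_arc\<close>)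
    then have "S = cyclic_arc N a N" using S S' arc_mono[of N l N a] False by auto
    then show ?thesis using that[of a] card_arc[of N N a] by simp
  qed
qed

lemma unit_root_image_arc: "unit_root N ` cyclic_arc N a n = arc_nodes N (unit_root N a) n"
  unfolding cyclic_arc_def arc_nodes_def image_image unit_root_mod unit_root_add ..

lemma sum_arc:
  assumes "n \<le> N" shows "sum g (cyclic_arc N a n) = (\<Sum>i<n. g ((a + i) mod N))"
  unfolding cyclic_arc_def by (subst sum.reindex[OF inj_on_arc[OF assms]]) simp

text \<open>Starting the arc of columns at \<open>a\<close> instead of \<open>0\<close> multiplies the rows by unimodular factors, which
  change no norm.\<close>

lemma fourier_arc_sum:
  assumes "n \<le> N"
  shows "(\<Sum>t\<in>cyclic_arc N a n. x t * unit_root N s ^ t)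
       = unit_root N s ^ a * (\<Sum>i<n. x ((a + i) mod N) * unit_root N s ^ i)"
  unfolding sum_arc[OF assms] unit_root_power_mod sum_distrib_left
  by (intro sum.cong refl) (simp only: power_add mult_ac)

lemma sum_unit_root_image:
  assumes "S \<subseteq> {..<N}"
  shows "(\<Sum>z\<in>unit_root N ` S. g z) = (\<Sum>s\<in>S. g (unit_root N s))"
  by (subst sum.reindex[OF inj_on_subset[OF inj_on_unit_root assms]]) simp

lemma card_unit_root_image:
  assumes "S \<subseteq> {..<N}" shows "card (unit_root N ` S) = card S"
  by (rule card_image[OF inj_on_subset[OF inj_on_unit_root assms]])

lemma fourier_lower_bound:
  assumes S: "S \<subseteq> {..<N}" and T: "T = cyclic_arc N a n" and n: "n \<le> card S" "n \<le> N"
  shows "(\<Sum>t\<in>T. (cmod (x t))\<^sup>2)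
     \<le> interpolation_constant (unit_root N ` S) * (\<Sum>s\<in>S. (cmod (\<Sum>t\<in>T. x t * unit_root N s ^ t))\<^sup>2)"
proof -
  have fS: "finite S" using S by (rule finite_subset) simp
  have "(\<Sum>t\<in>T. (cmod (x t))\<^sup>2) = (\<Sum>i<n. (cmod (x ((a + i) mod N)))\<^sup>2)"
    unfolding T sum_arc[OF n(2)] ..
  also have "\<dots> \<le> interpolation_constant (unit_root N ` S) *
      (\<Sum>z\<in>unit_root N ` S. (cmod (\<Sum>i<n. x ((a + i) mod N) * z ^ i))\<^sup>2)"
    using fS n card_unit_root_image[OF S] by (intro interpolation_lower_bound) auto
  also have "(\<Sum>z\<in>unit_root N ` S. (cmod (\<Sum>i<n. x ((a + i) mod N) * z ^ i))\<^sup>2)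
      = (\<Sum>s\<in>S. (cmod (\<Sum>t\<in>T. x t * unit_root N s ^ t))\<^sup>2)"
    unfolding sum_unit_root_image[OF S] T fourier_arc_sum[OF n(2)] by (simp add: norm_mult norm_power)
  finally show ?thesis .
qed

text \<open>With fewer rows than columns the adjoint has to be bounded from below, which the dual interpolation
  inequality does after enlarging the row set to \<open>card T\<close> nodes.\<close>

lemma fourier_dual_lower_bound:
  assumes S: "S \<subseteq> S'" "S' \<subseteq> {..<N}" and T: "T = cyclic_arc N a n" and n: "card S' = n" "n \<le> N"
  shows "(\<Sum>s\<in>S. (cmod (y s))\<^sup>2)
     \<le> interpolation_constant (unit_root N ` S') * (\<Sum>t\<in>T. (cmod (\<Sum>s\<in>S. y s * cnj (unit_root N s ^ t)))\<^sup>2)"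
proof -
  have fS: "finite S'" using S(2) by (rule finite_subset) simp
  have SN: "S \<subseteq> {..<N}" using S by auto
  have inj: "inj_on (unit_root N) S" using inj_on_subset[OF inj_on_unit_root SN] .
  define Y where "Y = (\<lambda>z. let s = the_inv_into S (unit_root N) z in y s * cnj (unit_root N s ^ a))"
  have Y: "Y (unit_root N s) = y s * cnj (unit_root N s ^ a)" if "s \<in> S" for s
    using that by (simp add: Y_def the_inv_into_f_f[OF inj])
  have "(\<Sum>s\<in>S. (cmod (y s))\<^sup>2) = (\<Sum>z\<in>unit_root N ` S. (cmod (Y z))\<^sup>2)"
    unfolding sum_unit_root_image[OF SN] by (intro sum.cong refl) (simp add: Y norm_mult norm_power)
  also have "\<dots> \<le> interpolation_constant (unit_root N ` S') *
     (\<Sum>k<card (unit_root N ` S'). (cmod (\<Sum>z\<in>unit_root N ` S. Y z * cnj (z ^ k)))\<^sup>2)"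
    using fS S by (intro interpolation_dual_lower_bound) auto
  also have "(\<Sum>k<card (unit_root N ` S'). (cmod (\<Sum>z\<in>unit_root N ` S. Y z * cnj (z ^ k)))\<^sup>2)
      = (\<Sum>k<n. (cmod (\<Sum>s\<in>S. y s * cnj (unit_root N s ^ ((a + k) mod N))))\<^sup>2)"
    unfolding card_unit_root_image[OF S(2)] n(1) sum_unit_root_image[OF SN] unit_root_power_mod
  proof (intro sum.cong refl arg_cong[of _ _ "\<lambda>z. (cmod z)\<^sup>2"])
    fix k s assume "s \<in> S"
    then show "Y (unit_root N s) * cnj (unit_root N s ^ k) = y s * cnj (unit_root N s ^ (a + k))"
      unfolding Y[OF \<open>s \<in> S\<close>] power_add complex_cnj_mult by (simp only: mult_ac)
  qed
  also have "\<dots> = (\<Sum>t\<in>T. (cmod (\<Sum>s\<in>S. y s * cnj (unit_root N s ^ t)))\<^sup>2)"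
    unfolding T sum_arc[OF n(2)] ..
  finally show ?thesis .
qed

lemma fourier_arc_extremal_vector:
  assumes S: "S = cyclic_arc N a n" and T: "T = cyclic_arc N b n" and n: "1 \<le> n" "n < N"
  shows "\<exists>x. (\<exists>t\<in>T. x t \<noteq> 0) \<and>
     (chord N n * extremal_ratio N n / 16)\<^sup>2 * (\<Sum>s\<in>S. (cmod (\<Sum>t\<in>T. x t * unit_root N s ^ t))\<^sup>2)
       \<le> (\<Sum>t\<in>T. (cmod (x t))\<^sup>2)"
proof -
  have nN: "n \<le> N" "S \<subseteq> {..<N}" using n arc_subset[of N a n] by (auto simp: S)
  obtain p where p: "degree p < n" "p \<noteq> 0" "(chord N n * extremal_ratio N n / 16)\<^sup>2 *
      (\<Sum>z\<in>arc_nodes N (unit_root N a) n. (cmod (poly p z))\<^sup>2) \<le> (\<Sum>k<n. (cmod (coeff p k))\<^sup>2)"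
    using arc_extremal_polynomial[of "unit_root N a" n N] n by auto
  define x where "x = (\<lambda>t. coeff p (the_inv_into {..<n} (\<lambda>i. (b + i) mod N) t))"
  have x: "x ((b + i) mod N) = coeff p i" if "i < n" for i
    using that the_inv_into_f_f[OF inj_on_arc[OF nN(1), of b], of i] by (simp add: x_def)
  have "(\<Sum>s\<in>S. (cmod (\<Sum>t\<in>T. x t * unit_root N s ^ t))\<^sup>2) = (\<Sum>s\<in>S. (cmod (poly p (unit_root N s)))\<^sup>2)"
  proof (rule sum.cong[OF refl])
    fix s
    have "(\<Sum>t\<in>T. x t * unit_root N s ^ t) = unit_root N s ^ b * (\<Sum>i<n. coeff p i * unit_root N s ^ i)"
      unfolding T fourier_arc_sum[OF nN(1)] by (simp add: x)
    also have "(\<Sum>i<n. coeff p i * unit_root N s ^ i) = poly p (unit_root N s)"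
      unfolding poly_altdef using p(1) by (intro sum.mono_neutral_right) (auto simp: coeff_eq_0)
    finally show "(cmod (\<Sum>t\<in>T. x t * unit_root N s ^ t))\<^sup>2 = (cmod (poly p (unit_root N s)))\<^sup>2"
      by (simp add: norm_mult norm_power)
  qed
  also have "\<dots> = (\<Sum>z\<in>arc_nodes N (unit_root N a) n. (cmod (poly p z))\<^sup>2)"
    using sum_unit_root_image[OF nN(2), of "\<lambda>z. (cmod (poly p z))\<^sup>2"]
    unfolding S unit_root_image_arc by simp
  finally have 1: "(\<Sum>s\<in>S. (cmod (\<Sum>t\<in>T. x t * unit_root N s ^ t))\<^sup>2) = (\<Sum>z\<in>arc_nodes N (unit_root N a) n. (cmod (poly p z))\<^sup>2)" .
  have 2: "(\<Sum>t\<in>T. (cmod (x t))\<^sup>2) = (\<Sum>k<n. (cmod (coeff p k))\<^sup>2)"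
    unfolding T sum_arc[OF nN(1)] by (simp add: x)
  have "x ((b + degree p) mod N) \<noteq> 0" using p(1,2) by (simp add: x)
  moreover have "(b + degree p) mod N \<in> T" using p(1) by (auto simp: T cyclic_arc_def)
  ultimately show ?thesis using p(3) unfolding 1[symmetric] 2[symmetric] by blast
qed

text \<open>Numerator and denominator of the extremal ratio are products of cosines and of sines.\<close>

lemma log_extremal_ratio:
  assumes n: "1 \<le> n" "n < N"
  defines "\<alpha> \<equiv> real n / real N"
  shows "\<bar>ln (extremal_ratio N n) + ln (real N) - log_cot_term N \<alpha>\<bar> \<le> 10 * - ln (\<alpha> * (1 - \<alpha>))"
proof -
  have "chord_fact N m = (\<Prod>k=1..m. 2 * sin (real k * (pi / real N)))" for m
    by (simp add: chord_fact_def chord_def mult.commute)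
  then have "extremal_ratio N n = (\<Prod>j<n. 2 * cos (pi / real N * (real j - (real n - 1) / 2))) /
      ((\<Prod>k=1..n div 2. 2 * sin (real k * (pi / real N))) * (\<Prod>k=1..n - n div 2. 2 * sin (real k * (pi / real N))))"
    by (simp only: extremal_ratio_def sum_chord_binomial[OF n(2)])
  then show ?thesis using product_quotient_estimate[OF n] by (simp only: log_cot_term_def \<alpha>_def)
qed

text \<open>The largest singular value is at most \<open>sqrt N\<close>. The smallest one is bounded by interpolation at the
  nodes \<open>S'\<close>: if \<open>S\<close> is the larger set then \<open>S' = S\<close>, otherwise \<open>S'\<close> completes \<open>S\<close> to a square
  problem and the dual inequality applies to the adjoint.\<close>

lemma ln_condition_number_fourier_le:
  assumes S: "S \<subseteq> {..<N}" "S \<noteq> {}" and T: "T = cyclic_arc N a (card T)" "T \<noteq> {}"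
    and N: "1 \<le> N" and n: "n = max (card S) (card T)"
    and S': "S \<subseteq> S'" "S' \<subseteq> {..<N}" "card S' = n"
    and I: "interpolation_constant (unit_root N ` S') \<le> c\<^sup>2" "0 < c"
  shows "ln_ereal (condition_number (submatrix (fourier_matrix N) S T)) \<le> ereal (ln (real N) / 2 + ln c)"
proof -
  let ?A = "submatrix (fourier_matrix N) S T"
  have TN: "T \<subseteq> {..<N}" using T(1) arc_subset[OF N] by metis
  have fS: "finite S" "finite T" using S TN finite_subset by blast+
  have cards: "1 \<le> card S" "1 \<le> card T" using S T fS by (auto simp: Suc_le_eq card_gt_0_iff)
  note A = submatrix_fourier[OF S(1) TN]
  have nN: "n \<le> N" using card_mono[OF _ S'(2)] S'(3) by simp
  have sqrtN: "(sqrt (real N))\<^sup>2 = real N" "0 < sqrt (real N)" "ln (sqrt (real N)) = ln (real N) / 2"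
    using N by (auto simp: ln_sqrt)
  have form: "(\<Sum>i<card S. (cmod (\<Sum>k<card T. ?A $$ (i, k) * x k))\<^sup>2) = (\<Sum>s\<in>S. (cmod (\<Sum>t\<in>T. x' t * unit_root N s ^ t))\<^sup>2)"
    if x: "\<forall>k<card T. x k = x' (pick T k)" for x x'
  proof -
    have "(\<Sum>k<card T. ?A $$ (i, k) * x k) = (\<Sum>t\<in>T. x' t * unit_root N (pick S i) ^ t)" if "i < card S" for i
      unfolding sum_pick[OF fS(2), symmetric] using that by (intro sum.cong) (auto simp: A(2) x)
    then have "(\<Sum>i<card S. (cmod (\<Sum>k<card T. ?A $$ (i, k) * x k))\<^sup>2)
        = (\<Sum>i<card S. (\<lambda>s. (cmod (\<Sum>t\<in>T. x' t * unit_root N s ^ t))\<^sup>2) (pick S i))" by simp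
    then show ?thesis
      using sum_pick[OF fS(1), of "\<lambda>s. (cmod (\<Sum>t\<in>T. x' t * unit_root N s ^ t))\<^sup>2"] by simp
  qed
  have formT: "(\<Sum>k<card T. (cmod (x k))\<^sup>2) = (\<Sum>t\<in>T. (cmod (x' t))\<^sup>2)"
    if x: "\<forall>k<card T. x k = x' (pick T k)" for x x' :: "nat \<Rightarrow> complex"
    unfolding sum_pick[OF fS(2), symmetric] by (simp add: x)
  show ?thesis
  proof (cases "card T \<le> card S")
    case True
    then have "card S = card S'" using n S' by simp
    then have SS: "S' = S" using S' finite_subset[OF S'(2)] card_subset_eq[of S' S] by auto
    have "ln_ereal (condition_number ?A) \<le> ereal (ln (sqrt (real N)) + ln c)"
    proof (rule ln_condition_number_le[OF A(1) cards(2) True sqrtN(2) I(2)])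
      fix x :: "nat \<Rightarrow> complex"
      obtain x' where x': "\<forall>k<card T. x k = x' (pick T k)" using vector_on_pick[OF fS(2), of x] by blast
      show "(\<Sum>i<card S. (cmod (\<Sum>k<card T. ?A $$ (i, k) * x k))\<^sup>2) \<le> (sqrt (real N))\<^sup>2 * (\<Sum>k<card T. (cmod (x k))\<^sup>2)"
        unfolding form[of x x', OF x'] formT[of x x', OF x'] sqrtN by (rule fourier_Bessel[OF S(1) TN N])
      have "(\<Sum>t\<in>T. (cmod (x' t))\<^sup>2)
          \<le> interpolation_constant (unit_root N ` S) * (\<Sum>s\<in>S. (cmod (\<Sum>t\<in>T. x' t * unit_root N s ^ t))\<^sup>2)"
        using True card_mono[OF _ TN] by (intro fourier_lower_bound[OF S(1) T(1)]) auto
      also have "\<dots> \<le> c\<^sup>2 * (\<Sum>s\<in>S. (cmod (\<Sum>t\<in>T. x' t * unit_root N s ^ t))\<^sup>2)"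
        using I(1) SS by (intro mult_right_mono sum_nonneg) auto
      finally show "(\<Sum>k<card T. (cmod (x k))\<^sup>2) \<le> c\<^sup>2 * (\<Sum>i<card S. (cmod (\<Sum>k<card T. ?A $$ (i, k) * x k))\<^sup>2)"
        unfolding form[of x x', OF x'] formT[of x x', OF x'] .
    qed
    then show ?thesis by (simp add: sqrtN)
  next
    case False
    let ?B = "mat_adjoint ?A"
    have B: "?B \<in> carrier_mat (card T) (card S)" using A(1) by (rule mat_adjoint_carrier)
    have nT: "n = card T" using False n by simp
    have formB: "(\<Sum>k<card T. (cmod (\<Sum>i<card S. ?B $$ (k, i) * y i))\<^sup>2) = (\<Sum>t\<in>T. (cmod (\<Sum>s\<in>S. y' s * cnj (unit_root N s ^ t)))\<^sup>2)"
      if y: "\<forall>i<card S. y i = y' (pick S i)" for y y'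
    proof -
      have "(\<Sum>i<card S. ?B $$ (k, i) * y i) = (\<Sum>s\<in>S. y' s * cnj (unit_root N s ^ pick T k))" if "k < card T" for k
        unfolding sum_pick[OF fS(1), symmetric] using that A(1)
        by (intro sum.cong) (auto simp: mat_adjoint_index A(2) y)
      then have "(\<Sum>k<card T. (cmod (\<Sum>i<card S. ?B $$ (k, i) * y i))\<^sup>2)
          = (\<Sum>k<card T. (\<lambda>t. (cmod (\<Sum>s\<in>S. y' s * cnj (unit_root N s ^ t)))\<^sup>2) (pick T k))" by simp
      then show ?thesis
        using sum_pick[OF fS(2), of "\<lambda>t. (cmod (\<Sum>s\<in>S. y' s * cnj (unit_root N s ^ t)))\<^sup>2"] by simp
    qed
    have formS: "(\<Sum>i<card S. (cmod (y i))\<^sup>2) = (\<Sum>s\<in>S. (cmod (y' s))\<^sup>2)"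
      if y: "\<forall>i<card S. y i = y' (pick S i)" for y y' :: "nat \<Rightarrow> complex"
      unfolding sum_pick[OF fS(1), symmetric] by (simp add: y)
    have "ln_ereal (condition_number ?B) \<le> ereal (ln (sqrt (real N)) + ln c)"
    proof (rule ln_condition_number_le[OF B cards(1) _ sqrtN(2) I(2)])
      show "card S \<le> card T" using False by simp
      fix y :: "nat \<Rightarrow> complex"
      obtain y' where y': "\<forall>i<card S. y i = y' (pick S i)" using vector_on_pick[OF fS(1), of y] by blast
      have "(\<Sum>t\<in>T. (cmod (\<Sum>s\<in>S. y' s * cnj (unit_root N s ^ t)))\<^sup>2)
          = (\<Sum>t\<in>T. (cmod (\<Sum>s\<in>S. cnj (y' s) * unit_root N t ^ s))\<^sup>2)"
      proof (rule sum.cong[OF refl])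
        fix t
        have "(\<Sum>s\<in>S. y' s * cnj (unit_root N s ^ t)) = cnj (\<Sum>s\<in>S. cnj (y' s) * unit_root N t ^ s)"
          unfolding cnj_sum
          by (intro sum.cong refl) (subst unit_root_power_commute, simp only: complex_cnj_mult complex_cnj_cnj)
        then show "(cmod (\<Sum>s\<in>S. y' s * cnj (unit_root N s ^ t)))\<^sup>2 = (cmod (\<Sum>s\<in>S. cnj (y' s) * unit_root N t ^ s))\<^sup>2"
          by (simp only: complex_mod_cnj)
      qed
      also have "\<dots> \<le> real N * (\<Sum>s\<in>S. (cmod (cnj (y' s)))\<^sup>2)" by (rule fourier_Bessel[OF TN S(1) N])
      finally show "(\<Sum>k<card T. (cmod (\<Sum>i<card S. ?B $$ (k, i) * y i))\<^sup>2) \<le> (sqrt (real N))\<^sup>2 * (\<Sum>i<card S. (cmod (y i))\<^sup>2)"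
        unfolding formB[of y y', OF y'] formS[of y y', OF y'] sqrtN by simp
      have "(\<Sum>s\<in>S. (cmod (y' s))\<^sup>2)
          \<le> interpolation_constant (unit_root N ` S') * (\<Sum>t\<in>T. (cmod (\<Sum>s\<in>S. y' s * cnj (unit_root N s ^ t)))\<^sup>2)"
        using S' nT nN by (intro fourier_dual_lower_bound[OF _ _ T(1)]) auto
      also have "\<dots> \<le> c\<^sup>2 * (\<Sum>t\<in>T. (cmod (\<Sum>s\<in>S. y' s * cnj (unit_root N s ^ t)))\<^sup>2)"
        using I(1) by (intro mult_right_mono sum_nonneg) auto
      finally show "(\<Sum>i<card S. (cmod (y i))\<^sup>2) \<le> c\<^sup>2 * (\<Sum>k<card T. (cmod (\<Sum>i<card S. ?B $$ (k, i) * y i))\<^sup>2)"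
        unfolding formB[of y y', OF y'] formS[of y y', OF y'] .
    qed
    then show ?thesis using condition_number_adjoint[OF A(1) cards(1)] False by (simp add: sqrtN)
  qed
qed

text \<open>All entries are unimodular, so a unit vector shows that the largest singular value is at least
  \<open>sqrt n\<close>; the extremal polynomial bounds the smallest one.\<close>

lemma ln_condition_number_fourier_ge:
  assumes S: "S = cyclic_arc N a n" and T: "T = cyclic_arc N b n" and n: "1 \<le> n" "n < N"
  shows "ereal (ln (real n) / 2 + ln (chord N n * extremal_ratio N n / 16))
       \<le> ln_ereal (condition_number (submatrix (fourier_matrix N) S T))"
proof -
  let ?A = "submatrix (fourier_matrix N) S T"
  have SN: "S \<subseteq> {..<N}" "T \<subseteq> {..<N}" using S T arc_subset n by auto
  have fS: "finite S" "finite T" using SN finite_subset by blast+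
  have cards: "card S = n" "card T = n" using S T n card_arc by auto
  note A = submatrix_fourier[OF SN, unfolded cards]
  have form: "(\<Sum>i<n. (cmod (\<Sum>k<n. ?A $$ (i, k) * x (pick T k)))\<^sup>2) = (\<Sum>s\<in>S. (cmod (\<Sum>t\<in>T. x t * unit_root N s ^ t))\<^sup>2)" for x
  proof -
    have "(\<Sum>k<n. ?A $$ (i, k) * x (pick T k)) = (\<Sum>t\<in>T. x t * unit_root N (pick S i) ^ t)" if "i < n" for i
      unfolding sum_pick[OF fS(2), symmetric] cards using that by (intro sum.cong) (auto simp: A(2))
    then have "(\<Sum>i<n. (cmod (\<Sum>k<n. ?A $$ (i, k) * x (pick T k)))\<^sup>2)
        = (\<Sum>i<n. (\<lambda>s. (cmod (\<Sum>t\<in>T. x t * unit_root N s ^ t))\<^sup>2) (pick S i))" by simp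
    then show ?thesis using sum_pick[OF fS(1), of "\<lambda>s. (cmod (\<Sum>t\<in>T. x t * unit_root N s ^ t))\<^sup>2"] by (simp add: cards)
  qed
  have formT: "(\<Sum>k<n. (cmod (x (pick T k)))\<^sup>2) = (\<Sum>t\<in>T. (cmod (x t))\<^sup>2)" for x :: "nat \<Rightarrow> complex"
    using sum_pick[OF fS(2), of "\<lambda>t. (cmod (x t))\<^sup>2"] by (simp add: cards)
  obtain x where x: "\<exists>t\<in>T. x t \<noteq> 0" "(chord N n * extremal_ratio N n / 16)\<^sup>2 *
     (\<Sum>s\<in>S. (cmod (\<Sum>t\<in>T. x t * unit_root N s ^ t))\<^sup>2) \<le> (\<Sum>t\<in>T. (cmod (x t))\<^sup>2)"
    using fourier_arc_extremal_vector[OF S T n] by auto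
  have nz: "\<exists>k<n. x (pick T k) \<noteq> 0"
  proof -
    obtain t where t: "t \<in> T" "x t \<noteq> 0" using x(1) by auto
    then obtain k where "k < n" "t = pick T k"
      using bij_betw_imp_surj_on[OF bij_betw_pick[OF fS(2)]] cards by (metis imageE lessThan_iff)
    then show ?thesis using t by auto
  qed
  have y: "(sqrt (real n))\<^sup>2 * (\<Sum>k<n. (cmod (if k = 0 then 1 else 0))\<^sup>2)
      \<le> (\<Sum>i<n. (cmod (\<Sum>k<n. ?A $$ (i, k) * (if k = 0 then 1 else 0)))\<^sup>2)"
  proof -
    have "(\<Sum>k<n. ?A $$ (i, k) * (if k = 0 then 1 else 0)) = unit_root N (pick S i) ^ pick T 0" if "i < n" for i
      using that n by (simp add: A(2) if_distrib cong: if_cong)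
    moreover have "(\<Sum>k<n. (cmod (if k = 0 then 1 else 0))\<^sup>2) = (\<Sum>k<n. if k = 0 then 1 else (0::real))"
      by (intro sum.cong) auto
    ultimately show ?thesis using n by (simp add: norm_power)
  qed
  have E: "1 \<le> extremal_ratio N n" "0 < chord N n" using extremal_ratio_ge_1 chord_pos n by auto
  have "ereal (ln (sqrt (real n)) + ln (chord N n * extremal_ratio N n / 16)) \<le> ln_ereal (condition_number ?A)"
  proof (rule ln_condition_number_ge[OF A(1) n(1) order_refl _ _ nz _ _ y])
    show "0 < sqrt (real n)" using n by simp
    show "0 < chord N n * extremal_ratio N n / 16" using E by (intro divide_pos_pos mult_pos_pos) auto
    show "(chord N n * extremal_ratio N n / 16)\<^sup>2 * (\<Sum>i<n. (cmod (\<Sum>k<n. ?A $$ (i, k) * x (pick T k)))\<^sup>2)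
        \<le> (\<Sum>k<n. (cmod (x (pick T k)))\<^sup>2)"
      unfolding form formT by (rule x(2))
    show "\<exists>k<n. (if k = 0 then 1 else 0 :: complex) \<noteq> 0" using n by (intro exI[of _ 0]) auto
  qed
  then show ?thesis using n by (simp add: ln_sqrt)
qed

lemma chord_ge: 
  assumes "1 \<le> n" "n < N" shows "4 * (real n / real N * (1 - real n / real N)) \<le> chord N n"
proof -
  define \<alpha> where "\<alpha> = real n / real N"
  have a: "0 \<le> \<alpha>" "\<alpha> \<le> 1" using assms by (auto simp: \<alpha>_def)
  have c: "1 - \<alpha> \<le> cos (\<alpha> * pi / 2)" using a by (rule cos_half_pi_ge)
  have e: "(1 - \<alpha>) * pi / 2 = pi / 2 - \<alpha> * pi / 2" by (simp add: left_diff_distrib diff_divide_distrib)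
  have "cos ((1 - \<alpha>) * pi / 2) = sin (\<alpha> * pi / 2)" unfolding e cos_diff by simp
  then have s: "\<alpha> \<le> sin (\<alpha> * pi / 2)" using cos_half_pi_ge[of "1 - \<alpha>"] a by simp
  have "chord N n = 2 * sin (2 * (\<alpha> * pi / 2))" by (simp add: chord_def \<alpha>_def mult.commute)
  also have "\<dots> = 4 * (sin (\<alpha> * pi / 2) * cos (\<alpha> * pi / 2))"
    unfolding sin_double by simp
  finally have e: "chord N n = 4 * (sin (\<alpha> * pi / 2) * cos (\<alpha> * pi / 2))" .
  have "\<alpha> * (1 - \<alpha>) \<le> sin (\<alpha> * pi / 2) * cos (\<alpha> * pi / 2)" using s c a by (intro mult_mono) auto
  then show ?thesis unfolding e \<alpha>_def[symmetric] by simp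
qed

theorem corollary1p2:
  shows "\<exists>K::real. K > 0 \<and>
    (\<forall>(N::nat) (S::nat set) (T::nat set) (\<alpha>::real).
       N \<ge> 1 \<longrightarrow> S \<subseteq> {..<N} \<longrightarrow> S \<noteq> {} \<longrightarrow> T \<subseteq> {..<N} \<longrightarrow> T \<noteq> {} \<longrightarrow>
       cyclically_contiguous N T \<longrightarrow>
       \<alpha> = real (max (card S) (card T)) / real N \<longrightarrow>
         ln_ereal (condition_number (submatrix (fourier_matrix N) S T))
           \<le> ereal (log_cot_term N \<alpha>) + ereal K * log_error \<alpha> \<and>
         (cyclically_contiguous N S \<longrightarrow>
            ln_ereal (condition_number (submatrix (fourier_matrix N) S T))
              \<le> ereal (log_cot_term N \<alpha> - 1 / 2 * ln (real N)) + ereal K * log_error \<alpha>) \<and>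
         (cyclically_contiguous N S \<and> card S = card T \<longrightarrow>
            \<bar>ln_ereal (condition_number (submatrix (fourier_matrix N) S T))
               - ereal (log_cot_term N \<alpha> - 1 / 2 * ln (real N))\<bar>
              \<le> ereal K * log_error \<alpha>))"
proof (intro exI[of _ "20::real"] conjI allI impI)
  (* 10 from the Riemann sum; the rest pays for bounded factors and powers of \<alpha> and 1 - \<alpha> *)
  show "(0::real) < 20" by simp
next
  fix N :: nat and S T :: "nat set" and \<alpha> :: real
  assume N: "1 \<le> N" and S: "S \<subseteq> {..<N}" "S \<noteq> {}" and T: "T \<subseteq> {..<N}" "T \<noteq> {}"
    and cT: "cyclically_contiguous N T" and \<alpha>: "\<alpha> = real (max (card S) (card T)) / real N"
  define \<kappa> where "\<kappa> = ln_ereal (condition_number (submatrix (fourier_matrix N) S T))"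
  define L where "L = log_cot_term N \<alpha>"
  define n where "n = max (card S) (card T)"
  have fin: "finite S" "finite T" using S T finite_subset by blast+
  have n1: "1 \<le> n" using S fin by (auto simp: n_def Suc_le_eq card_gt_0_iff)
  have nN: "n \<le> N" using card_mono[OF _ S(1)] card_mono[OF _ T(1)] by (auto simp: n_def)
  have an: "\<alpha> = real n / real N" by (simp add: \<alpha> n_def)
  obtain b where b: "T = cyclic_arc N b (card T)" using cyclically_contiguous_arc[OF T(1) N cT] .
  have main: "\<kappa> \<le> ereal L + ereal 20 * log_error \<alpha> \<and>
     (cyclically_contiguous N S \<longrightarrow> \<kappa> \<le> ereal (L - 1 / 2 * ln (real N)) + ereal 20 * log_error \<alpha>) \<and>
     (cyclically_contiguous N S \<and> card S = card T \<longrightarrow>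
       \<bar>\<kappa> - ereal (L - 1 / 2 * ln (real N))\<bar> \<le> ereal 20 * log_error \<alpha>)"
  proof (cases "n = N")
    case True
    then have "log_error \<alpha> = \<infinity>" using N by (simp add: an log_error_def ln_ereal_def)
    then show ?thesis by simp
  next
    case False
    then have nlt: "n < N" using nN by simp
    have a: "0 < \<alpha>" "\<alpha> < 1" using n1 nlt by (auto simp: an)
    define e where "e = - ln (\<alpha> * (1 - \<alpha>))"
    have pos: "0 < \<alpha> * (1 - \<alpha>)" using a by simp
    have e1: "1 \<le> e" using ln_mult_complement_le[OF a] by (simp add: e_def)
    have err: "log_error \<alpha> = ereal e"
      using pos e1 by (simp add: log_error_def ln_ereal_def e_def not_le)
    let ?E = "extremal_ratio N n"
    have E: "1 \<le> ?E" using extremal_ratio_ge_1[OF nlt] .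
    have key: "\<bar>ln ?E + ln (real N) - L\<bar> \<le> 10 * e"
      using log_extremal_ratio[OF n1 nlt] by (simp add: L_def e_def an)
    have lnN: "0 \<le> ln (real N)" using N by simp
    have ln_small: "ln 2 \<le> (1::real)" "ln 5 \<le> (2::real)" "ln 4 \<le> (2::real)"
    proof -
      show "ln 2 \<le> (1::real)" using ln_2_less_1 by simp
      have "ln (5/4 :: real) \<le> 5/4 - 1" by (intro ln_le_minus_one) auto
      moreover have "ln (4::real) = 2 * ln 2" using ln_realpow[of 2 2] by simp
      moreover have "ln (5::real) = ln (5/4) + ln 4" by (simp add: ln_div)
      ultimately show "ln 5 \<le> (2::real)" "ln 4 \<le> (2::real)" using ln2_le_25_over_36 by linarith+
    qed
    have part1: "\<kappa> \<le> ereal (L + 20 * e)"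
    proof -
      obtain S' where S': "S \<subseteq> S'" "S' \<subseteq> {..<N}" "card S' = n"
        using exists_subset_between[of S n "{..<N}"] S nN fin by (auto simp: n_def)
      have I: "interpolation_constant (unit_root N ` S') \<le> (2 * sqrt (real N) * ?E)\<^sup>2"
        using interpolation_constant_le[of S' N] S' nlt by (simp add: power_mult_distrib)
      have "\<kappa> \<le> ereal (ln (real N) / 2 + ln (2 * sqrt (real N) * ?E))"
        unfolding \<kappa>_def using N E
        by (intro ln_condition_number_fourier_le[OF S b T(2) N n_def S' I]) auto
      also have "ln (2 * sqrt (real N) * ?E) = ln 2 + ln (real N) / 2 + ln ?E"
        using N E by (simp add: ln_mult ln_sqrt)
      also have "ln (real N) / 2 + (ln 2 + ln (real N) / 2 + ln ?E) \<le> L + 20 * e"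
        using key ln_small e1 by linarith
      finally show ?thesis by simp
    qed
    have part2: "\<kappa> \<le> ereal (L - 1 / 2 * ln (real N) + 20 * e)" if cS: "cyclically_contiguous N S"
    proof -
      obtain a' where a': "S = cyclic_arc N a' (card S)" using cyclically_contiguous_arc[OF S(1) N cS] .
      define S' where "S' = cyclic_arc N a' n"
      have S': "S \<subseteq> S'" "S' \<subseteq> {..<N}" "card S' = n"
        using arc_mono[of "card S" n N a'] a' arc_subset[OF N] card_arc[OF nN] by (auto simp: S'_def n_def)
      have I: "interpolation_constant (unit_root N ` S') \<le> (sqrt 5 * ?E)\<^sup>2"
        using interpolation_constant_arc_le[of "unit_root N a'" n N] nlt
        by (simp add: power_mult_distrib S'_def unit_root_image_arc)
      have "\<kappa> \<le> ereal (ln (real N) / 2 + ln (sqrt 5 * ?E))"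
        unfolding \<kappa>_def using E
        by (intro ln_condition_number_fourier_le[OF S b T(2) N n_def S' I]) auto
      also have "ln (sqrt 5 * ?E) = ln 5 / 2 + ln ?E"
        using E by (simp add: ln_mult ln_sqrt)
      also have "ln (real N) / 2 + (ln 5 / 2 + ln ?E) \<le> L - 1 / 2 * ln (real N) + 20 * e"
        using key ln_small e1 by linarith
      finally show ?thesis by simp
    qed
    have part3: "ereal (L - 1 / 2 * ln (real N) - 20 * e) \<le> \<kappa>"
      if cS: "cyclically_contiguous N S" and eq: "card S = card T"
    proof -
      obtain a' where a': "S = cyclic_arc N a' (card S)" using cyclically_contiguous_arc[OF S(1) N cS] .
      have "card S = n" "card T = n" using eq by (auto simp: n_def)
      then have arcs: "S = cyclic_arc N a' n" "T = cyclic_arc N b n" using a' b by auto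
      have c: "4 * (\<alpha> * (1 - \<alpha>)) \<le> chord N n" using chord_ge[OF n1 nlt] by (simp add: an)
      have cpos: "0 < chord N n" using chord_pos n1 nlt by simp
      have "ln 4 + ln (\<alpha> * (1 - \<alpha>)) = ln (4 * (\<alpha> * (1 - \<alpha>)))" using pos by (subst ln_mult) auto
      also have "\<dots> \<le> ln (chord N n)" using c pos by (subst ln_le_cancel_iff) auto
      finally have lc: "ln 4 - e \<le> ln (chord N n)" by (simp add: e_def)
      have lna: "- e \<le> ln \<alpha>"
      proof -
        have "ln (\<alpha> * (1 - \<alpha>)) \<le> ln \<alpha>" using a pos by (subst ln_le_cancel_iff) (auto simp: mult_le_cancel_left1)
        then show ?thesis by (simp add: e_def)
      qed
      have lnn: "ln (real n) = ln \<alpha> + ln (real N)" using n1 N by (simp add: an ln_div)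
      have "ln (16::real) = 2 * ln 4" using ln_realpow[of 4 2] by simp
      moreover have "ln (chord N n * ?E / 16) = ln (chord N n) + ln ?E - ln 16"
        using cpos E by (simp add: ln_div ln_mult)
      moreover have "L - ln (real N) - 10 * e \<le> ln ?E" using key by linarith
      ultimately have "L - ln (real N) - 10 * e - e - ln 4 \<le> ln (chord N n * ?E / 16)"
        using lc by linarith
      moreover have "ln (real N) / 2 - e / 2 \<le> ln (real n) / 2" using lnn lna by linarith
      ultimately have "L - 1 / 2 * ln (real N) - 20 * e \<le> ln (real n) / 2 + ln (chord N n * ?E / 16)"
        using ln_small e1 by linarith
      also have "ereal \<dots> \<le> \<kappa>" unfolding \<kappa>_def by (rule ln_condition_number_fourier_ge[OF arcs n1 nlt])
      finally show ?thesis by simp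
    qed
    have p3: "\<bar>\<kappa> - ereal (L - 1 / 2 * ln (real N))\<bar> \<le> ereal (20 * e)"
      if cS: "cyclically_contiguous N S" and eq: "card S = card T"
      using part2[OF cS] part3[OF cS eq] by (cases \<kappa>) auto
    show ?thesis unfolding err using part1 part2 p3 by simp
  qed
  show "ln_ereal (condition_number (submatrix (fourier_matrix N) S T))
           \<le> ereal (log_cot_term N \<alpha>) + ereal 20 * log_error \<alpha>"
    using main by (simp add: \<kappa>_def L_def)
  show "ln_ereal (condition_number (submatrix (fourier_matrix N) S T))
              \<le> ereal (log_cot_term N \<alpha> - 1 / 2 * ln (real N)) + ereal 20 * log_error \<alpha>"
    if "cyclically_contiguous N S"
    using main that by (simp add: \<kappa>_def L_def)
  show "\<bar>ln_ereal (condition_number (submatrix (fourier_matrix N) S T))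
               - ereal (log_cot_term N \<alpha> - 1 / 2 * ln (real N))\<bar>
              \<le> ereal 20 * log_error \<alpha>"
    if "cyclically_contiguous N S \<and> card S = card T"
    using main that by (simp add: \<kappa>_def L_def)
qed

end
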